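(* Let $A$ be a finite dimensional $k$-algebra with identity, $k=\overline{\mathbb F}_q$, with a Frobenius morphism $F_A$ and fixed-point algebra $A^F$. Then there is a one-to-one correspondence between the isomorphism classes of indecomposable $A^F$-modules and the $F$-orbits of the isomorphism classes of indecomposable $A$-modules.
   Context: Let $q$ be a prime power and $k=\overline{\mathbb F}_q$. All modules are left modules, finite dimensional over the base field. A Frobenius map on a $k$-vector space $V$ is an $\mathbb F_q$-linear isomorphism $F:V\to V$ with $F(\lambda v)=\lambda^qF(v)$ ($\lambda\in k$, $v\in V$) such that for every $v$ there is $n>0$ with $F^n(v)=v$. A Frobenius morphism on a $k$-algebra $A$ is a Frobenius map $F_A$ on $A$ that is also an $\mathbb F_q$-algebra isomorphism with $F_A(1)=1$; $A^F=\{a\in A:F_A(a)=a\}$. Frobenius twist: for an $A$-module $M$ choose any Frobenius map $F_M$ on the underlying vector space; $M^{[1]}$ is the same vector space with action $a*m=F_M(F_A^{-1}(a)F_M^{-1}(m))$. Up to isomorphism $M^{[1]}$ does not depend on $F_M$, and $[M]\mapsto[M^{[1]}]$ is a permutation of the set of isomorphism classes of (indecomposable) $A$-modules. The $F$-orbits are the orbits of this permutation. *)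

theory Defs
  imports
    "HOL-Algebra.Algebraic_Closure"
    "HOL-Algebra.AbelCoset"
    "HOL-Library.Infinite_Typeclass"
    "HOL-Number_Theory.Prime_Powers"
    "Jordan_Normal_Form.Missing_VectorSpace"
begin

section \<open>Finite dimensional algebras and their modules\<close>

text \<open>
  The \<open>algebra\<close> locale of HOL-Algebra is for commutative algebras only. The
  algebras below are associative with identity, but not necessarily commutative.
\<close>

locale fd_algebra = vectorspace K A + A: ring A for K and A +
  assumes smult_mult_left:
      "\<lbrakk>c \<in> carrier K; a \<in> carrier A; b \<in> carrier A\<rbrakk>
        \<Longrightarrow> (c \<odot>\<^bsub>A\<^esub> a) \<otimes>\<^bsub>A\<^esub> b = c \<odot>\<^bsub>A\<^esub> (a \<otimes>\<^bsub>A\<^esub> b)"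
    and smult_mult_right:
      "\<lbrakk>c \<in> carrier K; a \<in> carrier A; b \<in> carrier A\<rbrakk>
        \<Longrightarrow> a \<otimes>\<^bsub>A\<^esub> (c \<odot>\<^bsub>A\<^esub> b) = c \<odot>\<^bsub>A\<^esub> (a \<otimes>\<^bsub>A\<^esub> b)"
    and finite_dimensional: "fin_dim"

text \<open>
  A module over a \<open>K\<close>-algebra is a \<open>K\<close>-vector space together with an action of the algebra.
  The fields \<open>mult\<close> and \<open>one\<close>, which the record type \<open>module\<close> inherits from
  \<open>ring\<close>, play no role.
\<close>

record ('k, 'm, 'a) alg_module = "('k, 'm) module" +
  act :: "'a \<Rightarrow> 'm \<Rightarrow> 'm"

locale fd_module = vectorspace K M
  for K and A :: "('k, 'a, 'z) module_scheme" and M :: "('k, 'm, 'a) alg_module" +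
  assumes act_closed:
      "\<lbrakk>a \<in> carrier A; m \<in> carrier M\<rbrakk> \<Longrightarrow> act M a m \<in> carrier M"
    and act_add_left:
      "\<lbrakk>a \<in> carrier A; b \<in> carrier A; m \<in> carrier M\<rbrakk>
        \<Longrightarrow> act M (a \<oplus>\<^bsub>A\<^esub> b) m = act M a m \<oplus>\<^bsub>M\<^esub> act M b m"
    and act_add_right:
      "\<lbrakk>a \<in> carrier A; m \<in> carrier M; n \<in> carrier M\<rbrakk>
        \<Longrightarrow> act M a (m \<oplus>\<^bsub>M\<^esub> n) = act M a m \<oplus>\<^bsub>M\<^esub> act M a n"
    and act_smult_left:
      "\<lbrakk>c \<in> carrier K; a \<in> carrier A; m \<in> carrier M\<rbrakk>
        \<Longrightarrow> act M (c \<odot>\<^bsub>A\<^esub> a) m = c \<odot>\<^bsub>M\<^esub> act M a m"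
    and act_smult_right:
      "\<lbrakk>c \<in> carrier K; a \<in> carrier A; m \<in> carrier M\<rbrakk>
        \<Longrightarrow> act M a (c \<odot>\<^bsub>M\<^esub> m) = c \<odot>\<^bsub>M\<^esub> act M a m"
    and act_mult:
      "\<lbrakk>a \<in> carrier A; b \<in> carrier A; m \<in> carrier M\<rbrakk>
        \<Longrightarrow> act M (a \<otimes>\<^bsub>A\<^esub> b) m = act M a (act M b m)"
    and act_one:
      "m \<in> carrier M \<Longrightarrow> act M \<one>\<^bsub>A\<^esub> m = m"
    and finite_dimensional: "fin_dim"

definition alg_module_iso ::
  "('k, 'r) ring_scheme \<Rightarrow> ('k, 'a, 'z) module_scheme \<Rightarrow>
    ('k, 'm, 'a) alg_module \<Rightarrow> ('k, 'n, 'a) alg_module \<Rightarrow> ('m \<Rightarrow> 'n) set" where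
  "alg_module_iso K A M N =
    {f \<in> module_hom K M N. bij_betw f (carrier M) (carrier N) \<and>
       (\<forall>a \<in> carrier A. \<forall>m \<in> carrier M. f (act M a m) = act N a (f m))}"

definition alg_submodule ::
  "('k, 'r) ring_scheme \<Rightarrow> ('k, 'a, 'z) module_scheme \<Rightarrow> 'm set \<Rightarrow>
    ('k, 'm, 'a) alg_module \<Rightarrow> bool" where
  "alg_submodule K A N M \<longleftrightarrow>
     subspace K N M \<and> (\<forall>a \<in> carrier A. \<forall>n \<in> N. act M a n \<in> N)"

definition indecomposable ::
  "('k, 'r) ring_scheme \<Rightarrow> ('k, 'a, 'z) module_scheme \<Rightarrow> ('k, 'm, 'a) alg_module \<Rightarrow> bool" where
  "indecomposable K A M \<longleftrightarrow>
     carrier M \<noteq> {\<zero>\<^bsub>M\<^esub>} \<and>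
     (\<forall>N\<^sub>1 N\<^sub>2. alg_submodule K A N\<^sub>1 M \<and> alg_submodule K A N\<^sub>2 M \<and>
        N\<^sub>1 <+>\<^bsub>M\<^esub> N\<^sub>2 = carrier M \<and> N\<^sub>1 \<inter> N\<^sub>2 = {\<zero>\<^bsub>M\<^esub>}
        \<longrightarrow> N\<^sub>1 = {\<zero>\<^bsub>M\<^esub>} \<or> N\<^sub>2 = {\<zero>\<^bsub>M\<^esub>})"

text \<open>
  Isomorphism classes are taken among the modules whose carrier is a subset of the type
  \<open>'m\<close>. Over a countable field a finite dimensional vector space is countable, so as soon
  as \<open>'m\<close> is infinite every finite dimensional module has an isomorphic copy there.
\<close>

definition iso_class ::
  "('k, 'r) ring_scheme \<Rightarrow> ('k, 'a, 'z) module_scheme \<Rightarrow>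
    ('k, 'm, 'a) alg_module \<Rightarrow> ('k, 'm, 'a) alg_module set" where
  "iso_class K A M = {N. fd_module K A N \<and> alg_module_iso K A M N \<noteq> {}}"

definition indec_classes ::
  "('k, 'r) ring_scheme \<Rightarrow> ('k, 'a, 'z) module_scheme \<Rightarrow> ('k, 'm, 'a) alg_module set set" where
  "indec_classes K A = {iso_class K A M | M. fd_module K A M \<and> indecomposable K A M}"


section \<open>Frobenius maps, Frobenius morphisms and Frobenius twists\<close>

text \<open>Here \<open>Fq\<close> is a finite subfield of \<open>K\<close>, given as a subset of its carrier.\<close>

definition frobenius_map ::
  "('k, 'r) ring_scheme \<Rightarrow> 'k set \<Rightarrow> ('k, 'v, 'z) module_scheme \<Rightarrow> ('v \<Rightarrow> 'v) set" where
  "frobenius_map K Fq V =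
    {F \<in> module_hom (K\<lparr>carrier := Fq\<rparr>) V V. bij_betw F (carrier V) (carrier V) \<and>
       (\<forall>c \<in> carrier K. \<forall>v \<in> carrier V. F (c \<odot>\<^bsub>V\<^esub> v) = (c [^]\<^bsub>K\<^esub> card Fq) \<odot>\<^bsub>V\<^esub> F v) \<and>
       (\<forall>v \<in> carrier V. \<exists>n>0. (F ^^ n) v = v)}"

definition frobenius_morphism ::
  "('k, 'r) ring_scheme \<Rightarrow> 'k set \<Rightarrow> ('k, 'a, 'z) module_scheme \<Rightarrow> ('a \<Rightarrow> 'a) set" where
  "frobenius_morphism K Fq A = frobenius_map K Fq A \<inter> ring_iso A A"

definition fixed_algebra ::
  "('k, 'a, 'z) module_scheme \<Rightarrow> ('a \<Rightarrow> 'a) \<Rightarrow> ('k, 'a, 'z) module_scheme" where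
  "fixed_algebra A F = A\<lparr>carrier := {a \<in> carrier A. F a = a}\<rparr>"

definition twist ::
  "('k, 'a, 'z) module_scheme \<Rightarrow> ('a \<Rightarrow> 'a) \<Rightarrow> ('m \<Rightarrow> 'm) \<Rightarrow>
    ('k, 'm, 'a) alg_module \<Rightarrow> ('k, 'm, 'a) alg_module" where
  "twist A F\<^sub>A F\<^sub>M M =
     M\<lparr>act := \<lambda>a m. F\<^sub>M (act M (inv_into (carrier A) F\<^sub>A a) (inv_into (carrier M) F\<^sub>M m))\<rparr>"

text \<open>
  The operation induced by the twist on isomorphism classes, taking all representatives
  and all Frobenius maps on them at once.
\<close>

definition twist_class ::
  "('k, 'r) ring_scheme \<Rightarrow> 'k set \<Rightarrow> ('k, 'a, 'z) module_scheme \<Rightarrow> ('a \<Rightarrow> 'a) \<Rightarrow>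
    ('k, 'm, 'a) alg_module set \<Rightarrow> ('k, 'm, 'a) alg_module set" where
  "twist_class K Fq A F\<^sub>A C =
     (\<Union>M \<in> C. \<Union>F\<^sub>M \<in> frobenius_map K Fq M. iso_class K A (twist A F\<^sub>A F\<^sub>M M))"

text \<open>
  For a permutation \<open>T\<close> of \<open>S\<close>, the element \<open>y\<close> lies in the orbit of \<open>x\<close> iff
  \<open>y\<close> is the image of \<open>x\<close> under some integer power of \<open>T\<close>; the second disjunct
  covers the negative powers.
\<close>

definition permutation_orbits :: "('x \<Rightarrow> 'x) \<Rightarrow> 'x set \<Rightarrow> 'x set set" where
  "permutation_orbits T S = {{y \<in> S. \<exists>n. (T ^^ n) x = y \<or> (T ^^ n) y = x} | x. x \<in> S}"

definition frobenius_orbits ::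
  "('k, 'r) ring_scheme \<Rightarrow> 'k set \<Rightarrow> ('k, 'a, 'z) module_scheme \<Rightarrow> ('a \<Rightarrow> 'a) \<Rightarrow>
    ('k, 'm, 'a) alg_module set set set" where
  "frobenius_orbits K Fq A F\<^sub>A = permutation_orbits (twist_class K Fq A F\<^sub>A) (indec_classes K A)"

end

theory Submission
  imports Defs "HOL-Library.Countable_Set"
begin

text \<open>
  Write \<open>B\<close> for the algebra of fixed points. An indecomposable \<open>B\<close>-module \<open>N\<close> is matched with the
  indecomposable \<open>A\<close>-modules \<open>M\<close> whose restriction to \<open>B\<close>, which is infinite dimensional, has \<open>N\<close> as
  a direct summand. A Frobenius map of \<open>M\<close> is an isomorphism of the restrictions of \<open>M\<close> and of its
  twist, so this relation is invariant under twisting.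

  Some power of a Frobenius map is compatible with the action on \<open>M\<close>; hence the sum \<open>W\<close> of finitely
  many twists of \<open>M\<close> carries a compatible Frobenius map, which permutes the summands. A separability
  idempotent of a finite subfield of \<open>k\<close> shows that \<open>W = k \<otimes> W\<^sup>F\<close> and that a finite local
  \<open>B\<close>-module which is a summand of \<open>W\<close> is already a summand of \<open>W\<^sup>F\<close>. So a summand \<open>N\<close> of the
  restriction of \<open>M\<close> gives a summand \<open>U = k \<otimes> N\<close> of \<open>W\<close>. By Krull-Schmidt, the indecomposable
  summands of \<open>U\<close> are twists of \<open>M\<close>, and, \<open>U\<close> being stable under the Frobenius map, \<open>M\<close> is one of
  them. Hence \<open>N\<close> is determined by \<open>M\<close>, and \<open>M\<close> by \<open>N\<close> up to twisting. The existence of \<open>M\<close> for a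
  given \<open>N\<close> uses a finite dimensional submodule of the coinduced module.
\<close>

subsection \<open>Linear algebra\<close>

text \<open>The classical route sends \<open>N\<close> to \<open>k \<otimes> N\<close> and
  decomposes it. Here no tensor product is formed: being a summand of the restriction of
  \<open>M\<close> involves only the given modules, and \<open>k \<otimes> N\<close> is recovered as
  a submodule of a sum of twists. The obstacle is that restrictions are infinite dimensional over
  \<open>Fq\<close>, out of reach of the usual Krull-Schmidt theorem. What survives is the exchange
  property of a single summand with local endomorphism ring: if its identity is a sum of maps that
  factor through various modules, one of these maps is bijective, whatever the ambient module. Hence
  summands are handled as retracts, pairs \<open>i\<close>, \<open>p\<close> with
  \<open>p (i x) = x\<close>; retracts compose, and they compare modules over different fields and
  on different types. Scalars are absorbed into the action, since \<open>c\<close> acts as the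
  algebra element \<open>c 1\<close>. A second constraint is that isomorphism classes live on a
  fixed infinite type, whereas the constructions produce modules of functions; countability of
  \<open>k\<close> permits transport back.\<close>

lemma (in abelian_group) diff_eq_zero_iff:
  assumes "x \<in> carrier G" "y \<in> carrier G"
  shows "x \<ominus> y = \<zero> \<longleftrightarrow> x = y"
  using assms by (metis a_minus_def add.inv_closed minus_equality r_neg minus_minus)

lemma (in abelian_group) diff_add_cancel:
  assumes "x \<in> carrier G" "y \<in> carrier G"
  shows "(x \<ominus> y) \<oplus> y = x"
  using assms by (simp add: a_minus_def a_assoc l_neg)

lemma additive_zero:
  assumes "abelian_group M" "abelian_group N" "f \<in> carrier M \<rightarrow> carrier N"
    and "\<And>x y. x \<in> carrier M \<Longrightarrow> y \<in> carrier M \<Longrightarrow> f (x \<oplus>\<^bsub>M\<^esub> y) = f x \<oplus>\<^bsub>N\<^esub> f y"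
  shows "f \<zero>\<^bsub>M\<^esub> = \<zero>\<^bsub>N\<^esub>"
proof -
  interpret M: abelian_group M by fact
  interpret N: abelian_group N by fact
  have c: "f \<zero>\<^bsub>M\<^esub> \<in> carrier N" using assms(3) by auto
  have "f \<zero>\<^bsub>M\<^esub> \<oplus>\<^bsub>N\<^esub> f \<zero>\<^bsub>M\<^esub> = f \<zero>\<^bsub>M\<^esub>" using assms(4)[of "\<zero>\<^bsub>M\<^esub>" "\<zero>\<^bsub>M\<^esub>"] by simp
  then show ?thesis using c by (metis N.add.r_cancel_one')
qed

lemma additive_diff:
  assumes "abelian_group M" "abelian_group N" "f \<in> carrier M \<rightarrow> carrier N"
    and "\<And>x y. x \<in> carrier M \<Longrightarrow> y \<in> carrier M \<Longrightarrow> f (x \<oplus>\<^bsub>M\<^esub> y) = f x \<oplus>\<^bsub>N\<^esub> f y"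
    and "x \<in> carrier M" "y \<in> carrier M"
  shows "f (x \<ominus>\<^bsub>M\<^esub> y) = f x \<ominus>\<^bsub>N\<^esub> f y"
proof -
  interpret M: abelian_group M by fact
  interpret N: abelian_group N by fact
  have c: "f (x \<ominus>\<^bsub>M\<^esub> y) \<in> carrier N" "f x \<in> carrier N" "f y \<in> carrier N" using assms by auto
  have "f (x \<ominus>\<^bsub>M\<^esub> y) \<oplus>\<^bsub>N\<^esub> f y = f x"
    using assms(4)[of "x \<ominus>\<^bsub>M\<^esub> y" y] assms(5,6) by (simp add: M.diff_add_cancel)
  then show ?thesis using c
    by (metis N.add.inv_closed N.add.inv_solve_right' N.minus_eq)
qed

lemma (in abelian_monoid) finsum_induct:
  assumes "finite S" "f \<in> S \<rightarrow> carrier G" "P \<zero>" "\<And>x. x \<in> S \<Longrightarrow> P (f x)"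
    and "\<And>u v. u \<in> carrier G \<Longrightarrow> v \<in> carrier G \<Longrightarrow> P u \<Longrightarrow> P v \<Longrightarrow> P (u \<oplus> v)"
  shows "P (finsum G f S)"
  using assms(1,2,4)
proof (induction S rule: finite_induct)
  case (insert x F)
  then have "finsum G f (insert x F) = f x \<oplus> finsum G f F"
    by (intro finsum_insert) auto
  moreover have "finsum G f F \<in> carrier G" "f x \<in> carrier G" using insert by (auto intro: finsum_closed)
  ultimately show ?case using insert assms(5) by auto
qed (simp add: assms)

lemma (in vectorspace) span_induct:
  assumes "v \<in> span L" "L \<subseteq> carrier V" "P \<zero>\<^bsub>V\<^esub>"
    and "\<And>c x. c \<in> carrier K \<Longrightarrow> x \<in> L \<Longrightarrow> P (c \<odot>\<^bsub>V\<^esub> x)"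
    and "\<And>u v. u \<in> carrier V \<Longrightarrow> v \<in> carrier V \<Longrightarrow> P u \<Longrightarrow> P v \<Longrightarrow> P (u \<oplus>\<^bsub>V\<^esub> v)"
  shows "P v"
proof -
  from assms(1) obtain a S where v: "v = lincomb a S" "finite S" "S \<subseteq> L" "a \<in> S \<rightarrow> carrier K"
    unfolding span_def by auto
  show ?thesis unfolding v(1) lincomb_def
    by (rule M.finsum_induct) (use v assms in \<open>auto simp: Pi_iff subset_iff\<close>)
qed

lemma (in vectorspace) span_least:
  assumes "L \<subseteq> W" "subspace K W V"
  shows "span L \<subseteq> W"
  using assms span_is_subset is_module by blast

text \<open>Independence in \<open>W\<close> agrees with independence in \<open>V\<close>, so
  independent subsets of \<open>W\<close> are bounded by \<open>dim\<close> and a maximal one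
  exists; it is a basis of \<open>W\<close>. If it has \<open>dim\<close> elements, it is also a
  basis of \<open>V\<close>.\<close>

lemma (in vectorspace) subspace_finite:
  assumes fd: "fin_dim" and W: "subspace K W V"
  shows "vectorspace.fin_dim K (vs W)"
    and "vectorspace.dim K (vs W) \<le> dim"
    and "vectorspace.dim K (vs W) = dim \<Longrightarrow> W = carrier V"
proof -
  interpret W: vectorspace K "vs W" by (rule subspace_is_vs[OF W])
  have sm: "submodule K W V" using W by (simp add: is_module)
  have WV: "W \<subseteq> carrier V" using sm by (simp add: submodule_def)
  have li: "S \<subseteq> W \<Longrightarrow> W.lin_dep S = lin_dep S" for S
    using span_li_not_depend(2)[OF _ sm] by blast
  have "\<exists>L. finite L \<and> maximal L (\<lambda>S. S \<subseteq> W \<and> lin_indpt S)"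
  proof (rule maximal_exists)
    show "{} \<subseteq> W \<and> lin_indpt {}" by (auto simp: lin_dep_def)
    show "A \<subseteq> W \<and> lin_indpt A \<Longrightarrow> finite A \<and> card A \<le> dim" for A
      using li_le_dim[OF fd] WV by blast
  qed
  then obtain L where L: "finite L" "maximal L (\<lambda>S. S \<subseteq> W \<and> lin_indpt S)" by blast
  then have XW: "L \<subseteq> W" "lin_indpt L" by (auto simp: maximal_def)
  have "maximal L (\<lambda>S. S \<subseteq> carrier (vs W) \<and> W.lin_indpt S)"
    using L(2) li unfolding maximal_def by auto
  then have b: "W.basis L" by (rule W.max_li_is_basis)
  then show fdW: "W.fin_dim" using L(1) unfolding W.fin_dim_def W.basis_def by blast
  have d: "W.dim = card L" using W.dim_basis[OF L(1) b] .
  show "W.dim \<le> dim" using d li_le_dim[OF fd _ XW(2)] XW WV by auto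
  show "W = carrier V" if "W.dim = dim"
  proof -
    have "basis L" by (rule dim_li_is_basis[OF fd L(1)]) (use XW WV d that in auto)
    then have "span L = carrier V" by (simp add: basis_def)
    with span_least[OF XW(1) W] WV show ?thesis by auto
  qed
qed

subsection \<open>Maps commuting with a set of operators\<close>

text \<open>Scalars are absent and the two scalar types may differ, so one notion covers
  homomorphisms of \<open>A\<close>-modules, of \<open>B\<close>-modules, and from a
  \<open>B\<close>-module over \<open>Fq\<close> into the restriction of an \<open>A\<close>-module.
  Linearity is regained from the operators \<open>c 1\<close> in
  \<open>act_hom_smult\<close>.\<close>

definition act_hom :: "'a set \<Rightarrow> ('k, 'm, 'a) alg_module \<Rightarrow> ('l, 'n, 'a) alg_module \<Rightarrow> ('m \<Rightarrow> 'n) set" where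
  "act_hom S M N = {f \<in> carrier M \<rightarrow> carrier N.
     (\<forall>x \<in> carrier M. \<forall>y \<in> carrier M. f (x \<oplus>\<^bsub>M\<^esub> y) = f x \<oplus>\<^bsub>N\<^esub> f y) \<and>
     (\<forall>a \<in> S. \<forall>x \<in> carrier M. f (act M a x) = act N a (f x))}"

lemma act_homI:
  assumes "\<And>x. x \<in> carrier M \<Longrightarrow> f x \<in> carrier N"
    and "\<And>x y. x \<in> carrier M \<Longrightarrow> y \<in> carrier M \<Longrightarrow> f (x \<oplus>\<^bsub>M\<^esub> y) = f x \<oplus>\<^bsub>N\<^esub> f y"
    and "\<And>a x. a \<in> S \<Longrightarrow> x \<in> carrier M \<Longrightarrow> f (act M a x) = act N a (f x)"
  shows "f \<in> act_hom S M N"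
  using assms by (auto simp: act_hom_def)

lemma act_homD:
  assumes "f \<in> act_hom S M N"
  shows "f \<in> carrier M \<rightarrow> carrier N"
    and "\<And>x. x \<in> carrier M \<Longrightarrow> f x \<in> carrier N"
    and "\<And>x y. x \<in> carrier M \<Longrightarrow> y \<in> carrier M \<Longrightarrow> f (x \<oplus>\<^bsub>M\<^esub> y) = f x \<oplus>\<^bsub>N\<^esub> f y"
    and "\<And>a x. a \<in> S \<Longrightarrow> x \<in> carrier M \<Longrightarrow> f (act M a x) = act N a (f x)"
  using assms by (auto simp: act_hom_def)

lemma act_hom_mono: "S \<subseteq> T \<Longrightarrow> act_hom T M N \<subseteq> act_hom S M N"
  by (auto simp: act_hom_def)

lemma act_hom_id: "(\<lambda>x. x) \<in> act_hom S M M"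
  by (auto simp: act_hom_def)

lemma act_hom_comp: "f \<in> act_hom S M N \<Longrightarrow> g \<in> act_hom S N P \<Longrightarrow> (\<lambda>x. g (f x)) \<in> act_hom S M P"
  by (auto simp: act_hom_def Pi_iff)

lemma act_hom_funpow:
  assumes "f \<in> act_hom S M M" shows "f ^^ n \<in> act_hom S M M"
proof (induction n)
  case 0 show ?case by (auto simp: act_hom_def)
next
  case (Suc n) show ?case using act_hom_comp[OF Suc assms] by (simp add: comp_def)
qed

lemma act_hom_zero:
  "\<lbrakk>f \<in> act_hom S M N; abelian_group M; abelian_group N\<rbrakk> \<Longrightarrow> f \<zero>\<^bsub>M\<^esub> = \<zero>\<^bsub>N\<^esub>"
  by (rule additive_zero) (auto dest: act_homD)

lemma act_hom_diff:
  "\<lbrakk>f \<in> act_hom S M N; abelian_group M; abelian_group N; x \<in> carrier M; y \<in> carrier M\<rbrakk>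
    \<Longrightarrow> f (x \<ominus>\<^bsub>M\<^esub> y) = f x \<ominus>\<^bsub>N\<^esub> f y"
  by (rule additive_diff) (auto dest: act_homD)

lemma act_hom_inv:
  assumes f: "f \<in> act_hom S M N" and b: "bij_betw f (carrier M) (carrier N)" and M: "abelian_group M"
    and cl: "\<And>a x. a \<in> S \<Longrightarrow> x \<in> carrier M \<Longrightarrow> act M a x \<in> carrier M"
  shows "inv_into (carrier M) f \<in> act_hom S N M"
proof -
  interpret M: abelian_group M by fact
  let ?g = "inv_into (carrier M) f"
  have g: "?g y \<in> carrier M" "f (?g y) = y" if "y \<in> carrier N" for y
    using b that by (auto simp: bij_betw_def inv_into_into f_inv_into_f)
  have gi: "?g y = x" if "f x = y" "x \<in> carrier M" for x y
    using b that by (auto simp: bij_betw_def)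
  show ?thesis
  proof (rule act_homI)
    show "?g (x \<oplus>\<^bsub>N\<^esub> y) = ?g x \<oplus>\<^bsub>M\<^esub> ?g y" if "x \<in> carrier N" "y \<in> carrier N" for x y
      by (rule gi) (use that g act_homD(3)[OF f] in auto)
    show "?g (act N a x) = act M a (?g x)" if "a \<in> S" "x \<in> carrier N" for a x
      by (rule gi) (use that g act_homD(4)[OF f] cl in auto)
  qed (use g in auto)
qed

section \<open>Direct summands as retracts, and local endomorphism rings\<close>

definition retract :: "'a set \<Rightarrow> ('k, 'm, 'a) alg_module \<Rightarrow> ('l, 'n, 'a) alg_module \<Rightarrow> bool" where
  "retract S L Y \<longleftrightarrow> (\<exists>i \<in> act_hom S L Y. \<exists>p \<in> act_hom S Y L. \<forall>x \<in> carrier L. p (i x) = x)"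

lemma retractI:
  "\<lbrakk>i \<in> act_hom S L Y; p \<in> act_hom S Y L; \<And>x. x \<in> carrier L \<Longrightarrow> p (i x) = x\<rbrakk> \<Longrightarrow> retract S L Y"
  by (auto simp: retract_def)

lemma retract_trans:
  assumes "retract S L Y" "retract S Y Z" shows "retract S L Z"
proof -
  obtain i p where 1: "i \<in> act_hom S L Y" "p \<in> act_hom S Y L" "\<forall>x \<in> carrier L. p (i x) = x"
    using assms(1) by (auto simp: retract_def)
  obtain j r where 2: "j \<in> act_hom S Y Z" "r \<in> act_hom S Z Y" "\<forall>x \<in> carrier Y. r (j x) = x"
    using assms(2) by (auto simp: retract_def)
  show ?thesis
    by (rule retractI[OF act_hom_comp[OF 1(1) 2(1)] act_hom_comp[OF 2(2) 1(2)]])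
      (use 1 2 act_homD(2)[OF 1(1)] in auto)
qed

lemma retract_refl: "retract S L L"
  by (rule retractI[OF act_hom_id act_hom_id]) auto

lemma retract_mono: "S \<subseteq> T \<Longrightarrow> retract T L Y \<Longrightarrow> retract S L Y"
  unfolding retract_def using act_hom_mono[of S T L Y] act_hom_mono[of S T Y L] by blast

lemma retract_iso:
  assumes "f \<in> act_hom S M N" "bij_betw f (carrier M) (carrier N)" "abelian_group M"
    and "\<And>a x. a \<in> S \<Longrightarrow> x \<in> carrier M \<Longrightarrow> act M a x \<in> carrier M"
  shows "retract S M N" "retract S N M"
  using act_hom_inv[OF assms] assms(1,2)
  by (auto intro!: retractI[of f _ _ _ "inv_into (carrier M) f"] retractI[of "inv_into (carrier M) f" _ _ _ f]
      simp: bij_betw_def f_inv_into_f)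

text \<open>Locality of the endomorphism ring, in the form that a sum of two endomorphisms is an
  automorphism only if one of them is.\<close>

definition act_local :: "'a set \<Rightarrow> ('k, 'm, 'a) alg_module \<Rightarrow> bool" where
  "act_local S L \<longleftrightarrow> abelian_group L \<and> carrier L \<noteq> {\<zero>\<^bsub>L\<^esub>} \<and>
     (\<forall>a \<in> S. \<forall>x \<in> carrier L. act L a x \<in> carrier L) \<and>
     (\<forall>f \<in> act_hom S L L. \<forall>g \<in> act_hom S L L.
        bij_betw (\<lambda>x. f x \<oplus>\<^bsub>L\<^esub> g x) (carrier L) (carrier L) \<longrightarrow>
        bij_betw f (carrier L) (carrier L) \<or> bij_betw g (carrier L) (carrier L))"

lemma act_localD:
  "\<lbrakk>act_local S L; f \<in> act_hom S L L; g \<in> act_hom S L L;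
     bij_betw (\<lambda>x. f x \<oplus>\<^bsub>L\<^esub> g x) (carrier L) (carrier L)\<rbrakk>
    \<Longrightarrow> bij_betw f (carrier L) (carrier L) \<or> bij_betw g (carrier L) (carrier L)"
  unfolding act_local_def by blast

text \<open>The map \<open>v\<close>, followed by the inverse of \<open>v u\<close>, is a left
  inverse of \<open>u\<close>. Since \<open>Z\<close> is arbitrary, this exchange step also works
  inside infinite dimensional modules.\<close>

lemma retract_of_bij:
  assumes L: "act_local S L" and u: "u \<in> act_hom S L Z" and v: "v \<in> act_hom S Z L"
    and b: "bij_betw (\<lambda>x. v (u x)) (carrier L) (carrier L)"
  shows "retract S L Z"
proof -
  have f: "(\<lambda>x. v (u x)) \<in> act_hom S L L" by (rule act_hom_comp[OF u v])
  have g: "inv_into (carrier L) (\<lambda>x. v (u x)) \<in> act_hom S L L"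
    by (rule act_hom_inv[OF f b]) (use L in \<open>auto simp: act_local_def\<close>)
  show ?thesis
  proof (rule retractI[OF u act_hom_comp[OF v g]])
    fix x assume "x \<in> carrier L"
    then show "inv_into (carrier L) (\<lambda>x. v (u x)) (v (u x)) = x"
      using b unfolding bij_betw_def by (metis (no_types, lifting) inv_into_f_f)
  qed
qed

text \<open>The identity \<open>p i\<close> of \<open>L\<close> is the sum of two endomorphisms, one
  through \<open>Z1\<close> and one through \<open>Z2\<close>; locality makes one of them
  bijective.\<close>

lemma retract_split:
  assumes L: "act_local S L" and r: "retract S L Y"
    and s1: "s1 \<in> act_hom S Y Z1" and r1: "r1 \<in> act_hom S Z1 Y"
    and s2: "s2 \<in> act_hom S Y Z2" and r2: "r2 \<in> act_hom S Z2 Y"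
    and sum: "\<And>y. y \<in> carrier Y \<Longrightarrow> r1 (s1 y) \<oplus>\<^bsub>Y\<^esub> r2 (s2 y) = y"
  shows "retract S L Z1 \<or> retract S L Z2"
proof -
  obtain i p where ip: "i \<in> act_hom S L Y" "p \<in> act_hom S Y L" "\<forall>x \<in> carrier L. p (i x) = x"
    using r by (auto simp: retract_def)
  note is1 = act_hom_comp[OF ip(1) s1] and is2 = act_hom_comp[OF ip(1) s2]
    and rp1 = act_hom_comp[OF r1 ip(2)] and rp2 = act_hom_comp[OF r2 ip(2)]
  note f1 = act_hom_comp[OF is1 rp1] and f2 = act_hom_comp[OF is2 rp2]
  have "p (r1 (s1 (i x))) \<oplus>\<^bsub>L\<^esub> p (r2 (s2 (i x))) = x" if x: "x \<in> carrier L" for x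
  proof -
    have ix: "i x \<in> carrier Y" using ip x by (auto dest: act_homD)
    have "p (r1 (s1 (i x))) \<oplus>\<^bsub>L\<^esub> p (r2 (s2 (i x))) = p (r1 (s1 (i x)) \<oplus>\<^bsub>Y\<^esub> r2 (s2 (i x)))"
      using act_homD(3)[OF ip(2)] ix act_homD(2)[OF s1] act_homD(2)[OF s2] act_homD(2)[OF r1] act_homD(2)[OF r2]
      by auto
    then show ?thesis using sum[OF ix] ip x by auto
  qed
  then have "bij_betw (\<lambda>x. p (r1 (s1 (i x))) \<oplus>\<^bsub>L\<^esub> p (r2 (s2 (i x)))) (carrier L) (carrier L)"
    by (subst bij_betw_cong[where g = "\<lambda>x. x"]) (auto simp: bij_betw_def)
  then have "bij_betw (\<lambda>x. p (r1 (s1 (i x)))) (carrier L) (carrier L) \<or>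
      bij_betw (\<lambda>x. p (r2 (s2 (i x)))) (carrier L) (carrier L)"
    by (rule act_localD[OF L f1 f2])
  then show ?thesis
    using retract_of_bij[OF L is1 rp1] retract_of_bij[OF L is2 rp2] by blast
qed


subsection \<open>Indecomposable modules\<close>

text \<open>\<open>fd_module\<close> says nothing about \<open>A\<close> itself; once
  \<open>1\<close> and the multiples \<open>c a\<close> are known to lie in \<open>A\<close>,
  scalars act through \<open>A\<close>. Both \<open>A\<close> over \<open>k\<close> and
  \<open>B\<close> over \<open>Fq\<close> are instances, so the results below serve both.\<close>

locale unital_fd_module = fd_module +
  assumes one_in: "\<one>\<^bsub>A\<^esub> \<in> carrier A"
    and smult_in: "c \<in> carrier K \<Longrightarrow> a \<in> carrier A \<Longrightarrow> c \<odot>\<^bsub>A\<^esub> a \<in> carrier A"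
begin

lemma smult_as_act:
  assumes "c \<in> carrier K" "m \<in> carrier M"
  shows "c \<odot>\<^bsub>M\<^esub> m = act M (c \<odot>\<^bsub>A\<^esub> \<one>\<^bsub>A\<^esub>) m"
  using assms by (simp add: act_smult_left one_in act_one)

lemma alg_submoduleI:
  assumes "N \<subseteq> carrier M" "\<zero>\<^bsub>M\<^esub> \<in> N" "\<And>x y. x \<in> N \<Longrightarrow> y \<in> N \<Longrightarrow> x \<oplus>\<^bsub>M\<^esub> y \<in> N"
    and "\<And>a x. a \<in> carrier A \<Longrightarrow> x \<in> N \<Longrightarrow> act M a x \<in> N"
  shows "alg_submodule K A N M"
proof -
  have "submodule K N M"
  proof (unfold_locales)
    show "c \<odot>\<^bsub>M\<^esub> v \<in> N" if "c \<in> carrier K" "v \<in> N" for c v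
      using that assms smult_as_act[of c v] smult_in[OF that(1) one_in] by auto
  qed (use assms in auto)
  then show ?thesis
    unfolding alg_submodule_def subspace_def using assms(4) vectorspace_axioms by auto
qed

lemma alg_submoduleD:
  assumes "alg_submodule K A N M"
  shows "subspace K N M" "N \<subseteq> carrier M" "\<zero>\<^bsub>M\<^esub> \<in> N" "\<And>x y. x \<in> N \<Longrightarrow> y \<in> N \<Longrightarrow> x \<oplus>\<^bsub>M\<^esub> y \<in> N"
    "\<And>a x. a \<in> carrier A \<Longrightarrow> x \<in> N \<Longrightarrow> act M a x \<in> N"
    "\<And>x. x \<in> N \<Longrightarrow> \<ominus>\<^bsub>M\<^esub> x \<in> N"
    "\<And>x y. x \<in> N \<Longrightarrow> y \<in> N \<Longrightarrow> x \<ominus>\<^bsub>M\<^esub> y \<in> N"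
proof -
  show 1: "subspace K N M" using assms by (simp add: alg_submodule_def)
  then have 2: "submodule K N M" by (simp add: subspace_def)
  interpret submodule K N M by (rule 2)
  show N: "N \<subseteq> carrier M" by (rule subset)
  show "\<zero>\<^bsub>M\<^esub> \<in> N" by simp
  show add: "\<And>x y. x \<in> N \<Longrightarrow> y \<in> N \<Longrightarrow> x \<oplus>\<^bsub>M\<^esub> y \<in> N" by simp
  show "\<And>a x. a \<in> carrier A \<Longrightarrow> x \<in> N \<Longrightarrow> act M a x \<in> N"
    using assms by (simp add: alg_submodule_def)
  show neg: "\<ominus>\<^bsub>M\<^esub> x \<in> N" if "x \<in> N" for x
  proof -
    have "\<ominus>\<^bsub>M\<^esub> x = (\<ominus>\<^bsub>K\<^esub> \<one>\<^bsub>K\<^esub>) \<odot>\<^bsub>M\<^esub> x"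
      using that N by (auto simp: smult_minus_1)
    then show ?thesis using that smult_closed by auto
  qed
  show "\<And>x y. x \<in> N \<Longrightarrow> y \<in> N \<Longrightarrow> x \<ominus>\<^bsub>M\<^esub> y \<in> N"
    using neg add by (simp add: a_minus_def)
qed

lemma unital_submodule:
  assumes "alg_submodule K A N M" shows "unital_fd_module K A (M\<lparr>carrier := N\<rparr>)"
proof -
  note D = alg_submoduleD[OF assms]
  interpret N: vectorspace K "M\<lparr>carrier := N\<rparr>" using subspace_is_vs[OF D(1)] .
  show ?thesis
    by (unfold_locales)
      (use D subspace_finite(1)[OF finite_dimensional D(1)] in
        \<open>auto simp: act_add_left act_add_right act_smult_left act_smult_right act_mult act_one
          one_in smult_in subset_iff\<close>)
qed

lemma fd_submodule: "alg_submodule K A N M \<Longrightarrow> fd_module K A (M\<lparr>carrier := N\<rparr>)"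
  using unital_submodule unital_fd_module.axioms(1) by blast

lemma alg_submodule_trans:
  assumes N: "alg_submodule K A N M" and L: "alg_submodule K A L (M\<lparr>carrier := N\<rparr>)"
  shows "alg_submodule K A L M"
proof -
  interpret N: unital_fd_module K A "M\<lparr>carrier := N\<rparr>" by (rule unital_submodule[OF N])
  show ?thesis
    by (rule alg_submoduleI)
      (use N.alg_submoduleD[OF L] alg_submoduleD[OF N] in auto)
qed

lemma alg_submodule_restrict:
  assumes N: "alg_submodule K A N M" and L: "alg_submodule K A L M" "L \<subseteq> N"
  shows "alg_submodule K A L (M\<lparr>carrier := N\<rparr>)"
proof -
  interpret N: unital_fd_module K A "M\<lparr>carrier := N\<rparr>" by (rule unital_submodule[OF N])
  show ?thesis
    by (rule N.alg_submoduleI)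
      (use alg_submoduleD[OF L(1)] alg_submoduleD[OF N] L(2) in auto)
qed

lemma act_hom_incl:
  assumes N: "alg_submodule K A N M" shows "(\<lambda>x. x) \<in> act_hom S (M\<lparr>carrier := N\<rparr>) M"
  using alg_submoduleD(2)[OF N] by (auto simp: act_hom_def)

lemma sum_projections:
  assumes N1: "alg_submodule K A N1 M" and N2: "alg_submodule K A N2 M"
    and sum: "N1 <+>\<^bsub>M\<^esub> N2 = N" and int: "N1 \<inter> N2 = {\<zero>\<^bsub>M\<^esub>}"
  shows "\<exists>p1 p2. p1 \<in> act_hom (carrier A) (M\<lparr>carrier := N\<rparr>) (M\<lparr>carrier := N1\<rparr>) \<and>
    p2 \<in> act_hom (carrier A) (M\<lparr>carrier := N\<rparr>) (M\<lparr>carrier := N2\<rparr>) \<and>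
    (\<forall>x \<in> N. p1 x \<oplus>\<^bsub>M\<^esub> p2 x = x) \<and> (\<forall>x \<in> N1. p1 x = x) \<and> (\<forall>x \<in> N2. p2 x = x)"
proof -
  note D1 = alg_submoduleD[OF N1] and D2 = alg_submoduleD[OF N2]
  have un: "x = x' \<and> y = y'" if "x \<in> N1" "y \<in> N2" "x' \<in> N1" "y' \<in> N2" "x \<oplus>\<^bsub>M\<^esub> y = x' \<oplus>\<^bsub>M\<^esub> y'" for x y x' y'
  proof -
    have c: "x \<in> carrier M" "y \<in> carrier M" "x' \<in> carrier M" "y' \<in> carrier M" using that D1 D2 by auto
    have "x \<ominus>\<^bsub>M\<^esub> x' = y' \<ominus>\<^bsub>M\<^esub> y"
    proof -
      have "x = (x' \<oplus>\<^bsub>M\<^esub> y') \<ominus>\<^bsub>M\<^esub> y" using that(5) c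
        by (metis M.add.inv_closed M.add.inv_solve_right' M.add.m_closed M.minus_eq)
      then have "x = x' \<oplus>\<^bsub>M\<^esub> (y' \<ominus>\<^bsub>M\<^esub> y)" using c by (simp add: a_minus_def M.a_assoc)
      then show ?thesis using c
        by (metis M.a_comm M.add.inv_closed M.add.inv_solve_right' M.minus_closed M.minus_eq)
    qed
    moreover have "x \<ominus>\<^bsub>M\<^esub> x' \<in> N1" "y' \<ominus>\<^bsub>M\<^esub> y \<in> N2" using that D1 D2 by auto
    ultimately have "x \<ominus>\<^bsub>M\<^esub> x' = \<zero>\<^bsub>M\<^esub>" "y' \<ominus>\<^bsub>M\<^esub> y = \<zero>\<^bsub>M\<^esub>" using int by auto
    then show ?thesis using c by (simp add: M.diff_eq_zero_iff)
  qed
  have ex: "\<exists>x y. x \<in> N1 \<and> y \<in> N2 \<and> n = x \<oplus>\<^bsub>M\<^esub> y" if "n \<in> N" for n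
    using that sum unfolding set_add_def' by blast
  have inN: "x \<oplus>\<^bsub>M\<^esub> y \<in> N" if "x \<in> N1" "y \<in> N2" for x y
    using that sum unfolding set_add_def' by blast
  obtain p1 p2 where p: "\<And>n. n \<in> N \<Longrightarrow> p1 n \<in> N1 \<and> p2 n \<in> N2 \<and> n = p1 n \<oplus>\<^bsub>M\<^esub> p2 n"
    using ex by metis
  have eq: "p1 n = x \<and> p2 n = y" if "x \<in> N1" "y \<in> N2" "n = x \<oplus>\<^bsub>M\<^esub> y" for n x y
    using un[of "p1 n" "p2 n" x y] p[of n] inN that by auto
  have add: "p1 (x \<oplus>\<^bsub>M\<^esub> y) = p1 x \<oplus>\<^bsub>M\<^esub> p1 y \<and> p2 (x \<oplus>\<^bsub>M\<^esub> y) = p2 x \<oplus>\<^bsub>M\<^esub> p2 y" if "x \<in> N" "y \<in> N" for x y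
  proof (rule eq)
    have c: "p1 x \<in> carrier M" "p2 x \<in> carrier M" "p1 y \<in> carrier M" "p2 y \<in> carrier M"
      using p[OF that(1)] p[OF that(2)] D1 D2 by auto
    have "x \<oplus>\<^bsub>M\<^esub> y = (p1 x \<oplus>\<^bsub>M\<^esub> p2 x) \<oplus>\<^bsub>M\<^esub> (p1 y \<oplus>\<^bsub>M\<^esub> p2 y)" using p[OF that(1)] p[OF that(2)] by simp
    then show "x \<oplus>\<^bsub>M\<^esub> y = p1 x \<oplus>\<^bsub>M\<^esub> p1 y \<oplus>\<^bsub>M\<^esub> (p2 x \<oplus>\<^bsub>M\<^esub> p2 y)" using c by (simp add: M.a_ac)
  qed (use p[OF that(1)] p[OF that(2)] D1 D2 in auto)
  have act: "p1 (act M a x) = act M a (p1 x) \<and> p2 (act M a x) = act M a (p2 x)"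
    if "a \<in> carrier A" "x \<in> N" for a x
  proof (rule eq)
    have "p1 x \<in> carrier M" "p2 x \<in> carrier M" "x = p1 x \<oplus>\<^bsub>M\<^esub> p2 x" using p[OF that(2)] D1 D2 by auto
    then show "act M a x = act M a (p1 x) \<oplus>\<^bsub>M\<^esub> act M a (p2 x)"
      using act_add_right[OF that(1)] by metis
  qed (use p[OF that(2)] D1 D2 that in auto)
  have "p1 x = x" if "x \<in> N1" for x
    using eq[OF that D2(3)] that D1 by (metis M.r_zero subsetD)
  moreover have "p2 x = x" if "x \<in> N2" for x
    using eq[OF D1(3) that] that D2 by (metis M.l_zero subsetD)
  ultimately show ?thesis
    using p add act by (intro exI[of _ p1] exI[of _ p2]) (auto simp: act_hom_def)
qed

text \<open>Induction on the dimension: a decomposable \<open>N\<close> passes \<open>P\<close> on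
  to one of two proper summands, and a summand of a summand is a summand. The property is a
  parameter because the rule is used both for being nonzero and for containing a prescribed local
  summand.\<close>

lemma indecomposable_summand:
  assumes top: "P (carrier M)" and nz: "\<And>N. P N \<Longrightarrow> N \<noteq> {\<zero>\<^bsub>M\<^esub>}"
    and split: "\<And>N N1 N2 p1 p2. \<lbrakk>P N; alg_submodule K A N M; alg_submodule K A N1 M; alg_submodule K A N2 M;
      N1 \<subseteq> N; N2 \<subseteq> N;
      p1 \<in> act_hom (carrier A) (M\<lparr>carrier := N\<rparr>) (M\<lparr>carrier := N1\<rparr>);
      p2 \<in> act_hom (carrier A) (M\<lparr>carrier := N\<rparr>) (M\<lparr>carrier := N2\<rparr>);
      \<And>x. x \<in> N \<Longrightarrow> p1 x \<oplus>\<^bsub>M\<^esub> p2 x = x; N1 <+>\<^bsub>M\<^esub> N2 = N\<rbrakk> \<Longrightarrow> P N1 \<or> P N2"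
  shows "\<exists>Z. P Z \<and> alg_submodule K A Z M \<and> indecomposable K A (M\<lparr>carrier := Z\<rparr>) \<and>
    retract (carrier A) (M\<lparr>carrier := Z\<rparr>) M"
proof -
  have "\<exists>Z. P Z \<and> alg_submodule K A Z M \<and> indecomposable K A (M\<lparr>carrier := Z\<rparr>) \<and>
    retract (carrier A) (M\<lparr>carrier := Z\<rparr>) M"
    if "P N" "alg_submodule K A N M" "retract (carrier A) (M\<lparr>carrier := N\<rparr>) M" for N
    using that
  proof (induction "vectorspace.dim K (M\<lparr>carrier := N\<rparr>)" arbitrary: N rule: less_induct)
    case less
    show ?case
    proof (cases "indecomposable K A (M\<lparr>carrier := N\<rparr>)")
      case True with less show ?thesis by blast
    next
      case False
      interpret N: unital_fd_module K A "M\<lparr>carrier := N\<rparr>" by (rule unital_submodule[OF less(3)])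
      obtain N1 N2 where N12: "alg_submodule K A N1 (M\<lparr>carrier := N\<rparr>)" "alg_submodule K A N2 (M\<lparr>carrier := N\<rparr>)"
        "N1 <+>\<^bsub>M\<lparr>carrier := N\<rparr>\<^esub> N2 = N" "N1 \<inter> N2 = {\<zero>\<^bsub>M\<^esub>}" "N1 \<noteq> {\<zero>\<^bsub>M\<^esub>}" "N2 \<noteq> {\<zero>\<^bsub>M\<^esub>}"
        using False nz[OF less(2)] unfolding indecomposable_def by auto
      have s: "alg_submodule K A N1 M" "alg_submodule K A N2 M"
        using alg_submodule_trans[OF less(3)] N12 by auto
      have sum: "N1 <+>\<^bsub>M\<^esub> N2 = N" using N12(3) by (simp add: set_add_def')
      note D1 = N.alg_submoduleD[OF N12(1)] and D2 = N.alg_submoduleD[OF N12(2)]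
      have sub: "N1 \<subseteq> N" "N2 \<subseteq> N" using D1(2) D2(2) by auto
      have ne: "N1 \<noteq> N" "N2 \<noteq> N" using sub N12 by auto
      have lt: "vectorspace.dim K (M\<lparr>carrier := N1\<rparr>) < vectorspace.dim K (M\<lparr>carrier := N\<rparr>)"
        "vectorspace.dim K (M\<lparr>carrier := N2\<rparr>) < vectorspace.dim K (M\<lparr>carrier := N\<rparr>)"
        using N.subspace_finite(2,3)[OF N.finite_dimensional D1(1)] N.subspace_finite(2,3)[OF N.finite_dimensional D2(1)] ne
        by (auto simp: le_less)
      obtain p1 p2 where p: "p1 \<in> act_hom (carrier A) (M\<lparr>carrier := N\<rparr>) (M\<lparr>carrier := N1\<rparr>)"
        "p2 \<in> act_hom (carrier A) (M\<lparr>carrier := N\<rparr>) (M\<lparr>carrier := N2\<rparr>)"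
        "\<And>x. x \<in> N \<Longrightarrow> p1 x \<oplus>\<^bsub>M\<^esub> p2 x = x" "\<And>x. x \<in> N1 \<Longrightarrow> p1 x = x" "\<And>x. x \<in> N2 \<Longrightarrow> p2 x = x"
        using sum_projections[OF s sum N12(4)] by blast
      have "retract (carrier A) (M\<lparr>carrier := N1\<rparr>) (M\<lparr>carrier := N\<rparr>)"
        by (rule retractI[of "\<lambda>x. x", OF _ p(1)]) (use sub p(4) in \<open>auto simp: act_hom_def\<close>)
      moreover have "retract (carrier A) (M\<lparr>carrier := N2\<rparr>) (M\<lparr>carrier := N\<rparr>)"
        by (rule retractI[of "\<lambda>x. x", OF _ p(2)]) (use sub p(5) in \<open>auto simp: act_hom_def\<close>)
      ultimately have r: "retract (carrier A) (M\<lparr>carrier := N1\<rparr>) M" "retract (carrier A) (M\<lparr>carrier := N2\<rparr>) M"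
        using retract_trans less(4) by blast+
      have "P N1 \<or> P N2"
        by (rule split[OF less(2,3) s sub p(1,2,3) sum])
      then show ?thesis using less(1)[OF lt(1) _ s(1) r(1)] less(1)[OF lt(2) _ s(2) r(2)] by blast
    qed
  qed
  moreover have "alg_submodule K A (carrier M) M"
    by (rule alg_submoduleI) (auto simp: act_closed)
  ultimately show ?thesis using top retract_refl[of "carrier A" M] by simp
qed

lemma ex_indecomposable_summand:
  assumes "carrier M \<noteq> {\<zero>\<^bsub>M\<^esub>}"
  shows "\<exists>Z. alg_submodule K A Z M \<and> indecomposable K A (M\<lparr>carrier := Z\<rparr>) \<and>
    retract (carrier A) (M\<lparr>carrier := Z\<rparr>) M"
proof -
  have "\<exists>Z. Z \<noteq> {\<zero>\<^bsub>M\<^esub>} \<and> alg_submodule K A Z M \<and> indecomposable K A (M\<lparr>carrier := Z\<rparr>) \<and>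
    retract (carrier A) (M\<lparr>carrier := Z\<rparr>) M"
  proof (rule indecomposable_summand[where P = "\<lambda>Z. Z \<noteq> {\<zero>\<^bsub>M\<^esub>}"])
    show "carrier M \<noteq> {\<zero>\<^bsub>M\<^esub>}" by (rule assms)
    show "N1 \<noteq> {\<zero>\<^bsub>M\<^esub>} \<or> N2 \<noteq> {\<zero>\<^bsub>M\<^esub>}" if "N \<noteq> {\<zero>\<^bsub>M\<^esub>}" "N1 <+>\<^bsub>M\<^esub> N2 = N" for N N1 N2
    proof (rule ccontr)
      assume "\<not> ?thesis"
      then have "N = {\<zero>\<^bsub>M\<^esub> \<oplus>\<^bsub>M\<^esub> \<zero>\<^bsub>M\<^esub>}" using that(2) by (simp add: set_add_def')
      with that(1) show False by simp
    qed
  qed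
  then show ?thesis by blast
qed

text \<open>\<open>L\<close> may be local for a smaller operator set than \<open>A\<close>. By
  \<open>retract_split\<close> it follows each splitting of \<open>M\<close> over \<open>A\<close>
  into one of the two parts, down to an indecomposable one. With \<open>S = B\<close> this finds an
  \<open>A\<close>-module belonging to a given \<open>B\<close>-module.\<close>

lemma local_indecomposable_summand:
  assumes L: "act_local S L" and S: "S \<subseteq> carrier A" and r: "retract S L M"
  shows "\<exists>Z. retract S L (M\<lparr>carrier := Z\<rparr>) \<and> alg_submodule K A Z M \<and> indecomposable K A (M\<lparr>carrier := Z\<rparr>) \<and>
    retract (carrier A) (M\<lparr>carrier := Z\<rparr>) M"
proof (rule indecomposable_summand)
  show "retract S L (M\<lparr>carrier := carrier M\<rparr>)" using r by simp
next
  fix N assume "retract S L (M\<lparr>carrier := N\<rparr>)"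
  then obtain i p where ip: "i \<in> act_hom S L (M\<lparr>carrier := N\<rparr>)" "p \<in> act_hom S (M\<lparr>carrier := N\<rparr>) L"
    "\<And>x. x \<in> carrier L \<Longrightarrow> p (i x) = x" by (auto simp: retract_def)
  show "N \<noteq> {\<zero>\<^bsub>M\<^esub>}"
  proof
    assume N: "N = {\<zero>\<^bsub>M\<^esub>}"
    have "x = p \<zero>\<^bsub>M\<^esub>" if "x \<in> carrier L" for x
      using ip(3)[OF that] act_homD(2)[OF ip(1) that] N by simp
    moreover have "\<zero>\<^bsub>L\<^esub> \<in> carrier L" "carrier L \<noteq> {\<zero>\<^bsub>L\<^esub>}"
      using L by (auto simp: act_local_def abelian_group_def abelian_monoid.zero_closed)
    ultimately show False by (metis equals0D singletonI subsetI subset_antisym singletonD)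
  qed
next
  fix N N1 N2 p1 p2
  assume a: "retract S L (M\<lparr>carrier := N\<rparr>)" "N1 \<subseteq> N" "N2 \<subseteq> N"
      "p1 \<in> act_hom (carrier A) (M\<lparr>carrier := N\<rparr>) (M\<lparr>carrier := N1\<rparr>)"
      "p2 \<in> act_hom (carrier A) (M\<lparr>carrier := N\<rparr>) (M\<lparr>carrier := N2\<rparr>)"
      "\<And>x. x \<in> N \<Longrightarrow> p1 x \<oplus>\<^bsub>M\<^esub> p2 x = x"
  show "retract S L (M\<lparr>carrier := N1\<rparr>) \<or> retract S L (M\<lparr>carrier := N2\<rparr>)"
  proof (rule retract_split[OF L a(1)])
    show "p1 \<in> act_hom S (M\<lparr>carrier := N\<rparr>) (M\<lparr>carrier := N1\<rparr>)" using a(4) act_hom_mono[OF S] by blast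
    show "p2 \<in> act_hom S (M\<lparr>carrier := N\<rparr>) (M\<lparr>carrier := N2\<rparr>)" using a(5) act_hom_mono[OF S] by blast
    show "(\<lambda>x. x) \<in> act_hom S (M\<lparr>carrier := N1\<rparr>) (M\<lparr>carrier := N\<rparr>)"
      "(\<lambda>x. x) \<in> act_hom S (M\<lparr>carrier := N2\<rparr>) (M\<lparr>carrier := N\<rparr>)"
      using a(2,3) by (auto simp: act_hom_def)
  qed (use a(6) in auto)
qed

section \<open>Fitting's lemma and the locality of endomorphism rings\<close>

lemma act_hom_image:
  assumes "f \<in> act_hom (carrier A) N M" "fd_module K A N"
  shows "alg_submodule K A (f ` carrier N) M"
proof -
  interpret N: fd_module K A N by fact
  note f = act_homD[OF assms(1)]
  show ?thesis
  proof (rule alg_submoduleI)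
    show "\<zero>\<^bsub>M\<^esub> \<in> f ` carrier N"
      using act_hom_zero[OF assms(1)] M.abelian_group_axioms N.M.abelian_group_axioms N.M.zero_closed by (metis imageI)
    show "x \<oplus>\<^bsub>M\<^esub> y \<in> f ` carrier N" if xy: "x \<in> f ` carrier N" "y \<in> f ` carrier N" for x y
    proof -
      from xy obtain u v where "u \<in> carrier N" "v \<in> carrier N" "x = f u" "y = f v" by auto
      then show ?thesis by (intro image_eqI[of _ _ "u \<oplus>\<^bsub>N\<^esub> v"]) (auto simp: f)
    qed
    show "act M a x \<in> f ` carrier N" if ax: "a \<in> carrier A" "x \<in> f ` carrier N" for a x
    proof -
      from ax(2) obtain u where "u \<in> carrier N" "x = f u" by auto
      with ax(1) show ?thesis by (intro image_eqI[of _ _ "act N a u"]) (auto simp: f N.act_closed)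
    qed
  qed (auto simp: f)
qed

lemma act_hom_kernel:
  assumes "f \<in> act_hom (carrier A) M N" "fd_module K A N"
  shows "alg_submodule K A {x \<in> carrier M. f x = \<zero>\<^bsub>N\<^esub>} M"
proof -
  interpret N: fd_module K A N by fact
  note f = act_homD[OF assms(1)]
  have z: "act N a \<zero>\<^bsub>N\<^esub> = \<zero>\<^bsub>N\<^esub>" if "a \<in> carrier A" for a
    by (rule additive_zero[OF N.M.abelian_group_axioms N.M.abelian_group_axioms])
      (use that N.act_closed N.act_add_right in auto)
  show ?thesis
    by (rule alg_submoduleI)
      (use f z act_closed act_hom_zero[OF assms(1) M.abelian_group_axioms N.M.abelian_group_axioms] in auto)
qed

text \<open>Images of powers shrink and kernels grow; by dimension both are stationary from some
  \<open>n\<close> on, and then \<open>M\<close> is the direct sum of the kernel and the image of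
  \<open>f ^^ n\<close>. For indecomposable \<open>M\<close> one of the two is zero.\<close>

lemma fitting:
  assumes ind: "indecomposable K A M" and f: "f \<in> act_hom (carrier A) M M"
  shows "bij_betw f (carrier M) (carrier M) \<or> (\<exists>n. \<forall>x \<in> carrier M. (f ^^ n) x = \<zero>\<^bsub>M\<^esub>)"
proof -
  define I where "I n = (f ^^ n) ` carrier M" for n
  define N where "N n = {x \<in> carrier M. (f ^^ n) x = \<zero>\<^bsub>M\<^esub>}" for n
  define d where "d W = vectorspace.dim K (M\<lparr>carrier := W\<rparr>)" for W
  have fn: "f ^^ n \<in> act_hom (carrier A) M M" for n by (rule act_hom_funpow[OF f])
  have f0: "f \<zero>\<^bsub>M\<^esub> = \<zero>\<^bsub>M\<^esub>" by (rule act_hom_zero[OF f]) (simp_all add: M.abelian_group_axioms)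
  have f0n: "(f ^^ n) \<zero>\<^bsub>M\<^esub> = \<zero>\<^bsub>M\<^esub>" for n by (induction n) (auto simp: f0)
  have subI: "alg_submodule K A (I n) M" for n unfolding I_def by (rule act_hom_image[OF fn fd_module_axioms])
  have subN: "alg_submodule K A (N n) M" for n unfolding N_def by (rule act_hom_kernel[OF fn fd_module_axioms])
  have fM: "(f ^^ n) x \<in> carrier M" if "x \<in> carrier M" for n x using act_homD(2)[OF fn that] .
  have decI: "I (m + n) \<subseteq> I n" for m n
    unfolding I_def by (auto simp: funpow_add add.commute[of m] fM)
  have incN: "N n \<subseteq> N (m + n)" for m n unfolding N_def by (auto simp: funpow_add f0n)
  have deq: "W = W'" if "W \<subseteq> W'" "d W' \<le> d W" "alg_submodule K A W M" "alg_submodule K A W' M" for W W'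
  proof -
    interpret W': unital_fd_module K A "M\<lparr>carrier := W'\<rparr>" by (rule unital_submodule[OF that(4)])
    have s: "subspace K W (M\<lparr>carrier := W'\<rparr>)"
      using alg_submodule_restrict[OF that(4,3,1)] by (simp add: alg_submodule_def)
    show ?thesis using W'.subspace_finite(2,3)[OF W'.finite_dimensional s] that(2) unfolding d_def by auto
  qed
  have dle: "d W \<le> dim" if "alg_submodule K A W M" for W
    using subspace_finite(2)[OF finite_dimensional] that unfolding d_def by (auto simp: alg_submodule_def)
  obtain n1 where n1: "\<And>m. d (I n1) \<le> d (I m)"
    using ex_has_least_nat[of "\<lambda>_. True" 0 "\<lambda>n. d (I n)"] by auto
  obtain n2 where n2: "\<And>m. d (N m) \<le> d (N n2)"
    using ex_has_greatest_nat[of "\<lambda>_. True" 0 "\<lambda>n. d (N n)" "Suc dim"] dle[OF subN] by (auto simp: less_Suc_eq_le)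
  \<comment> \<open>The successor makes \<open>n\<close> positive, so that \<open>f ^^ n\<close>
    begins with an application of \<open>f\<close> and its injectivity gives that of
    \<open>f\<close>.\<close>
  define n where "n = Suc (n1 + n2)"
  have I1: "I (m + n1) = I n1" for m by (rule deq[OF decI n1 subI subI])
  have N1: "N n2 = N (m + n2)" for m by (rule deq[OF incN n2 subN subN])
  have In: "I (n + n) = I n" unfolding n_def using I1[of "n1 + n2 + n2 + 2"] I1[of "n2 + 1"] by (simp add: ac_simps)
  have Nn: "N (n + n) = N n" unfolding n_def using N1[of "n1 + n1 + n2 + 2"] N1[of "n1 + 1"] by (simp add: ac_simps)
  have int: "N n \<inter> I n = {\<zero>\<^bsub>M\<^esub>}"
  proof -
    have "x = \<zero>\<^bsub>M\<^esub>" if x: "x \<in> N n" "x \<in> I n" for x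
    proof -
      obtain y where y: "y \<in> carrier M" "x = (f ^^ n) y" using x(2) by (auto simp: I_def)
      then have "y \<in> N (n + n)" using x(1) by (auto simp: N_def funpow_add)
      then show ?thesis using Nn y by (auto simp: N_def)
    qed
    then show ?thesis using alg_submoduleD(3)[OF subN] alg_submoduleD(3)[OF subI] by auto
  qed
  have sum: "N n <+>\<^bsub>M\<^esub> I n = carrier M"
  proof
    show "N n <+>\<^bsub>M\<^esub> I n \<subseteq> carrier M"
      using alg_submoduleD(2)[OF subN[of n]] alg_submoduleD(2)[OF subI[of n]] by (auto simp: set_add_def')
    show "carrier M \<subseteq> N n <+>\<^bsub>M\<^esub> I n"
    proof
      fix x assume x: "x \<in> carrier M"
      \<comment> \<open>As \<open>f ^^ n\<close> and \<open>f ^^ (n + n)\<close> have the same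
        image, \<open>f ^^ n\<close> takes the same value at \<open>x\<close> and at some
        \<open>(f ^^ n) y\<close>; the difference of these two lies in the kernel.\<close>
      then have "(f ^^ n) x \<in> I (n + n)" using In by (auto simp: I_def)
      then obtain y where y: "y \<in> carrier M" "(f ^^ n) x = (f ^^ n) ((f ^^ n) y)"
        by (auto simp: I_def funpow_add)
      have "x \<ominus>\<^bsub>M\<^esub> (f ^^ n) y \<in> N n" unfolding N_def
        using act_hom_diff[OF fn M.abelian_group_axioms M.abelian_group_axioms x fM[OF y(1)]] y x fM
        by (simp add: M.diff_eq_zero_iff)
      moreover have "(f ^^ n) y \<in> I n" using y by (auto simp: I_def)
      ultimately show "x \<in> N n <+>\<^bsub>M\<^esub> I n"
        unfolding set_add_def' using M.diff_add_cancel[OF x fM[OF y(1)]] by (metis UN_I singletonI)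
    qed
  qed
  have "N n = {\<zero>\<^bsub>M\<^esub>} \<or> I n = {\<zero>\<^bsub>M\<^esub>}"
    using ind subN[of n] subI[of n] sum int unfolding indecomposable_def by blast
  then show ?thesis
  proof
    assume "I n = {\<zero>\<^bsub>M\<^esub>}"
    then show ?thesis unfolding I_def by (intro disjI2 exI[of _ n]) auto
  next
    assume N0: "N n = {\<zero>\<^bsub>M\<^esub>}"
    have IM: "I n = carrier M"
    proof
      show "I n \<subseteq> carrier M" by (rule alg_submoduleD(2)[OF subI])
      show "carrier M \<subseteq> I n"
      proof
        fix x assume "x \<in> carrier M"
        then obtain y where "y \<in> I n" "x = \<zero>\<^bsub>M\<^esub> \<oplus>\<^bsub>M\<^esub> y" using sum N0 by (auto simp: set_add_def')
        then show "x \<in> I n" using alg_submoduleD(2)[OF subI[of n]] by auto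
      qed
    qed
    show ?thesis
    proof -
      obtain m where m: "n = Suc m" by (simp add: n_def)
      have "inj_on f (carrier M)"
      proof (rule inj_onI)
        fix x y assume xy: "x \<in> carrier M" "y \<in> carrier M" "f x = f y"
        then have "(f ^^ n) (x \<ominus>\<^bsub>M\<^esub> y) = (f ^^ m) (f (x \<ominus>\<^bsub>M\<^esub> y))" by (simp add: m funpow_swap1)
        also have "f (x \<ominus>\<^bsub>M\<^esub> y) = \<zero>\<^bsub>M\<^esub>"
          using act_hom_diff[OF f M.abelian_group_axioms M.abelian_group_axioms xy(1,2)] xy act_homD(2)[OF f]
          by (simp add: M.diff_eq_zero_iff)
        finally have "x \<ominus>\<^bsub>M\<^esub> y \<in> N n" using xy by (simp add: N_def f0n)
        then show "x = y" using N0 xy by (simp add: M.diff_eq_zero_iff)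
      qed
      moreover have "carrier M \<subseteq> f ` carrier M"
        using IM fM[of _ m] by (auto simp: I_def m)
      ultimately show ?thesis using act_homD(2)[OF f] by (auto simp: bij_betw_def)
    qed
  qed
qed

text \<open>After composition with the inverse \<open>u\<close> of \<open>f + g\<close>, the maps
  \<open>u f\<close> and \<open>u g\<close> add up to the identity. If \<open>u f\<close> is not
  bijective, it is nilpotent by \<open>fitting\<close>, so \<open>u g\<close> has trivial kernel:
  \<open>u g x = 0\<close> gives \<open>u f x = x\<close>. On a nonzero module such a map is not
  nilpotent, hence \<open>u g\<close> is bijective.\<close>

lemma indecomposable_local:
  assumes ind: "indecomposable K A M" shows "act_local (carrier A) M"
proof -
  have nz: "carrier M \<noteq> {\<zero>\<^bsub>M\<^esub>}" using ind by (simp add: indecomposable_def)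
  have "bij_betw f (carrier M) (carrier M) \<or> bij_betw g (carrier M) (carrier M)"
    if f: "f \<in> act_hom (carrier A) M M" and g: "g \<in> act_hom (carrier A) M M"
      and b: "bij_betw (\<lambda>x. f x \<oplus>\<^bsub>M\<^esub> g x) (carrier M) (carrier M)" for f g
  proof -
    let ?s = "\<lambda>x. f x \<oplus>\<^bsub>M\<^esub> g x"
    define u where "u = inv_into (carrier M) ?s"
    have s: "?s \<in> act_hom (carrier A) M M"
      by (rule act_homI) (use act_homD[OF f] act_homD[OF g] in \<open>auto simp: act_add_right M.a_ac\<close>)
    have u: "u \<in> act_hom (carrier A) M M" unfolding u_def
      by (rule act_hom_inv[OF s b M.abelian_group_axioms]) (auto simp: act_closed)
    have us: "u (?s x) = x" if "x \<in> carrier M" for x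
      using b that unfolding u_def bij_betw_def by (metis (no_types, lifting) inv_into_f_f)
    have ub: "bij_betw u (carrier M) (carrier M)" unfolding u_def by (rule bij_betw_inv_into[OF b])
    have f': "(\<lambda>x. u (f x)) \<in> act_hom (carrier A) M M" and g': "(\<lambda>x. u (g x)) \<in> act_hom (carrier A) M M"
      using act_hom_comp[OF f u] act_hom_comp[OF g u] .
    have un: "bij_betw h (carrier M) (carrier M)"
      if h: "h \<in> act_hom (carrier A) M M" "bij_betw (\<lambda>x. u (h x)) (carrier M) (carrier M)" for h
    proof -
      have "bij_betw (\<lambda>x. inv_into (carrier M) u (u (h x))) (carrier M) (carrier M)"
        using bij_betw_trans[OF h(2) bij_betw_inv_into[OF ub]] by (simp add: comp_def)
      moreover have "inv_into (carrier M) u (u (h x)) = h x" if "x \<in> carrier M" for x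
        using act_homD(2)[OF h(1) that] ub by (auto simp: bij_betw_def)
      ultimately show ?thesis by (subst bij_betw_cong) auto
    qed
    show ?thesis
    proof (cases "bij_betw (\<lambda>x. u (f x)) (carrier M) (carrier M)")
      case True then show ?thesis using un[OF f] by blast
    next
      case False
      then obtain n where n: "\<And>x. x \<in> carrier M \<Longrightarrow> ((\<lambda>x. u (f x)) ^^ n) x = \<zero>\<^bsub>M\<^esub>"
        using fitting[OF ind f'] by blast
      have g0: "x = \<zero>\<^bsub>M\<^esub>" if x: "x \<in> carrier M" "u (g x) = \<zero>\<^bsub>M\<^esub>" for x
      proof -
        have "u (f x) \<oplus>\<^bsub>M\<^esub> u (g x) = x"
          using act_homD(3)[OF u] act_homD(2)[OF f x(1)] act_homD(2)[OF g x(1)] us[OF x(1)] by simp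
        then have "u (f x) = x" using x act_homD(2)[OF f' x(1)] by simp
        then have "((\<lambda>x. u (f x)) ^^ n) x = x" for n by (induction n) auto
        then show ?thesis using n[OF x(1)] by simp
      qed
      have "bij_betw (\<lambda>x. u (g x)) (carrier M) (carrier M)"
      proof (rule ccontr)
        assume "\<not> ?thesis"
        then obtain m where m: "\<And>x. x \<in> carrier M \<Longrightarrow> ((\<lambda>x. u (g x)) ^^ m) x = \<zero>\<^bsub>M\<^esub>"
          using fitting[OF ind g'] by blast
        have "x = \<zero>\<^bsub>M\<^esub>" if "x \<in> carrier M" "((\<lambda>x. u (g x)) ^^ m) x = \<zero>\<^bsub>M\<^esub>" for x m
          using that
        proof (induction m arbitrary: x)
          case (Suc m)
          have "u (g x) \<in> carrier M" using act_homD(2)[OF g' Suc(2)] .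
          then have "u (g x) = \<zero>\<^bsub>M\<^esub>" using Suc(1)[of "u (g x)"] Suc(3)
            by (simp add: funpow_Suc_right del: funpow.simps)
          then show ?case using g0[OF Suc(2)] by simp
        qed simp
        then show False using m nz M.zero_closed by blast
      qed
      then show ?thesis using un[OF g] by blast
    qed
  qed
  then show ?thesis unfolding act_local_def
    using nz M.abelian_group_axioms act_closed by blast
qed

text \<open>\<open>M\<close> is the direct sum of the image of \<open>i\<close> and the kernel of
  \<open>p\<close>. The image is nonzero, so the kernel vanishes.\<close>

lemma retract_indecomposable_bij:
  assumes ind: "indecomposable K A M" and N: "fd_module K A N" "carrier N \<noteq> {\<zero>\<^bsub>N\<^esub>}"
    and i: "i \<in> act_hom (carrier A) N M" and p: "p \<in> act_hom (carrier A) M N"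
    and pi: "\<And>x. x \<in> carrier N \<Longrightarrow> p (i x) = x"
  shows "bij_betw i (carrier N) (carrier M)"
proof -
  interpret N: fd_module K A N by fact
  note ag = M.abelian_group_axioms N.M.abelian_group_axioms
  let ?I = "i ` carrier N" and ?K = "{x \<in> carrier M. p x = \<zero>\<^bsub>N\<^esub>}"
  have 1: "alg_submodule K A ?I M" "alg_submodule K A ?K M"
    using act_hom_image[OF i N(1)] act_hom_kernel[OF p N(1)] .
  have i0: "i \<zero>\<^bsub>N\<^esub> = \<zero>\<^bsub>M\<^esub>" by (rule act_hom_zero[OF i ag(2,1)])
  have int: "?I \<inter> ?K = {\<zero>\<^bsub>M\<^esub>}"
  proof
    show "?I \<inter> ?K \<subseteq> {\<zero>\<^bsub>M\<^esub>}" using pi i0 by auto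
    show "{\<zero>\<^bsub>M\<^esub>} \<subseteq> ?I \<inter> ?K" using alg_submoduleD(3)[OF 1(1)] alg_submoduleD(3)[OF 1(2)] by blast
  qed
  have dec: "x \<ominus>\<^bsub>M\<^esub> i (p x) \<in> ?K" if x: "x \<in> carrier M" for x
    using act_hom_diff[OF p ag x act_homD(2)[OF i act_homD(2)[OF p x]]] pi act_homD(2)[OF p x] x
      act_homD(2)[OF i act_homD(2)[OF p x]] by (simp add: N.M.diff_eq_zero_iff)
  have "?I <+>\<^bsub>M\<^esub> ?K = carrier M"
  proof
    show "?I <+>\<^bsub>M\<^esub> ?K \<subseteq> carrier M" using act_homD(2)[OF i] by (auto simp: set_add_def')
    show "carrier M \<subseteq> ?I <+>\<^bsub>M\<^esub> ?K"
    proof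
      fix x assume x: "x \<in> carrier M"
      have px: "p x \<in> carrier N" "i (p x) \<in> carrier M" using act_homD(2)[OF p x] act_homD(2)[OF i] by auto
      have "x = i (p x) \<oplus>\<^bsub>M\<^esub> (x \<ominus>\<^bsub>M\<^esub> i (p x))"
        using M.diff_add_cancel[OF x px(2)] px x by (simp add: M.a_comm)
      with dec[OF x] px show "x \<in> ?I <+>\<^bsub>M\<^esub> ?K" unfolding set_add_def' by blast
    qed
  qed
  then have "?I = {\<zero>\<^bsub>M\<^esub>} \<or> ?K = {\<zero>\<^bsub>M\<^esub>}"
    using ind 1 int unfolding indecomposable_def by blast
  moreover have "?I \<noteq> {\<zero>\<^bsub>M\<^esub>}"
  proof
    assume "?I = {\<zero>\<^bsub>M\<^esub>}"
    then have "i x = \<zero>\<^bsub>M\<^esub>" if "x \<in> carrier N" for x using that by blast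
    then have "x = p \<zero>\<^bsub>M\<^esub>" if "x \<in> carrier N" for x using pi[OF that] that by simp
    then have "x = \<zero>\<^bsub>N\<^esub>" if "x \<in> carrier N" for x using that N.M.zero_closed by metis
    then have "carrier N = {\<zero>\<^bsub>N\<^esub>}" using N.M.zero_closed by blast
    then show False using N(2) by contradiction
  qed
  ultimately have K0: "?K = {\<zero>\<^bsub>M\<^esub>}" by blast
  have "x = i (p x)" if x: "x \<in> carrier M" for x
    using dec[OF x] K0 x act_homD(2)[OF i act_homD(2)[OF p x]] M.diff_eq_zero_iff by blast
  then have "carrier M \<subseteq> i ` carrier N" using act_homD(2)[OF p] by blast
  moreover have "inj_on i (carrier N)" by (rule inj_on_inverseI[of _ p]) (rule pi)
  ultimately show ?thesis using act_homD(2)[OF i] by (auto simp: bij_betw_def)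
qed

lemma act_hom_smult:
  assumes "unital_fd_module K A N" "f \<in> act_hom (carrier A) M N" "c \<in> carrier K" "x \<in> carrier M"
  shows "f (c \<odot>\<^bsub>M\<^esub> x) = c \<odot>\<^bsub>N\<^esub> f x"
proof -
  interpret N: unital_fd_module K A N by fact
  show ?thesis using assms act_homD[OF assms(2)]
    by (simp add: smult_as_act N.smult_as_act smult_in one_in)
qed

lemma act_hom_bij_iso:
  assumes "unital_fd_module K A N" "f \<in> act_hom (carrier A) M N" "bij_betw f (carrier M) (carrier N)"
  shows "f \<in> alg_module_iso K A M N"
  using assms act_hom_smult[OF assms(1,2)] act_homD[OF assms(2)]
  unfolding alg_module_iso_def module_hom_def by auto

end

lemma alg_module_isoD:
  assumes "f \<in> alg_module_iso K A M N"
  shows "f \<in> act_hom (carrier A) M N" "bij_betw f (carrier M) (carrier N)"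
  using assms unfolding alg_module_iso_def module_hom_def act_hom_def by auto

subsection \<open>The Frobenius automorphism of the closure of a finite field\<close>

text \<open>Besides algebraic closedness and the size of \<open>Fq\<close>, the arithmetic input
  consists of the properties of \<open>c \<mapsto> c^q\<close> that a Frobenius morphism of a
  nonzero algebra supplies.\<close>

locale finite_field_closure = algebraic_closure k Fq for k (structure) and Fq +
  fixes q :: nat
  assumes card_Fq: "card Fq = q" and q_pos: "q > 0"
    and pow_add: "x \<in> carrier k \<Longrightarrow> y \<in> carrier k \<Longrightarrow> (x \<oplus> y) [^] q = x [^] q \<oplus> y [^] q"
    and pow_periodic: "x \<in> carrier k \<Longrightarrow> \<exists>n > 0. ((\<lambda>z. z [^] q) ^^ n) x = x"
    and pow_Fq: "x \<in> Fq \<Longrightarrow> x [^] q = x"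
begin

abbreviation sg :: "'a \<Rightarrow> 'a" where "sg \<equiv> \<lambda>z. z [^] q"

lemma Fq_sub: "Fq \<subseteq> carrier k" by (rule subfieldE(3)[OF subfield_axioms])

lemma Fq_in [simp]: "x \<in> Fq \<Longrightarrow> x \<in> carrier k" using Fq_sub by auto

lemma finite_Fq: "finite Fq" using card_Fq q_pos card_ge_0_finite by blast

lemma q_ge_2: "q \<ge> 2"
proof -
  have "{\<zero>, \<one>} \<subseteq> Fq" using subringE(2,3)[OF subfieldE(1)[OF subfield_axioms]] by auto
  then have "card {\<zero>, \<one>} \<le> card Fq" by (rule card_mono[OF finite_Fq])
  then show ?thesis using card_Fq by simp
qed

lemma sgn_closed [simp]: "x \<in> carrier k \<Longrightarrow> (sg ^^ i) x \<in> carrier k"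
  by (induction i) auto

lemma sgn_pow: "x \<in> carrier k \<Longrightarrow> (sg ^^ i) x = x [^] (q ^ i)"
  by (induction i) (auto simp: nat_pow_pow mult.commute)

lemma sgn_add: "x \<in> carrier k \<Longrightarrow> y \<in> carrier k \<Longrightarrow> (sg ^^ i) (x \<oplus> y) = (sg ^^ i) x \<oplus> (sg ^^ i) y"
  by (induction i) (auto simp: pow_add)

lemma sgn_mult: "x \<in> carrier k \<Longrightarrow> y \<in> carrier k \<Longrightarrow> (sg ^^ i) (x \<otimes> y) = (sg ^^ i) x \<otimes> (sg ^^ i) y"
  by (induction i) (auto simp: nat_pow_distrib)

lemma sgn_one [simp]: "(sg ^^ i) \<one> = \<one>"
  by (induction i) auto

lemma sgn_zero [simp]: "(sg ^^ i) \<zero> = \<zero>"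
  using q_pos by (induction i) (auto simp: nat_pow_zero)

lemma sgn_minus:
  assumes "x \<in> carrier k" shows "(sg ^^ i) (\<ominus> x) = \<ominus> (sg ^^ i) x"
proof -
  have "(sg ^^ i) (\<ominus> x) \<oplus> (sg ^^ i) x = \<zero>"
    using sgn_add[of "\<ominus> x" x i] assms by (simp add: l_neg)
  then show ?thesis using assms by (simp add: minus_equality)
qed

lemma sgn_inv:
  assumes "x \<in> carrier k" "x \<noteq> \<zero>" shows "(sg ^^ i) (inv x) = inv ((sg ^^ i) x)"
proof -
  have u: "x \<in> Units k" "inv x \<in> carrier k" using assms by (auto simp: field_Units)
  have "(sg ^^ i) (inv x) \<otimes> (sg ^^ i) x = \<one>"
    using sgn_mult[of "inv x" x i] u assms by simp
  then show ?thesis using assms u by (metis comm_inv_char m_comm sgn_closed)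
qed

section \<open>Roots of additive polynomials and the finite subfields of \<open>k\<close>\<close>

lemma exists_root_k:
  assumes "polynomial (carrier k) p" "length p > 1"
  shows "\<exists>x \<in> carrier k. eval p x = \<zero>"
proof -
  have p: "p \<in> carrier (poly_ring k)" using assms(1) by (simp add: univ_poly_carrier)
  have "size (roots p) = length p - 1" using roots_over_carrier[OF p] by (simp add: splitted_def)
  then have "roots p \<noteq> {#}" using assms(2) by auto
  then obtain x where "x \<in># roots p" by auto
  then show ?thesis using roots_mem_iff_is_root[OF p] by (auto simp: is_root_def)
qed

text \<open>Coefficient lists start with the leading coefficient, so the prefix adds the monomial of
  degree \<open>r + length p\<close>. The polynomials below are assembled in this way.\<close>

lemma eval_lead:
  assumes "set p \<subseteq> carrier k" "x \<in> carrier k"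
  shows "eval (\<one> # replicate r \<zero> @ p) x = x [^] (r + length p) \<oplus> eval p x"
proof -
  have "eval (replicate r \<zero> @ p) x = eval p x"
    using assms eval_in_carrier[OF assms] by (induction r) auto
  then show ?thesis using assms by simp
qed

lemma polynomial_lead:
  assumes "set p \<subseteq> carrier k"
  shows "polynomial (carrier k) (\<one> # replicate r \<zero> @ p)"
  using assms by (auto simp: polynomial_def)

lemma card_fixed_le:
  assumes "Q \<ge> 2"
  shows "finite {x \<in> carrier k. x [^] Q = x}" "card {x \<in> carrier k. x [^] Q = x} \<le> Q"
proof -
  \<comment> \<open>The polynomial \<open>X^Q - X\<close>.\<close>
  define p where "p = \<one> # replicate (Q - 2) \<zero> @ [\<ominus> \<one>, \<zero>]"
  have pp: "p \<in> carrier (poly_ring k)"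
    unfolding p_def univ_poly_carrier[symmetric] by (rule polynomial_lead) auto
  obtain t where t: "Q = Suc (Suc t)" using assms by (metis add_2_eq_Suc le_Suc_ex)
  have "eval p x = x [^] Q \<ominus> x" if "x \<in> carrier k" for x
    unfolding p_def t by (subst eval_lead) (use that in \<open>auto simp: a_minus_def l_minus\<close>)
  then have sub: "{x \<in> carrier k. x [^] Q = x} \<subseteq> set_mset (roots p)"
    using roots_mem_iff_is_root[OF pp] by (auto simp: is_root_def p_def)
  then show "finite {x \<in> carrier k. x [^] Q = x}" by (rule finite_subset) simp
  have "card {x \<in> carrier k. x [^] Q = x} \<le> card (set_mset (roots p))" using sub by (rule card_mono[rotated]) simp
  also have "\<dots> = (\<Sum>x\<in>set_mset (roots p). 1)" by simp
  also have "\<dots> \<le> (\<Sum>x\<in>set_mset (roots p). count (roots p) x)"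
    by (rule sum_mono) (simp add: Suc_le_eq)
  also have "\<dots> = size (roots p)" by (simp only: size_multiset_overloaded_eq)
  also have "\<dots> \<le> Q" using size_roots_le_degree[OF pp] assms by (simp add: p_def)
  finally show "card {x \<in> carrier k. x [^] Q = x} \<le> Q" .
qed

text \<open>\<open>Fq\<close> already supplies \<open>q\<close> roots of \<open>X^q - X\<close>, so
  there are no others.\<close>

lemma sg_fixed_iff: "x \<in> carrier k \<Longrightarrow> sg x = x \<longleftrightarrow> x \<in> Fq"
proof -
  have "Fq = {x \<in> carrier k. sg x = x}"
  proof (rule card_seteq)
    show "finite {x \<in> carrier k. sg x = x}" by (rule card_fixed_le(1)[OF q_ge_2])
    show "Fq \<subseteq> {x \<in> carrier k. sg x = x}" using pow_Fq Fq_in by blast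
    show "card {x \<in> carrier k. sg x = x} \<le> card Fq" using card_fixed_le(2)[OF q_ge_2] card_Fq by simp
  qed
  then show "x \<in> carrier k \<Longrightarrow> sg x = x \<longleftrightarrow> x \<in> Fq"
    by (metis (mono_tags, lifting) mem_Collect_eq)
qed

text \<open>For \<open>n > 0\<close>, the subfield with \<open>q^n\<close> elements.\<close>

definition E :: "nat \<Rightarrow> 'a set" where "E n = {x \<in> carrier k. (sg ^^ n) x = x}"

lemma E_closed [simp]:
  "\<zero> \<in> E n" "\<one> \<in> E n" "x \<in> E n \<Longrightarrow> x \<in> carrier k"
  "x \<in> E n \<Longrightarrow> y \<in> E n \<Longrightarrow> x \<oplus> y \<in> E n" "x \<in> E n \<Longrightarrow> y \<in> E n \<Longrightarrow> x \<otimes> y \<in> E n"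
  "x \<in> E n \<Longrightarrow> \<ominus> x \<in> E n" "x \<in> E n \<Longrightarrow> y \<in> E n \<Longrightarrow> x \<ominus> y \<in> E n"
  "x \<in> E n \<Longrightarrow> x \<noteq> \<zero> \<Longrightarrow> inv x \<in> E n"
  by (auto simp: E_def sgn_add sgn_mult sgn_minus a_minus_def sgn_inv field_Units)

lemma E_sg: "x \<in> E n \<Longrightarrow> (sg ^^ i) x \<in> E n"
  unfolding E_def by (auto simp: funpow_add[symmetric, THEN fun_cong, simplified] add.commute)
    (metis comp_apply funpow_add add.commute)

text \<open>Each element has finite order under Frobenius, so \<open>k\<close> is the union of the
  finite sets \<open>E n\<close> with \<open>n > 0\<close>. Countability later moves modules onto an
  arbitrary infinite type.\<close>

lemma countable_carrier: "countable (carrier k)"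
proof -
  have "finite (E n)" if "n > 0" for n
  proof -
    have "q ^ n \<ge> 2" using q_ge_2 that by (metis One_nat_def Suc_leI le_trans self_le_power zero_less_numeral order_less_le_trans)
    moreover have "E n = {x \<in> carrier k. x [^] (q ^ n) = x}" 
      unfolding E_def by (rule Collect_cong) (metis sgn_pow)
    ultimately show ?thesis using card_fixed_le(1) by simp
  qed
  moreover have "carrier k \<subseteq> (\<Union>n \<in> {0<..}. E n)"
  proof
    fix x assume x: "x \<in> carrier k"
    obtain n where "n > 0" "(sg ^^ n) x = x" using pow_periodic[OF x] by blast
    then show "x \<in> (\<Union>n \<in> {0<..}. E n)" using x unfolding E_def by blast
  qed
  moreover have "countable (\<Union>n \<in> {0<..}. E n)"
    by (rule countable_UN) (use calculation(1) in \<open>auto intro: countable_finite\<close>)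
  ultimately show ?thesis using countable_subset by blast
qed

lemma finsum_lessThan_Suc:
  assumes "abelian_monoid G" "\<And>i. i \<le> n \<Longrightarrow> f i \<in> carrier G"
  shows "finsum G f {..<Suc n} = f n \<oplus>\<^bsub>G\<^esub> finsum G f {..<n}"
proof -
  interpret G: abelian_monoid G by fact
  show ?thesis unfolding lessThan_Suc by (rule G.finsum_insert) (use assms in auto)
qed

text \<open>The sum is the additive polynomial \<open>X + X^Q + ... + X^(Q^(h-1))\<close> with
  \<open>Q = q^d\<close>. Divided by \<open>X\<close> it has constant term \<open>1\<close> and, as
  \<open>h \<ge> 2\<close>, positive degree; a root of the quotient is a nonzero root of the
  sum.\<close>

lemma ex_trace_zero:
  assumes d: "d > 0" and h: "h \<ge> 2"
  shows "\<exists>y \<in> carrier k. y \<noteq> \<zero> \<and> (\<Oplus>i\<in>{..<h}. (sg ^^ (d * i)) y) = \<zero>"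
proof -
  define Q where "Q = q ^ d"
  have Q2: "Q \<ge> 2" unfolding Q_def using q_ge_2 d
    by (metis One_nat_def Suc_leI le_trans self_le_power zero_less_numeral order_less_le_trans)
  have sq: "(sg ^^ (d * i)) x = x [^] (Q ^ i)" if "x \<in> carrier k" for x i
    using that by (simp add: sgn_pow Q_def power_mult)
  have "\<exists>p. polynomial (carrier k) p \<and> length p = Q ^ l \<and> eval p \<zero> = \<one> \<and>
    (\<forall>x \<in> carrier k. eval p x \<otimes> x = (\<Oplus>i\<in>{..<Suc l}. (sg ^^ (d * i)) x))" for l
  proof (induction l)
    case 0
    show ?case by (rule exI[of _ "[\<one>]"]) (auto simp: polynomial_def finsum_lessThan_Suc abelian_monoid_axioms)
  next
    case (Suc l)
    then obtain p where p: "polynomial (carrier k) p" "length p = Q ^ l" "eval p \<zero> = \<one>"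
      "\<And>x. x \<in> carrier k \<Longrightarrow> eval p x \<otimes> x = (\<Oplus>i\<in>{..<Suc l}. (sg ^^ (d * i)) x)" by blast
    have ps: "set p \<subseteq> carrier k" using p(1) polynomial_incl by blast
    have lt: "Q ^ l < Q ^ Suc l" using Q2 by (simp add: power_strict_increasing_iff)
    \<comment> \<open>The number of zero coefficients that brings the length to
      \<open>Q ^ Suc l\<close>, so that the new leading monomial times \<open>X\<close> is the next
      summand of the trace.\<close>
    define r where "r = Q ^ Suc l - Q ^ l - 1"
    have r: "r + Q ^ l = Q ^ Suc l - 1" using lt by (simp add: r_def del: power_Suc)
    have rp: "r + Q ^ l > 0" using Q2 by simp
    have ev: "eval (\<one> # replicate r \<zero> @ p) x = x [^] (r + Q ^ l) \<oplus> eval p x" if "x \<in> carrier k" for x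
      using eval_lead[OF ps that, of r] p(2) by simp
    show ?case
    proof (intro exI[of _ "\<one> # replicate r \<zero> @ p"] conjI ballI)
      show "polynomial (carrier k) (\<one> # replicate r \<zero> @ p)" by (rule polynomial_lead[OF ps])
      show "length (\<one> # replicate r \<zero> @ p) = Q ^ Suc l" using p(2) lt by (simp add: r_def del: power_Suc)
      show "eval (\<one> # replicate r \<zero> @ p) \<zero> = \<one>"
        using ev[of \<zero>] p(3) rp by (simp add: nat_pow_zero)
      fix x assume x: "x \<in> carrier k"
      have e: "eval p x \<in> carrier k" using eval_in_carrier[OF ps x] .
      have "(x [^] (r + Q ^ l) \<oplus> eval p x) \<otimes> x = x [^] Suc (r + Q ^ l) \<oplus> eval p x \<otimes> x"
        using x e by (simp add: l_distr)
      also have "Suc (r + Q ^ l) = Q ^ Suc l" using r lt by (simp del: power_Suc)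
      finally have "(x [^] (r + Q ^ l) \<oplus> eval p x) \<otimes> x = x [^] (Q ^ Suc l) \<oplus> eval p x \<otimes> x" .
      then show "eval (\<one> # replicate r \<zero> @ p) x \<otimes> x = (\<Oplus>i\<in>{..<Suc (Suc l)}. (sg ^^ (d * i)) x)"
        unfolding ev[OF x] p(4)[OF x] sq[OF x, symmetric]
        by (subst finsum_lessThan_Suc[of _ "Suc l"]) (use x abelian_monoid_axioms in auto)
    qed
  qed
  from this[of "h - 1"] h obtain p where p: "polynomial (carrier k) p" "length p = Q ^ (h - 1)" "eval p \<zero> = \<one>"
      "\<And>x. x \<in> carrier k \<Longrightarrow> eval p x \<otimes> x = (\<Oplus>i\<in>{..<h}. (sg ^^ (d * i)) x)"
    by (cases h) auto
  have "Q ^ (h - 1) > 1" using Q2 h by (intro one_less_power) auto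
  then obtain y where y: "y \<in> carrier k" "eval p y = \<zero>" using exists_root_k[OF p(1)] p(2) by auto
  then have "y \<noteq> \<zero>" using p(3) by auto
  then show ?thesis using y p(4)[OF y(1)] by auto
qed

text \<open>A root of \<open>X^Q - X - y\<close> with \<open>Q = q^d\<close>.\<close>

lemma ex_artin_schreier:
  assumes d: "d > 0" and y: "y \<in> carrier k"
  shows "\<exists>x \<in> carrier k. (sg ^^ d) x = x \<oplus> y"
proof -
  define Q where "Q = q ^ d"
  have Q2: "Q \<ge> 2" unfolding Q_def using q_ge_2 d
    by (metis One_nat_def Suc_leI le_trans self_le_power zero_less_numeral order_less_le_trans)
  define p where "p = \<one> # replicate (Q - 2) \<zero> @ [\<ominus> \<one>, \<ominus> y]"
  have "polynomial (carrier k) p" unfolding p_def by (rule polynomial_lead) (use y in auto)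
  then obtain x where x: "x \<in> carrier k" "eval p x = \<zero>" using exists_root_k[of p] by (auto simp: p_def)
  obtain t where t: "Q = Suc (Suc t)" using Q2 by (metis add_2_eq_Suc le_Suc_ex)
  have "eval p x = x [^] Q \<oplus> (\<ominus> x \<ominus> y)"
    unfolding p_def t by (subst eval_lead) (use x y in \<open>auto simp: a_minus_def l_minus\<close>)
  then have "x [^] Q \<oplus> \<ominus> (x \<oplus> y) = \<zero>" using x y by (simp add: minus_add a_minus_def)
  then have "x [^] Q = x \<oplus> y" using x y by (metis a_minus_def r_right_minus_eq add.m_closed nat_pow_closed)
  then show ?thesis using x by (auto simp: sgn_pow Q_def)
qed

text \<open>Otherwise the least positive exponent \<open>d\<close> that is trivial on
  \<open>E n\<close> divides \<open>n\<close>, say \<open>n = d h\<close> with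
  \<open>h \<ge> 2\<close>. Take a nonzero \<open>y\<close> of trace zero and \<open>x\<close> with
  \<open>\<sigma>^d(x) = x + y\<close>. Then \<open>\<sigma>^n(x) = x\<close>, so \<open>x\<close>
  lies in \<open>E n\<close>, but \<open>\<sigma>^d\<close> moves it.\<close>

lemma ex_not_fixed:
  assumes j: "0 < j" "j < n"
  shows "\<exists>m \<in> E n. (sg ^^ j) m \<noteq> m"
proof (rule ccontr)
  assume "\<not> ?thesis"
  then have all: "\<forall>m \<in> E n. (sg ^^ j) m = m" by blast
  define d where "d = (LEAST d. 0 < d \<and> (\<forall>m \<in> E n. (sg ^^ d) m = m))"
  have d: "0 < d" "\<And>m. m \<in> E n \<Longrightarrow> (sg ^^ d) m = m" and dj: "d \<le> j"
    and least: "\<And>r. r < d \<Longrightarrow> 0 < r \<Longrightarrow> \<not> (\<forall>m \<in> E n. (sg ^^ r) m = m)"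
    using LeastI[of "\<lambda>d. 0 < d \<and> (\<forall>m \<in> E n. (sg ^^ d) m = m)" j]
      Least_le[of "\<lambda>d. 0 < d \<and> (\<forall>m \<in> E n. (sg ^^ d) m = m)" j]
      not_less_Least[of _ "\<lambda>d. 0 < d \<and> (\<forall>m \<in> E n. (sg ^^ d) m = m)"] j all
    unfolding d_def by auto
  have mult: "(sg ^^ (d * t)) m = m" if "m \<in> E n" for m t
    using that d(2) by (induction t) (auto simp: funpow_add)
  have "n mod d = 0"
  proof (rule ccontr)
    assume r: "n mod d \<noteq> 0"
    have "(sg ^^ (n mod d)) m = m" if m: "m \<in> E n" for m
    proof -
      have "(sg ^^ (n mod d + d * (n div d))) m = m" 
        unfolding mod_mult_div_eq using m unfolding E_def by blast
      then show ?thesis unfolding funpow_add comp_apply mult[OF m] .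
    qed
    then show False using least[of "n mod d"] r d(1) by auto
  qed
  then obtain h where h: "n = d * h" by auto
  have h2: "h \<ge> 2" using j dj h d(1) by (cases h; cases "h - 1") auto
  obtain y where y: "y \<in> carrier k" "y \<noteq> \<zero>" "(\<Oplus>i\<in>{..<h}. (sg ^^ (d * i)) y) = \<zero>"
    using ex_trace_zero[OF d(1) h2] by blast
  obtain x where x: "x \<in> carrier k" "(sg ^^ d) x = x \<oplus> y" using ex_artin_schreier[OF d(1) y(1)] by blast
  \<comment> \<open>Iterating the equation for \<open>x\<close> adds up the conjugates of
    \<open>y\<close>; at \<open>t = h\<close> the sum is the vanishing trace.\<close>
  have "(sg ^^ (d * t)) x = x \<oplus> (\<Oplus>i\<in>{..<t}. (sg ^^ (d * i)) y)" for t
  proof (induction t)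
    case 0 show ?case using x by simp
  next
    case (Suc t)
    have "(sg ^^ (d * Suc t)) x = (sg ^^ (d * t)) ((sg ^^ d) x)"
      unfolding mult_Suc_right add.commute[of d] by (simp only: funpow_add comp_apply)
    also have "\<dots> = (sg ^^ (d * t)) x \<oplus> (sg ^^ (d * t)) y" using x y by (simp add: sgn_add)
    also have "\<dots> = x \<oplus> ((sg ^^ (d * t)) y \<oplus> (\<Oplus>i\<in>{..<t}. (sg ^^ (d * i)) y))"
      unfolding Suc using x y by (simp add: a_ac finsum_closed)
    finally show ?case using finsum_lessThan_Suc[of k t "\<lambda>i. (sg ^^ (d * i)) y"] y abelian_monoid_axioms by simp
  qed
  from this[of h] have "(sg ^^ n) x = x \<oplus> \<zero>" by (simp only: h y(3))
  then have "(sg ^^ n) x = x" using r_zero[OF x(1)] by (rule trans)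
  with x(1) have "x \<in> E n" unfolding E_def by blast
  then have "(sg ^^ d) x = x" by (rule d(2))
  then have "y = \<zero>" using x y by (metis add.l_cancel_one' )
  then show False using y by simp
qed

text \<open>
  The image of \<open>E n \<otimes> E n\<close> in the algebra of sequences under \<open>x \<otimes> y \<mapsto> (x \<sigma>\<^sup>i(y))\<^sub>i\<close>; up to
  index \<open>n\<close> it contains the separability idempotent of \<open>E n\<close> over \<open>Fq\<close>.
\<close>

inductive_set sep :: "nat \<Rightarrow> (nat \<Rightarrow> 'a) set" for n where
  base: "x \<in> E n \<Longrightarrow> y \<in> E n \<Longrightarrow> (\<lambda>i. x \<otimes> (sg ^^ i) y) \<in> sep n"
| add: "g \<in> sep n \<Longrightarrow> h \<in> sep n \<Longrightarrow> (\<lambda>i. g i \<oplus> h i) \<in> sep n"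

lemma sep_closed: "g \<in> sep n \<Longrightarrow> g i \<in> carrier k"
  by (induction rule: sep.induct) auto

lemma sep_mult:
  assumes "g \<in> sep n" "h \<in> sep n" shows "(\<lambda>i. g i \<otimes> h i) \<in> sep n"
  using assms(1)
proof induction
  case (base x y)
  show ?case using assms(2)
  proof induction
    case (base u v)
    have "(\<lambda>i. x \<otimes> (sg ^^ i) y \<otimes> (u \<otimes> (sg ^^ i) v)) = (\<lambda>i. (x \<otimes> u) \<otimes> (sg ^^ i) (y \<otimes> v))"
      using base \<open>x \<in> E n\<close> \<open>y \<in> E n\<close> by (auto simp: sgn_mult m_ac)
    then show ?case using sep.base[of "x \<otimes> u" n "y \<otimes> v"] base \<open>x \<in> E n\<close> \<open>y \<in> E n\<close> by simp
  next
    case (add g h)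
    have "(\<lambda>i. x \<otimes> (sg ^^ i) y \<otimes> (g i \<oplus> h i)) = (\<lambda>i. x \<otimes> (sg ^^ i) y \<otimes> g i \<oplus> x \<otimes> (sg ^^ i) y \<otimes> h i)"
      using sep_closed[OF add(1)] sep_closed[OF add(2)] \<open>x \<in> E n\<close> \<open>y \<in> E n\<close> by (auto simp: r_distr)
    then show ?case using sep.add[OF add(3,4)] by simp
  qed
next
  case (add g h')
  have "(\<lambda>i. (g i \<oplus> h' i) \<otimes> h i) = (\<lambda>i. g i \<otimes> h i \<oplus> h' i \<otimes> h i)"
    using sep_closed[OF add(1)] sep_closed[OF add(2)] sep_closed[OF assms(2)] by (auto simp: l_distr)
  then show ?case using sep.add[OF add(3,4)] by simp
qed

text \<open>Interpolation: \<open>sep n\<close> is closed under products, and for each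
  \<open>m\<close> strictly between \<open>0\<close> and \<open>n\<close> it contains a factor with
  value \<open>1\<close> at index \<open>0\<close> that vanishes at \<open>m\<close>. Indices from
  \<open>n\<close> on are left uncontrolled.\<close>

lemma sep_delta: "\<exists>g \<in> sep n. g 0 = \<one> \<and> (\<forall>i. 0 < i \<and> i < n \<longrightarrow> g i = \<zero>)"
proof -
  have "m \<le> n \<Longrightarrow> \<exists>g \<in> sep n. g 0 = \<one> \<and> (\<forall>i. 0 < i \<and> i < m \<longrightarrow> g i = \<zero>)" for m
  proof (induction m)
    case 0
    have "(\<lambda>i. \<one> \<otimes> (sg ^^ i) \<one>) \<in> sep n" by (rule sep.base) auto
    then show ?case by force
  next
    case (Suc m)
    then obtain g where g: "g \<in> sep n" "g 0 = \<one>" "\<And>i. 0 < i \<Longrightarrow> i < m \<Longrightarrow> g i = \<zero>" by auto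
    show ?case
    proof (cases "m = 0")
      case True then show ?thesis using g by auto
    next
      case False
      then obtain y where y: "y \<in> E n" "(sg ^^ m) y \<noteq> y" using ex_not_fixed[of m n] Suc(2) by auto
      define u where "u = inv (y \<ominus> (sg ^^ m) y)"
      have nz: "y \<ominus> (sg ^^ m) y \<noteq> \<zero>" using y by simp
      have e: "y \<ominus> (sg ^^ m) y \<in> E n" using y E_sg by simp
      have u: "u \<in> E n" unfolding u_def using e nz by simp
      \<comment> \<open>The factor \<open>u (\<sigma>^i(y) - \<sigma>^m(y))\<close>. Its constant
        term is written as a multiple of \<open>\<sigma>^i(1)\<close>, so that both summands have
        the shape that \<open>sep\<close> demands.\<close>
      define h where "h = (\<lambda>i. u \<otimes> (sg ^^ i) y \<oplus> (\<ominus> (u \<otimes> (sg ^^ m) y)) \<otimes> (sg ^^ i) \<one>)"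
      have h: "h \<in> sep n" unfolding h_def by (intro sep.intros) (use u y E_sg in auto)
      have hi: "h i = u \<otimes> ((sg ^^ i) y \<ominus> (sg ^^ m) y)" for i
        unfolding h_def using u y by (simp add: a_minus_def r_distr r_minus)
      have "h 0 = \<one>" unfolding hi u_def using e nz by (simp add: field_Units Units_l_inv)
      moreover have "h m = \<zero>" 
      proof -
        have c: "u \<in> carrier k" "(sg ^^ m) y \<in> carrier k" using E_closed(3)[OF u] E_closed(3)[OF y(1)] by auto
        have z: "(sg ^^ m) y \<ominus> (sg ^^ m) y = \<zero>" using c(2) by (simp add: diff_eq_zero_iff)
        show ?thesis unfolding hi z using c by simp
      qed
      ultimately show ?thesis
        using g h sep_mult[OF g(1) h] sep_closed[OF g(1)] sep_closed[OF h]
        by (intro bexI[of _ "\<lambda>i. g i \<otimes> h i"]) (auto simp: less_Suc_eq)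
    qed
  qed
  then show ?thesis by blast
qed

section \<open>A linear form on \<open>k\<close> over \<open>Fq\<close>\<close>

lemma Fq_closed [simp]:
  "\<zero> \<in> Fq" "\<one> \<in> Fq" "x \<in> Fq \<Longrightarrow> y \<in> Fq \<Longrightarrow> x \<oplus> y \<in> Fq" "x \<in> Fq \<Longrightarrow> y \<in> Fq \<Longrightarrow> x \<otimes> y \<in> Fq"
  "x \<in> Fq \<Longrightarrow> \<ominus> x \<in> Fq" "x \<in> Fq \<Longrightarrow> x \<noteq> \<zero> \<Longrightarrow> inv x \<in> Fq" "x \<in> Fq \<Longrightarrow> y \<in> Fq \<Longrightarrow> x \<ominus> y \<in> Fq"
  using subringE[OF subfieldE(1)[OF subfield_axioms]] subfield_m_inv(1)[OF subfield_axioms]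
  by (auto simp: a_minus_def)

text \<open>Zorn's lemma gives an \<open>Fq\<close>-subspace \<open>H\<close> maximal among those
  that avoid \<open>1\<close>. It is a complement of the line \<open>Fq\<close>, and the form is the
  projection onto this line along \<open>H\<close>.\<close>

lemma ex_functional:
  "\<exists>l. l \<in> carrier k \<rightarrow> Fq \<and> (\<forall>x \<in> carrier k. \<forall>y \<in> carrier k. l (x \<oplus> y) = l x \<oplus> l y) \<and>
     (\<forall>d \<in> Fq. \<forall>x \<in> carrier k. l (d \<otimes> x) = d \<otimes> l x) \<and> l \<one> = \<one>"
proof -
  define good where "good H \<longleftrightarrow> H \<subseteq> carrier k \<and> \<zero> \<in> H \<and> \<one> \<notin> H \<and> (\<forall>x \<in> H. \<forall>y \<in> H. x \<oplus> y \<in> H) \<and>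
    (\<forall>d \<in> Fq. \<forall>x \<in> H. d \<otimes> x \<in> H)" for H
  have "\<exists>H \<in> {H. good H}. \<forall>H' \<in> {H. good H}. H \<subseteq> H' \<longrightarrow> H' = H"
  proof (rule subset_Zorn_nonempty)
    show "{H. good H} \<noteq> {}" by (auto simp: good_def intro!: exI[of _ "{\<zero>}"])
  next
    fix C assume C: "C \<noteq> {}" "subset.chain {H. good H} C"
    then have g: "\<And>H. H \<in> C \<Longrightarrow> good H" and ch: "\<And>H H'. H \<in> C \<Longrightarrow> H' \<in> C \<Longrightarrow> H \<subseteq> H' \<or> H' \<subseteq> H"
      by (auto simp: subset_chain_def)
    have "x \<oplus> y \<in> \<Union>C" if xy: "x \<in> \<Union>C" "y \<in> \<Union>C" for x y
    proof -
      obtain H H' where "H \<in> C" "x \<in> H" "H' \<in> C" "y \<in> H'" using xy by blast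
      then obtain H'' where "H'' \<in> C" "x \<in> H''" "y \<in> H''" using ch by blast
      then show ?thesis using g[of H''] unfolding good_def by blast
    qed
    moreover have "d \<otimes> x \<in> \<Union>C" if "d \<in> Fq" "x \<in> \<Union>C" for d x
      using g that unfolding good_def by blast
    moreover have "\<Union>C \<subseteq> carrier k" "\<zero> \<in> \<Union>C" "\<one> \<notin> \<Union>C" using g C(1) unfolding good_def by blast+
    ultimately show "\<Union>C \<in> {H. good H}" unfolding good_def by blast
  qed
  then obtain H where H: "good H" and max: "\<And>H'. good H' \<Longrightarrow> H \<subseteq> H' \<Longrightarrow> H' = H" by blast
  have Hc: "H \<subseteq> carrier k" "\<zero> \<in> H" "\<one> \<notin> H" "\<And>x y. x \<in> H \<Longrightarrow> y \<in> H \<Longrightarrow> x \<oplus> y \<in> H"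
    "\<And>d x. d \<in> Fq \<Longrightarrow> x \<in> H \<Longrightarrow> d \<otimes> x \<in> H" using H by (auto simp: good_def)
  have Hm: "\<ominus> x \<in> H" if "x \<in> H" for x
  proof -
    have "\<ominus> x = (\<ominus> \<one>) \<otimes> x" using that Hc(1) by (auto simp: l_minus)
    then show ?thesis using Hc(5)[of "\<ominus> \<one>" x] that by simp
  qed
  have Hd: "x \<ominus> y \<in> H" if "x \<in> H" "y \<in> H" for x y using that Hc(4) Hm by (simp add: a_minus_def)
  have ex: "\<exists>d \<in> Fq. c \<ominus> d \<in> H" if c: "c \<in> carrier k" for c
  proof (rule ccontr)
    assume no: "\<not> ?thesis"
    \<comment> \<open>If \<open>c\<close> lies outside \<open>H + Fq\<close>, then
      \<open>H + Fq c\<close> still avoids \<open>1\<close>: an equation \<open>1 = h + d c\<close>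
      with \<open>h \<in> H\<close> would put \<open>c - 1/d\<close> into \<open>H\<close>. This
      contradicts maximality.\<close>
    define H' where "H' = {h \<oplus> d \<otimes> c | h d. h \<in> H \<and> d \<in> Fq}"
    have "good H'"
      unfolding good_def
    proof (intro conjI ballI)
      show "H' \<subseteq> carrier k" using Hc(1) c by (auto simp: H'_def)
      show "\<zero> \<in> H'" unfolding H'_def using Hc(2) c by (auto intro!: exI[of _ \<zero>])
      show "\<one> \<notin> H'"
      proof
        assume "\<one> \<in> H'"
        then obtain h d where hd: "h \<in> H" "d \<in> Fq" "\<one> = h \<oplus> d \<otimes> c" by (auto simp: H'_def)
        have hk: "h \<in> carrier k" using hd Hc(1) by auto
        have d0: "d \<noteq> \<zero>" using hd Hc(3) hk c by auto
        have id: "inv d \<in> Fq" "inv d \<in> carrier k" "inv d \<otimes> d = \<one>" using d0 hd by (auto simp: field_Units)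
        have "inv d = inv d \<otimes> h \<oplus> c"
        proof -
          have "inv d \<otimes> \<one> = inv d \<otimes> (h \<oplus> d \<otimes> c)" using arg_cong[OF hd(3), of "\<lambda>z. inv d \<otimes> z"] .
          also have "\<dots> = inv d \<otimes> h \<oplus> inv d \<otimes> (d \<otimes> c)" using hd(1,2) hk c id by (simp add: r_distr)
          finally have "inv d \<otimes> \<one> = inv d \<otimes> h \<oplus> inv d \<otimes> (d \<otimes> c)" .
          then show ?thesis using id hd(2) c by (simp add: m_assoc[symmetric])
        qed
        moreover have "c \<ominus> (w \<oplus> c) = \<ominus> w" if "w \<in> carrier k" for w
          using that c by (simp add: a_minus_def minus_add a_lcomm[of c "\<ominus> w" "\<ominus> c"] r_neg)
        ultimately have "c \<ominus> inv d = \<ominus> (inv d \<otimes> h)" using monoid.m_closed[OF monoid_axioms id(2) hk] by metis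
        also have "\<dots> \<in> H" using Hm Hc(5) id hd by simp
        finally show False using no id by blast
      qed
      show "x \<oplus> y \<in> H'" if xy: "x \<in> H'" "y \<in> H'" for x y
      proof -
        obtain h d h' d' where e: "x = h \<oplus> d \<otimes> c" "y = h' \<oplus> d' \<otimes> c" "h \<in> H" "d \<in> Fq" "h' \<in> H" "d' \<in> Fq"
          using xy unfolding H'_def by blast
        have "h \<in> carrier k" "h' \<in> carrier k" using e Hc(1) by auto
        then have "x \<oplus> y = (h \<oplus> h') \<oplus> (d \<oplus> d') \<otimes> c"
          unfolding e(1,2) using e(3-6) c by (simp add: l_distr a_ac)
        moreover have "h \<oplus> h' \<in> H" "d \<oplus> d' \<in> Fq" using e Hc(4) by auto
        ultimately show ?thesis unfolding H'_def by blast
      qed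
      show "a \<otimes> x \<in> H'" if ax: "a \<in> Fq" "x \<in> H'" for a x
      proof -
        obtain h d where e: "x = h \<oplus> d \<otimes> c" "h \<in> H" "d \<in> Fq" using ax unfolding H'_def by blast
        have "h \<in> carrier k" using e Hc(1) by auto
        then have "a \<otimes> x = (a \<otimes> h) \<oplus> (a \<otimes> d) \<otimes> c"
          unfolding e(1) using e(2,3) c ax(1) by (simp add: r_distr m_assoc)
        moreover have "a \<otimes> h \<in> H" "a \<otimes> d \<in> Fq" using e ax Hc(5) by auto
        ultimately show ?thesis unfolding H'_def by blast
      qed
    qed
    moreover have "H \<subseteq> H'"
    proof
      fix h assume "h \<in> H"
      moreover have "h = h \<oplus> \<zero> \<otimes> c" using \<open>h \<in> H\<close> Hc(1) c by auto
      ultimately show "h \<in> H'" unfolding H'_def by (metis (mono_tags, lifting) Fq_closed(1) mem_Collect_eq)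
    qed
    ultimately have "H' = H" using max by blast
    moreover have "c = \<zero> \<oplus> \<one> \<otimes> c" using c by simp
    then have "c \<in> H'" unfolding H'_def using Hc(2) by (metis (mono_tags, lifting) Fq_closed(2) mem_Collect_eq)
    ultimately have "c \<ominus> \<zero> \<in> H" using c by (simp add: a_minus_def)
    then show False using no Fq_closed(1) by blast
  qed
  have un: "d = d'" if "c \<in> carrier k" "d \<in> Fq" "d' \<in> Fq" "c \<ominus> d \<in> H" "c \<ominus> d' \<in> H" for c d d'
  proof (rule ccontr)
    assume ne: "d \<noteq> d'"
    have "(c \<ominus> d') \<ominus> (c \<ominus> d) \<in> H" using Hd that by simp
    moreover have "(c \<ominus> d') \<ominus> (c \<ominus> d) = d \<ominus> d'"
      using that by (simp add: a_minus_def minus_add a_ac r_neg2 r_neg1)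
    ultimately have dd: "d \<ominus> d' \<in> H" by simp
    have nz: "d \<ominus> d' \<noteq> \<zero>" using ne that by simp
    have "inv (d \<ominus> d') \<otimes> (d \<ominus> d') \<in> H" by (rule Hc(5)[OF _ dd]) (use nz that in simp)
    then show False using Hc(3) nz that by (simp add: field_Units)
  qed
  obtain l where l: "\<And>c. c \<in> carrier k \<Longrightarrow> l c \<in> Fq \<and> c \<ominus> l c \<in> H" using ex by metis
  have lk: "l c \<in> carrier k" if "c \<in> carrier k" for c using l that by auto
  have eq: "l c = d" if "c \<in> carrier k" "d \<in> Fq" "c \<ominus> d \<in> H" for c d
    using un l that by blast
  show ?thesis
  proof (intro exI[of _ l] conjI ballI)
    show "l \<in> carrier k \<rightarrow> Fq" using l by auto
    show "l (x \<oplus> y) = l x \<oplus> l y" if "x \<in> carrier k" "y \<in> carrier k" for x y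
    proof (rule eq)
      have "(x \<ominus> l x) \<oplus> (y \<ominus> l y) \<in> H" using l that Hc(4) by simp
      then show "x \<oplus> y \<ominus> (l x \<oplus> l y) \<in> H" using that lk by (simp add: a_minus_def minus_add a_ac)
    qed (use l that in auto)
    show "l (d \<otimes> x) = d \<otimes> l x" if "d \<in> Fq" "x \<in> carrier k" for d x
    proof (rule eq)
      have "d \<otimes> (x \<ominus> l x) \<in> H" using l that Hc(5) by simp
      then show "d \<otimes> x \<ominus> d \<otimes> l x \<in> H" using that lk by (simp add: a_minus_def r_distr r_minus)
    qed (use l that in auto)
    show "l \<one> = \<one>" by (rule eq) (use Hc(2) in \<open>auto simp: a_minus_def r_neg\<close>)
  qed
qed

end

subsection \<open>Vector spaces with a Frobenius map\<close>

lemma common_period: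
  assumes "finite S" "\<And>s. s \<in> S \<Longrightarrow> \<exists>n > 0. (f ^^ n) s = s"
  shows "\<exists>n > 0. \<forall>s \<in> S. (f ^^ n) s = s"
  using assms
proof (induction S rule: finite_induct)
  case (insert x S)
  obtain n where n: "n > 0" "\<forall>s \<in> S. (f ^^ n) s = s" using insert by blast
  obtain m where m: "m > 0" "(f ^^ m) x = x" using insert(4)[of x] by blast
  have p: "(f ^^ (a * t)) s = s" if "(f ^^ a) s = s" for a t s
    using that by (induction t) (simp_all add: funpow_add)
  have "(f ^^ (n * m)) s = s" if "s \<in> insert x S" for s
    using that p[of n s m] p[of m s n] n m by (auto simp: mult.commute)
  moreover have "n * m > 0" using n m by simp
  ultimately show ?case by blast
qed auto

section \<open>Coordinates with respect to a finite basis\<close>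

context finite_field_closure
begin

lemma basis_unique:
  assumes V: "vectorspace k V" and Y: "finite Y" "vectorspace.basis k V Y"
    and a: "a \<in> Y \<rightarrow> carrier k" and b: "b \<in> Y \<rightarrow> carrier k"
    and eq: "module.lincomb V a Y = module.lincomb V b Y" and y: "y \<in> Y"
  shows "a y = b y"
proof -
  interpret V: vectorspace k V by fact
  have Yc: "Y \<subseteq> carrier V" using Y(2) by (simp add: V.basis_def)
  have "\<exists>!c. c \<in> Y \<rightarrow>\<^sub>E carrier k \<and> V.lincomb c Y = V.lincomb a Y"
    using V.basis_criterion[OF Y(1) Yc] Y(2) V.lincomb_closed[OF Yc a] by blast
  moreover have "restrict a Y \<in> Y \<rightarrow>\<^sub>E carrier k" "restrict b Y \<in> Y \<rightarrow>\<^sub>E carrier k" using a b by auto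
  moreover have "V.lincomb (restrict a Y) Y = V.lincomb a Y"
    by (rule V.lincomb_cong) (use Yc a in auto)
  moreover have "V.lincomb (restrict b Y) Y = V.lincomb a Y"
    unfolding eq by (rule V.lincomb_cong) (use Yc b in auto)
  ultimately have "restrict a Y = restrict b Y" by blast
  then show ?thesis using y by (metis restrict_apply')
qed

lemma ex_coordinates:
  assumes V: "vectorspace k V" and Y: "finite Y" "vectorspace.basis k V Y"
  obtains co where "\<And>v. v \<in> carrier V \<Longrightarrow> co v \<in> Y \<rightarrow> carrier k"
    "\<And>v. v \<in> carrier V \<Longrightarrow> module.lincomb V (co v) Y = v"
    "\<And>u v y. u \<in> carrier V \<Longrightarrow> v \<in> carrier V \<Longrightarrow> y \<in> Y \<Longrightarrow> co (u \<oplus>\<^bsub>V\<^esub> v) y = co u y \<oplus> co v y"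
    "\<And>c v y. c \<in> carrier k \<Longrightarrow> v \<in> carrier V \<Longrightarrow> y \<in> Y \<Longrightarrow> co (c \<odot>\<^bsub>V\<^esub> v) y = c \<otimes> co v y"
proof -
  interpret V: vectorspace k V by fact
  have Yc: "Y \<subseteq> carrier V" using Y(2) by (simp add: V.basis_def)
  have "\<exists>a. a \<in> Y \<rightarrow> carrier k \<and> V.lincomb a Y = v" if "v \<in> carrier V" for v
    using Y(2) that V.finite_in_span[OF Y(1) Yc, of v] by (auto simp: V.basis_def)
  then obtain co where co: "\<And>v. v \<in> carrier V \<Longrightarrow> co v \<in> Y \<rightarrow> carrier k"
    "\<And>v. v \<in> carrier V \<Longrightarrow> V.lincomb (co v) Y = v" by metis
  have cok: "co v y \<in> carrier k" if "v \<in> carrier V" "y \<in> Y" for v y using co(1)[OF that(1)] that(2) by auto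
  have coa: "co (u \<oplus>\<^bsub>V\<^esub> v) y = co u y \<oplus> co v y" if u: "u \<in> carrier V" and v: "v \<in> carrier V" and y: "y \<in> Y" for u v y
  proof (rule basis_unique[OF V Y _ _ _ y])
    show "co (u \<oplus>\<^bsub>V\<^esub> v) \<in> Y \<rightarrow> carrier k" by (rule co(1)) (use u v in simp)
    show "(\<lambda>y. co u y \<oplus> co v y) \<in> Y \<rightarrow> carrier k" using cok u v by simp
    show "V.lincomb (co (u \<oplus>\<^bsub>V\<^esub> v)) Y = V.lincomb (\<lambda>y. co u y \<oplus> co v y) Y"
      unfolding V.lincomb_sum[OF Y(1) Yc co(1)[OF u] co(1)[OF v]] co(2)[OF u] co(2)[OF v]
      by (rule co(2)) (use u v in simp)
  qed
  have com: "co (c \<odot>\<^bsub>V\<^esub> v) y = c \<otimes> co v y" if c: "c \<in> carrier k" and v: "v \<in> carrier V" and y: "y \<in> Y" for c v y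
  proof (rule basis_unique[OF V Y _ _ _ y])
    show "co (c \<odot>\<^bsub>V\<^esub> v) \<in> Y \<rightarrow> carrier k" by (rule co(1)) (use c v in simp)
    show "(\<lambda>y. c \<otimes> co v y) \<in> Y \<rightarrow> carrier k" using cok c v by simp
    show "V.lincomb (co (c \<odot>\<^bsub>V\<^esub> v)) Y = V.lincomb (\<lambda>y. c \<otimes> co v y) Y"
      unfolding V.lincomb_smult[OF Yc co(1)[OF v] c] co(2)[OF v]
      by (rule co(2)) (use c v in simp)
  qed
  show thesis by (rule that[of co]) (rule co coa com; assumption)+
qed

lemma countable_vectorspace:
  assumes V: "vectorspace k V" and fd: "vectorspace.fin_dim k V"
  shows "countable (carrier V)"
proof -
  interpret V: vectorspace k V by fact
  obtain Y where Y: "finite Y" "V.basis Y" using V.finite_basis_exists[OF fd] by blast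
  have Yc: "Y \<subseteq> carrier V" using Y(2) by (simp add: V.basis_def)
  obtain co where co: "\<And>v. v \<in> carrier V \<Longrightarrow> co v \<in> Y \<rightarrow> carrier k"
      "\<And>v. v \<in> carrier V \<Longrightarrow> V.lincomb (co v) Y = v"
    by (rule ex_coordinates[OF V Y]) (rule that)
  have "countable (Y \<rightarrow>\<^sub>E carrier k)" 
    using Y(1)
  proof (induction Y rule: finite_induct)
    case (insert y Y)
    then show ?case by (simp add: PiE_insert_eq countable_carrier)
  qed simp
  moreover have "carrier V \<subseteq> (\<lambda>a. V.lincomb a Y) ` (Y \<rightarrow>\<^sub>E carrier k)"
  proof
    fix v assume v: "v \<in> carrier V"
    have "V.lincomb (restrict (co v) Y) Y = V.lincomb (co v) Y"
      by (rule V.lincomb_cong) (use Yc co[OF v] in auto)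
    then show "v \<in> (\<lambda>a. V.lincomb a Y) ` (Y \<rightarrow>\<^sub>E carrier k)"
      using co[OF v] by (intro image_eqI[of _ _ "restrict (co v) Y"]) auto
  qed
  ultimately show ?thesis by (meson countable_image countable_subset)
qed

end

locale frobenius_space = finite_field_closure k Fq q + V: vectorspace k V
  for k :: "('a, 'b) ring_scheme" (structure) and Fq q and V :: "('a, 'v, 'z) module_scheme" +
  fixes \<phi> :: "'v \<Rightarrow> 'v"
  assumes fd_V: "V.fin_dim"
    and phi_closed: "v \<in> carrier V \<Longrightarrow> \<phi> v \<in> carrier V"
    and phi_add: "u \<in> carrier V \<Longrightarrow> v \<in> carrier V \<Longrightarrow> \<phi> (u \<oplus>\<^bsub>V\<^esub> v) = \<phi> u \<oplus>\<^bsub>V\<^esub> \<phi> v"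
    and phi_smult: "c \<in> carrier k \<Longrightarrow> v \<in> carrier V \<Longrightarrow> \<phi> (c \<odot>\<^bsub>V\<^esub> v) = c [^] q \<odot>\<^bsub>V\<^esub> \<phi> v"
    and phi_periodic: "v \<in> carrier V \<Longrightarrow> \<exists>n > 0. (\<phi> ^^ n) v = v"
begin

definition fx :: "'v set" where "fx = {v \<in> carrier V. \<phi> v = v}"

lemma fx_closed: "v \<in> fx \<Longrightarrow> v \<in> carrier V" by (simp add: fx_def)

lemma fx_phi: "v \<in> fx \<Longrightarrow> \<phi> v = v" by (simp add: fx_def)

lemma fxI: "v \<in> carrier V \<Longrightarrow> \<phi> v = v \<Longrightarrow> v \<in> fx" by (simp add: fx_def)

lemma fx_phin: "v \<in> fx \<Longrightarrow> (\<phi> ^^ n) v = v" by (induction n) (auto simp: fx_phi)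

lemma phin_closed: "v \<in> carrier V \<Longrightarrow> (\<phi> ^^ n) v \<in> carrier V"
  by (induction n) (auto simp: phi_closed)

lemma phin_add: "u \<in> carrier V \<Longrightarrow> v \<in> carrier V \<Longrightarrow> (\<phi> ^^ n) (u \<oplus>\<^bsub>V\<^esub> v) = (\<phi> ^^ n) u \<oplus>\<^bsub>V\<^esub> (\<phi> ^^ n) v"
  by (induction n) (auto simp: phi_add phin_closed)

lemma phin_smult: "c \<in> carrier k \<Longrightarrow> v \<in> carrier V \<Longrightarrow> (\<phi> ^^ n) (c \<odot>\<^bsub>V\<^esub> v) = (sg ^^ n) c \<odot>\<^bsub>V\<^esub> (\<phi> ^^ n) v"
  by (induction n) (auto simp: phi_smult phin_closed)

lemma phi_zero: "\<phi> \<zero>\<^bsub>V\<^esub> = \<zero>\<^bsub>V\<^esub>"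
  by (rule additive_zero[OF V.M.abelian_group_axioms V.M.abelian_group_axioms])
    (auto simp: phi_add phi_closed)

lemma fx_zero: "\<zero>\<^bsub>V\<^esub> \<in> fx" by (simp add: fx_def phi_zero)

lemma fx_add: "u \<in> fx \<Longrightarrow> v \<in> fx \<Longrightarrow> u \<oplus>\<^bsub>V\<^esub> v \<in> fx" by (simp add: fx_def phi_add)

lemma fx_smult: "d \<in> Fq \<Longrightarrow> v \<in> fx \<Longrightarrow> d \<odot>\<^bsub>V\<^esub> v \<in> fx" by (simp add: fx_def phi_smult pow_Fq)

text \<open>Every vector is periodic, so \<open>V\<close> is a union of finite cycles of
  \<open>\<phi>\<close>.\<close>

lemma phi_bij: "bij_betw \<phi> (carrier V) (carrier V)"
proof -
  have "inj_on \<phi> (carrier V)"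
  proof (rule inj_onI)
    fix u v assume uv: "u \<in> carrier V" "v \<in> carrier V" "\<phi> u = \<phi> v"
    obtain n where n: "n > 0" "(\<phi> ^^ n) u = u" "(\<phi> ^^ n) v = v"
      using common_period[of "{u, v}" \<phi>] phi_periodic uv by auto
    obtain m where "n = Suc m" using n(1) gr0_implies_Suc by blast
    then have "(\<phi> ^^ n) u = (\<phi> ^^ m) (\<phi> u)" "(\<phi> ^^ n) v = (\<phi> ^^ m) (\<phi> v)"
      by (simp_all add: funpow_Suc_right del: funpow.simps)
    then show "u = v" using n uv(3) by simp
  qed
  moreover have "carrier V \<subseteq> \<phi> ` carrier V"
  proof
    fix v assume v: "v \<in> carrier V"
    then obtain n where n: "n > 0" "(\<phi> ^^ n) v = v" using phi_periodic by blast
    obtain m where "n = Suc m" using n(1) gr0_implies_Suc by blast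
    then have "v = \<phi> ((\<phi> ^^ m) v)" using n by simp
    then show "v \<in> \<phi> ` carrier V" using phin_closed[OF v] by blast
  qed
  ultimately show ?thesis using phi_closed by (auto simp: bij_betw_def)
qed

lemma phi_frobenius_map: "\<phi> \<in> frobenius_map k Fq V"
  unfolding frobenius_map_def module_hom_def
  using phi_bij phi_add phi_closed phi_smult phi_periodic by (auto simp: card_Fq pow_Fq)

section \<open>Traces, and sequences \<open>g\<close> acting as the operators
  \<open>\<Sigma> g_i \<phi>^i\<close>\<close>

definition comb :: "(nat \<Rightarrow> 'a) \<Rightarrow> nat \<Rightarrow> 'v \<Rightarrow> 'v" where
  "comb g n v = (\<Oplus>\<^bsub>V\<^esub>i\<in>{..<n}. g i \<odot>\<^bsub>V\<^esub> (\<phi> ^^ i) v)"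

definition tr :: "nat \<Rightarrow> 'v \<Rightarrow> 'v" where
  "tr n v = (\<Oplus>\<^bsub>V\<^esub>i\<in>{..<n}. (\<phi> ^^ i) v)"

lemma tr_closed: "v \<in> carrier V \<Longrightarrow> tr n v \<in> carrier V"
  unfolding tr_def by (rule V.M.finsum_closed) (auto simp: phin_closed)

lemma comb_closed: "v \<in> carrier V \<Longrightarrow> (\<And>i. g i \<in> carrier k) \<Longrightarrow> comb g n v \<in> carrier V"
  unfolding comb_def by (rule V.M.finsum_closed) (auto simp: phin_closed)

lemma tr_fixed:
  assumes v: "v \<in> carrier V" and n: "(\<phi> ^^ n) v = v" shows "tr n v \<in> fx"
proof -
  have t: "tr (Suc m) v = (\<phi> ^^ m) v \<oplus>\<^bsub>V\<^esub> tr m v" for m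
    unfolding tr_def by (rule finsum_lessThan_Suc[OF V.M.abelian_monoid_axioms]) (auto simp: phin_closed v)
  \<comment> \<open>The telescoping identity \<open>\<phi>(tr_m) - tr_m = \<phi>^m(v) - v\<close>,
    stated without subtraction.\<close>
  have "\<phi> (tr m v) \<oplus>\<^bsub>V\<^esub> v = tr m v \<oplus>\<^bsub>V\<^esub> (\<phi> ^^ m) v" for m
  proof (induction m)
    case 0 show ?case using v by (simp add: tr_def phi_zero)
  next
    case (Suc m)
    have c: "(\<phi> ^^ m) v \<in> carrier V" "\<phi> ((\<phi> ^^ m) v) \<in> carrier V" "tr m v \<in> carrier V" "\<phi> (tr m v) \<in> carrier V"
      using phin_closed[OF v] tr_closed[OF v] phi_closed by auto
    have "\<phi> (tr (Suc m) v) \<oplus>\<^bsub>V\<^esub> v = \<phi> ((\<phi> ^^ m) v) \<oplus>\<^bsub>V\<^esub> (\<phi> (tr m v) \<oplus>\<^bsub>V\<^esub> v)"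
      unfolding t using c v by (simp add: phi_add V.M.a_assoc)
    also have "\<dots> = tr (Suc m) v \<oplus>\<^bsub>V\<^esub> (\<phi> ^^ Suc m) v"
      unfolding Suc t using c by (simp add: V.M.a_ac)
    finally show ?case .
  qed
  from this[of n] have "\<phi> (tr n v) = tr n v"
    unfolding n using v tr_closed[OF v] phi_closed by simp
  then show ?thesis using tr_closed[OF v] by (simp add: fx_def)
qed

text \<open>This is why sequences in \<open>sep n\<close> are useful: those of an elementary tensor
  act as operators that pass through a trace, hence through a fixed point when
  \<open>\<phi>^n\<close> fixes \<open>y v\<close>.\<close>

lemma comb_base:
  assumes "x \<in> carrier k" "y \<in> carrier k" "v \<in> carrier V"
  shows "comb (\<lambda>i. x \<otimes> (sg ^^ i) y) n v = x \<odot>\<^bsub>V\<^esub> tr n (y \<odot>\<^bsub>V\<^esub> v)"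
proof -
  have "x \<odot>\<^bsub>V\<^esub> tr n (y \<odot>\<^bsub>V\<^esub> v) = (\<Oplus>\<^bsub>V\<^esub>i\<in>{..<n}. x \<odot>\<^bsub>V\<^esub> (\<phi> ^^ i) (y \<odot>\<^bsub>V\<^esub> v))"
    unfolding tr_def by (rule V.finsum_smult) (use assms phin_closed in auto)
  also have "\<dots> = comb (\<lambda>i. x \<otimes> (sg ^^ i) y) n v"
    unfolding comb_def
    by (rule V.M.finsum_cong') (use assms in \<open>auto simp: phin_smult phin_closed V.smult_assoc1\<close>)
  finally show ?thesis by simp
qed

lemma comb_add:
  assumes "\<And>i. g i \<in> carrier k" "\<And>i. h i \<in> carrier k" "v \<in> carrier V"
  shows "comb (\<lambda>i. g i \<oplus> h i) n v = comb g n v \<oplus>\<^bsub>V\<^esub> comb h n v"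
proof -
  have "comb g n v \<oplus>\<^bsub>V\<^esub> comb h n v = (\<Oplus>\<^bsub>V\<^esub>i\<in>{..<n}. g i \<odot>\<^bsub>V\<^esub> (\<phi> ^^ i) v \<oplus>\<^bsub>V\<^esub> h i \<odot>\<^bsub>V\<^esub> (\<phi> ^^ i) v)"
    unfolding comb_def by (rule V.M.finsum_addf[symmetric]) (use assms phin_closed in auto)
  also have "\<dots> = comb (\<lambda>i. g i \<oplus> h i) n v"
    unfolding comb_def
    by (rule V.M.finsum_cong') (use assms in \<open>auto simp: phin_closed V.smult_l_distr\<close>)
  finally show ?thesis by simp
qed

lemma comb_add_right:
  assumes "\<And>i. g i \<in> carrier k" "u \<in> carrier V" "v \<in> carrier V"
  shows "comb g n (u \<oplus>\<^bsub>V\<^esub> v) = comb g n u \<oplus>\<^bsub>V\<^esub> comb g n v"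
proof -
  have "comb g n u \<oplus>\<^bsub>V\<^esub> comb g n v = (\<Oplus>\<^bsub>V\<^esub>i\<in>{..<n}. g i \<odot>\<^bsub>V\<^esub> (\<phi> ^^ i) u \<oplus>\<^bsub>V\<^esub> g i \<odot>\<^bsub>V\<^esub> (\<phi> ^^ i) v)"
    unfolding comb_def by (rule V.M.finsum_addf[symmetric]) (use assms phin_closed in auto)
  also have "\<dots> = comb g n (u \<oplus>\<^bsub>V\<^esub> v)"
    unfolding comb_def
    by (rule V.M.finsum_cong') (use assms in \<open>auto simp: phin_closed phin_add V.smult_r_distr\<close>)
  finally show ?thesis by simp
qed

lemma tr_as_comb: "v \<in> carrier V \<Longrightarrow> tr n v = comb (\<lambda>i. \<one>) n v"
  using comb_base[of \<one> \<one> v n] tr_closed[of v n] by simp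

lemma comb_delta:
  assumes n: "n > 0" and g: "\<And>i. g i \<in> carrier k" "g 0 = \<one>" "\<And>i. 0 < i \<Longrightarrow> i < n \<Longrightarrow> g i = \<zero>" and v: "v \<in> carrier V"
  shows "comb g n v = v"
proof -
  have t: "comb g (Suc m) v = g m \<odot>\<^bsub>V\<^esub> (\<phi> ^^ m) v \<oplus>\<^bsub>V\<^esub> comb g m v" for m
    unfolding comb_def by (rule finsum_lessThan_Suc[OF V.M.abelian_monoid_axioms]) (auto simp: phin_closed v g)
  have "m < n \<Longrightarrow> comb g (Suc m) v = v" for m
  proof (induction m)
    case 0 show ?case unfolding t using v g by (simp add: comb_def)
  next
    case (Suc m) then show ?case unfolding t[of "Suc m"] using g(3)[of "Suc m"] v phin_closed[OF v, of "Suc m"] by simp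
  qed
  then show ?thesis using n by (metis Suc_pred' lessI)
qed

text \<open>
  The fixed points span \<open>V\<close>: if \<open>\<phi>\<^sup>n(v) = v\<close>, the separability idempotent writes \<open>v\<close> as a sum of
  terms \<open>x tr(y v)\<close>.
\<close>

lemma frob_induct:
  assumes v: "v \<in> carrier V"
    and base: "\<And>c y. c \<in> carrier k \<Longrightarrow> y \<in> fx \<Longrightarrow> P (c \<odot>\<^bsub>V\<^esub> y)"
    and add: "\<And>u v. u \<in> carrier V \<Longrightarrow> v \<in> carrier V \<Longrightarrow> P u \<Longrightarrow> P v \<Longrightarrow> P (u \<oplus>\<^bsub>V\<^esub> v)"
  shows "P v"
proof -
  obtain n where n: "n > 0" "(\<phi> ^^ n) v = v" using phi_periodic[OF v] by blast
  have P: "P (comb g n v)" if "g \<in> sep n" for g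
    using that
  proof induction
    case (base x y)
    have xy: "x \<in> carrier k" "y \<in> carrier k" "(sg ^^ n) y = y" using base by (auto simp only: E_def mem_Collect_eq)
    have "(\<phi> ^^ n) (y \<odot>\<^bsub>V\<^esub> v) = y \<odot>\<^bsub>V\<^esub> v" unfolding phin_smult[OF xy(2) v] n(2) xy(3) ..
    then have "tr n (y \<odot>\<^bsub>V\<^esub> v) \<in> fx" using tr_fixed xy v by simp
    then show ?case unfolding comb_base[OF xy(1,2) v] using assms(2) xy(1) by blast
  next
    case (add g h)
    then show ?case
      using comb_add[of g h v n] sep_closed comb_closed v assms(3) by simp
  qed
  obtain g where "g \<in> sep n" "g 0 = \<one>" "\<forall>i. 0 < i \<and> i < n \<longrightarrow> g i = \<zero>" using sep_delta by blast
  then show ?thesis using P[of g] comb_delta[OF n(1), of g v] sep_closed v by auto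
qed

text \<open>A maximal independent set of fixed points spans all fixed points, hence \<open>V\<close>
  by \<open>frob_induct\<close>.\<close>

lemma ex_fixed_basis: "\<exists>Y. finite Y \<and> Y \<subseteq> fx \<and> V.basis Y"
proof -
  have "\<exists>Y. finite Y \<and> maximal Y (\<lambda>S. S \<subseteq> fx \<and> V.lin_indpt S)"
  proof (rule maximal_exists)
    show "{} \<subseteq> fx \<and> V.lin_indpt {}" by (auto simp: V.lin_dep_def)
    show "S \<subseteq> fx \<and> V.lin_indpt S \<Longrightarrow> finite S \<and> card S \<le> V.dim" for S
      using V.li_le_dim[OF fd_V] fx_closed by blast
  qed
  then obtain Y where Y: "finite Y" "maximal Y (\<lambda>S. S \<subseteq> fx \<and> V.lin_indpt S)" by blast
  then have Yf: "Y \<subseteq> fx" "V.lin_indpt Y" by (auto simp: maximal_def)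
  have Yc: "Y \<subseteq> carrier V" using Yf fx_closed by blast
  have sub: "LinearCombinations.submodule k (V.span Y) V" by (rule V.span_is_submodule[OF Yc])
  have "fx \<subseteq> V.span Y"
  proof
    fix y assume y: "y \<in> fx"
    show "y \<in> V.span Y"
    proof (rule ccontr)
      assume n: "y \<notin> V.span Y"
      then have "y \<notin> Y" using V.in_own_span[OF Yc] by blast
      then have "V.lin_indpt (Y \<union> {y})" using V.lin_dep_iff_in_span[OF Yc Yf(2) fx_closed[OF y]] n by blast
      moreover have "Y \<union> {y} \<subseteq> fx" using y Yf by blast
      ultimately have "Y \<union> {y} = Y" using Y(2) unfolding maximal_def by blast
      then show False using \<open>y \<notin> Y\<close> by blast
    qed
  qed
  then have "carrier V \<subseteq> V.span Y"
  proof (intro subsetI)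
    fix v assume v: "v \<in> carrier V" and le: "fx \<subseteq> V.span Y"
    from v show "v \<in> V.span Y"
    proof (rule frob_induct)
      show "c \<odot>\<^bsub>V\<^esub> y \<in> V.span Y" if "c \<in> carrier k" "y \<in> fx" for c y
        using submodule.smult_closed[OF sub that(1)] le that(2) by blast
      show "u \<oplus>\<^bsub>V\<^esub> w \<in> V.span Y" if "u \<in> V.span Y" "w \<in> V.span Y" for u w
        using submodule.m_closed[OF sub that] .
    qed
  qed
  then have "V.gen_set Y" using V.span_is_subset2[OF Yc] by blast
  then show ?thesis using Y(1) Yf Yc by (auto simp: V.basis_def)
qed

lemma phi_lincomb:
  assumes "finite S" "S \<subseteq> fx" "a \<in> S \<rightarrow> carrier k"
  shows "\<phi> (V.lincomb a S) = V.lincomb (\<lambda>y. sg (a y)) S"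
  using assms
proof (induction S rule: finite_induct)
  case empty show ?case by (simp add: V.lincomb_def phi_zero)
next
  case (insert x S)
  have xc: "x \<in> carrier V" "S \<subseteq> carrier V" using insert fx_closed by auto
  have l: "V.lincomb b (insert x S) = b x \<odot>\<^bsub>V\<^esub> x \<oplus>\<^bsub>V\<^esub> V.lincomb b S" if "b \<in> insert x S \<rightarrow> carrier k" for b
    unfolding V.lincomb_def by (rule V.M.finsum_insert) (use that insert xc in auto)
  have ax: "a x \<in> carrier k" "a \<in> S \<rightarrow> carrier k" using insert by auto
  have c: "V.lincomb a S \<in> carrier V" using V.lincomb_closed[OF xc(2) ax(2)] .
  have "(\<lambda>y. sg (a y)) \<in> insert x S \<rightarrow> carrier k" using insert by auto
  from l[OF this] l[OF insert(5)] show ?case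
    using insert(3)[OF _ ax(2)] insert(4) xc ax c by (simp add: phi_add phi_smult fx_phi)
qed

text \<open>\<open>\<phi>\<close> raises the coordinates of a combination of fixed points to the
  \<open>q\<close>-th power. For a fixed vector, uniqueness of coordinates then shows that each of
  them equals its \<open>q\<close>-th power.\<close>

lemma coordinates_Fq:
  assumes "finite Y" "Y \<subseteq> fx" "V.basis Y" "a \<in> Y \<rightarrow> carrier k" "V.lincomb a Y \<in> fx" "y \<in> Y"
  shows "a y \<in> Fq"
proof -
  have "sg (a y) = a y"
    by (rule basis_unique[OF V.vectorspace_axioms assms(1,3) _ assms(4) _ assms(6)])
      (use assms phi_lincomb[OF assms(1,2,4)] fx_phi in auto)
  then show ?thesis using assms by (intro sg_fixed_iff[THEN iffD1]) auto
qed

lemma finite_fx: "finite fx"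
proof -
  obtain Y where Y: "finite Y" "Y \<subseteq> fx" "V.basis Y" using ex_fixed_basis by blast
  obtain co where co: "\<And>v. v \<in> carrier V \<Longrightarrow> co v \<in> Y \<rightarrow> carrier k"
      "\<And>v. v \<in> carrier V \<Longrightarrow> V.lincomb (co v) Y = v"
    by (rule ex_coordinates[OF V.vectorspace_axioms Y(1,3)]) (rule that)
  have Yc: "Y \<subseteq> carrier V" using Y fx_closed by blast
  have "fx \<subseteq> (\<lambda>a. V.lincomb a Y) ` (Y \<rightarrow>\<^sub>E Fq)"
  proof
    fix v assume v: "v \<in> fx"
    have c: "co v \<in> Y \<rightarrow> carrier k \<and> V.lincomb (co v) Y = v" using co fx_closed[OF v] by blast
    have "co v y \<in> Fq" if "y \<in> Y" for y using coordinates_Fq[OF Y, of "co v" y] c v that by simp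
    moreover have "V.lincomb (restrict (co v) Y) Y = V.lincomb (co v) Y"
      by (rule V.lincomb_cong) (use Yc c in auto)
    ultimately show "v \<in> (\<lambda>a. V.lincomb a Y) ` (Y \<rightarrow>\<^sub>E Fq)"
      using c by (intro image_eqI[of _ _ "restrict (co v) Y"]) auto
  qed
  moreover have "finite (Y \<rightarrow>\<^sub>E Fq)" by (rule finite_PiE[OF Y(1)]) (rule finite_Fq)
  ultimately show ?thesis by (meson finite_imageI finite_subset)
qed

text \<open>The universal property of \<open>V = k \<otimes> V\<^sup>\<phi>\<close>.\<close>

lemma ex_extension:
  assumes G: "abelian_group G"
    and cl: "\<And>c y. c \<in> carrier k \<Longrightarrow> y \<in> fx \<Longrightarrow> \<beta> c y \<in> carrier G"
    and add1: "\<And>c d y. c \<in> carrier k \<Longrightarrow> d \<in> carrier k \<Longrightarrow> y \<in> fx \<Longrightarrow> \<beta> (c \<oplus> d) y = \<beta> c y \<oplus>\<^bsub>G\<^esub> \<beta> d y"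
    and add2: "\<And>c x y. c \<in> carrier k \<Longrightarrow> x \<in> fx \<Longrightarrow> y \<in> fx \<Longrightarrow> \<beta> c (x \<oplus>\<^bsub>V\<^esub> y) = \<beta> c x \<oplus>\<^bsub>G\<^esub> \<beta> c y"
    and bal: "\<And>c d y. c \<in> carrier k \<Longrightarrow> d \<in> Fq \<Longrightarrow> y \<in> fx \<Longrightarrow> \<beta> (c \<otimes> d) y = \<beta> c (d \<odot>\<^bsub>V\<^esub> y)"
  shows "\<exists>h. (\<forall>v \<in> carrier V. h v \<in> carrier G) \<and>
    (\<forall>u \<in> carrier V. \<forall>v \<in> carrier V. h (u \<oplus>\<^bsub>V\<^esub> v) = h u \<oplus>\<^bsub>G\<^esub> h v) \<and>
    (\<forall>c \<in> carrier k. \<forall>y \<in> fx. h (c \<odot>\<^bsub>V\<^esub> y) = \<beta> c y)"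
proof -
  interpret G: abelian_group G by fact
  obtain Y where Y: "finite Y" "Y \<subseteq> fx" "V.basis Y" using ex_fixed_basis by blast
  have Yc: "Y \<subseteq> carrier V" using Y fx_closed by blast
  obtain co where co: "\<And>v. v \<in> carrier V \<Longrightarrow> co v \<in> Y \<rightarrow> carrier k" "\<And>v. v \<in> carrier V \<Longrightarrow> V.lincomb (co v) Y = v"
    and coa: "\<And>u v y. u \<in> carrier V \<Longrightarrow> v \<in> carrier V \<Longrightarrow> y \<in> Y \<Longrightarrow> co (u \<oplus>\<^bsub>V\<^esub> v) y = co u y \<oplus> co v y"
    and com: "\<And>c v y. c \<in> carrier k \<Longrightarrow> v \<in> carrier V \<Longrightarrow> y \<in> Y \<Longrightarrow> co (c \<odot>\<^bsub>V\<^esub> v) y = c \<otimes> co v y"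
    by (rule ex_coordinates[OF V.vectorspace_axioms Y(1,3)]) (rule that)
  define h where "h v = (\<Oplus>\<^bsub>G\<^esub>y\<in>Y. \<beta> (co v y) y)" for v
  have cok: "co v y \<in> carrier k" if "v \<in> carrier V" "y \<in> Y" for v y using co(1)[OF that(1)] that(2) by auto
  have b0: "\<beta> c \<zero>\<^bsub>V\<^esub> = \<zero>\<^bsub>G\<^esub>" if "c \<in> carrier k" for c
  proof -
    have "\<beta> c \<zero>\<^bsub>V\<^esub> = \<beta> c \<zero>\<^bsub>V\<^esub> \<oplus>\<^bsub>G\<^esub> \<beta> c \<zero>\<^bsub>V\<^esub>" using add2[OF that fx_zero fx_zero] by simp
    then show ?thesis using cl[OF that fx_zero] by (metis G.add.l_cancel_one')
  qed
  show ?thesis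
  proof (intro exI[of _ h] conjI ballI)
    show "h v \<in> carrier G" if v: "v \<in> carrier V" for v
      unfolding h_def by (rule G.finsum_closed) (use cok[OF v] cl Y(2) in auto)
    show "h (u \<oplus>\<^bsub>V\<^esub> v) = h u \<oplus>\<^bsub>G\<^esub> h v" if u: "u \<in> carrier V" and v: "v \<in> carrier V" for u v
    proof -
      have "h u \<oplus>\<^bsub>G\<^esub> h v = (\<Oplus>\<^bsub>G\<^esub>y\<in>Y. \<beta> (co u y) y \<oplus>\<^bsub>G\<^esub> \<beta> (co v y) y)"
        unfolding h_def by (rule G.finsum_addf[symmetric]) (use cok[OF u] cok[OF v] cl Y(2) in auto)
      also have "\<dots> = h (u \<oplus>\<^bsub>V\<^esub> v)" unfolding h_def
      proof (rule G.finsum_cong')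
        show "(\<lambda>y. \<beta> (co (u \<oplus>\<^bsub>V\<^esub> v) y) y) \<in> Y \<rightarrow> carrier G" using cok u v cl Y(2) by auto
        show "\<beta> (co u y) y \<oplus>\<^bsub>G\<^esub> \<beta> (co v y) y = \<beta> (co (u \<oplus>\<^bsub>V\<^esub> v) y) y" if "y \<in> Y" for y
          using add1[OF cok[OF u that] cok[OF v that]] coa[OF u v that] Y(2) that by auto
      qed simp
      finally show ?thesis by simp
    qed
    show "h (c \<odot>\<^bsub>V\<^esub> v) = \<beta> c v" if c: "c \<in> carrier k" and v: "v \<in> fx" for c v
    proof -
      have vc: "v \<in> carrier V" by (rule fx_closed[OF v])
      \<comment> \<open>Fixed vectors have coordinates in \<open>Fq\<close>, which
        \<open>bal\<close> moves into the second argument of \<open>\<beta>\<close>; there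
        additivity reassembles \<open>v\<close>.\<close>
      have cF: "co v y \<in> Fq" if "y \<in> Y" for y
        using coordinates_Fq[OF Y co(1)[OF vc] _ that] co(2)[OF vc] v by simp
      have tf: "co v y \<odot>\<^bsub>V\<^esub> y \<in> fx" if "y \<in> Y" for y using fx_smult cF that Y(2) by auto
      have "h (c \<odot>\<^bsub>V\<^esub> v) = (\<Oplus>\<^bsub>G\<^esub>y\<in>Y. \<beta> c (co v y \<odot>\<^bsub>V\<^esub> y))" unfolding h_def
      proof (rule G.finsum_cong')
        show "\<beta> (co (c \<odot>\<^bsub>V\<^esub> v) y) y = \<beta> c (co v y \<odot>\<^bsub>V\<^esub> y)" if "y \<in> Y" for y
          unfolding com[OF c vc that] using bal[OF c cF[OF that]] that Y(2) by auto
      qed (use tf cl c in auto)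
      also have "\<dots> = \<beta> c (\<Oplus>\<^bsub>V\<^esub>y\<in>Y. co v y \<odot>\<^bsub>V\<^esub> y)"
      proof -
        have "(\<Oplus>\<^bsub>V\<^esub>y\<in>S. co v y \<odot>\<^bsub>V\<^esub> y) \<in> fx \<and> (\<Oplus>\<^bsub>G\<^esub>y\<in>S. \<beta> c (co v y \<odot>\<^bsub>V\<^esub> y)) = \<beta> c (\<Oplus>\<^bsub>V\<^esub>y\<in>S. co v y \<odot>\<^bsub>V\<^esub> y)"
          if "finite S" "S \<subseteq> Y" for S
          using that
        proof (induction S rule: finite_induct)
          case empty show ?case using b0[OF c] fx_zero by simp
        next
          case (insert x S)
          have t: "co v x \<odot>\<^bsub>V\<^esub> x \<in> fx" "\<And>y. y \<in> S \<Longrightarrow> co v y \<odot>\<^bsub>V\<^esub> y \<in> fx" using tf insert by auto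
          have 1: "(\<Oplus>\<^bsub>V\<^esub>y\<in>insert x S. co v y \<odot>\<^bsub>V\<^esub> y) = co v x \<odot>\<^bsub>V\<^esub> x \<oplus>\<^bsub>V\<^esub> (\<Oplus>\<^bsub>V\<^esub>y\<in>S. co v y \<odot>\<^bsub>V\<^esub> y)"
            by (rule V.M.finsum_insert) (use insert t fx_closed in auto)
          have 2: "(\<Oplus>\<^bsub>G\<^esub>y\<in>insert x S. \<beta> c (co v y \<odot>\<^bsub>V\<^esub> y)) = \<beta> c (co v x \<odot>\<^bsub>V\<^esub> x) \<oplus>\<^bsub>G\<^esub> (\<Oplus>\<^bsub>G\<^esub>y\<in>S. \<beta> c (co v y \<odot>\<^bsub>V\<^esub> y))"
            by (rule G.finsum_insert) (use insert t cl c in auto)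
          have IH: "(\<Oplus>\<^bsub>V\<^esub>y\<in>S. co v y \<odot>\<^bsub>V\<^esub> y) \<in> fx" "(\<Oplus>\<^bsub>G\<^esub>y\<in>S. \<beta> c (co v y \<odot>\<^bsub>V\<^esub> y)) = \<beta> c (\<Oplus>\<^bsub>V\<^esub>y\<in>S. co v y \<odot>\<^bsub>V\<^esub> y)"
            using insert by auto
          show ?case unfolding 1 2 IH(2) using add2[OF c t(1) IH(1)] fx_add[OF t(1) IH(1)] by simp
        qed
        from this[OF Y(1)] show ?thesis by simp
      qed
      also have "(\<Oplus>\<^bsub>V\<^esub>y\<in>Y. co v y \<odot>\<^bsub>V\<^esub> y) = v" using co(2)[OF vc] by (simp add: V.lincomb_def)
      finally show ?thesis .
    qed
  qed
qed

text \<open>\<open>P\<close> is \<open>l \<otimes> id\<close> on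
  \<open>k \<otimes> V^\<phi>\<close>. It splits the fixed points off the restriction of a module
  and, applied to \<open>A\<close>, yields the map \<open>\<Lambda>\<close> of the coinduced
  module.\<close>

lemma ex_projection:
  obtains l P where "l \<in> carrier k \<rightarrow> Fq" "l \<one> = \<one>"
    "\<And>v. v \<in> carrier V \<Longrightarrow> P v \<in> fx"
    "\<And>u v. u \<in> carrier V \<Longrightarrow> v \<in> carrier V \<Longrightarrow> P (u \<oplus>\<^bsub>V\<^esub> v) = P u \<oplus>\<^bsub>V\<^esub> P v"
    "\<And>c y. c \<in> carrier k \<Longrightarrow> y \<in> fx \<Longrightarrow> P (c \<odot>\<^bsub>V\<^esub> y) = l c \<odot>\<^bsub>V\<^esub> y"
    "\<And>y. y \<in> fx \<Longrightarrow> P y = y"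
proof -
  obtain l where l: "l \<in> carrier k \<rightarrow> Fq" "\<And>x y. x \<in> carrier k \<Longrightarrow> y \<in> carrier k \<Longrightarrow> l (x \<oplus> y) = l x \<oplus> l y"
    "\<And>d x. d \<in> Fq \<Longrightarrow> x \<in> carrier k \<Longrightarrow> l (d \<otimes> x) = d \<otimes> l x" "l \<one> = \<one>"
    using ex_functional by blast
  have lF: "l c \<in> Fq" if "c \<in> carrier k" for c using l(1) that by auto
  obtain P where P: "\<And>v. v \<in> carrier V \<Longrightarrow> P v \<in> carrier V"
    "\<And>u v. u \<in> carrier V \<Longrightarrow> v \<in> carrier V \<Longrightarrow> P (u \<oplus>\<^bsub>V\<^esub> v) = P u \<oplus>\<^bsub>V\<^esub> P v"
    "\<And>c y. c \<in> carrier k \<Longrightarrow> y \<in> fx \<Longrightarrow> P (c \<odot>\<^bsub>V\<^esub> y) = l c \<odot>\<^bsub>V\<^esub> y"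
  proof -
    have "l (c \<otimes> d) \<odot>\<^bsub>V\<^esub> y = l c \<odot>\<^bsub>V\<^esub> (d \<odot>\<^bsub>V\<^esub> y)" if "c \<in> carrier k" "d \<in> Fq" "y \<in> fx" for c d y
      using l(3)[OF that(2,1)] that lF[OF that(1)] fx_closed[OF that(3)]
      by (simp add: m_comm V.smult_assoc1[symmetric])
    moreover have "l (c \<oplus> d) \<odot>\<^bsub>V\<^esub> y = l c \<odot>\<^bsub>V\<^esub> y \<oplus>\<^bsub>V\<^esub> l d \<odot>\<^bsub>V\<^esub> y"
      if "c \<in> carrier k" "d \<in> carrier k" "y \<in> fx" for c d y
      unfolding l(2)[OF that(1,2)] using lF that fx_closed by (simp add: V.smult_l_distr)
    ultimately have "\<exists>P. (\<forall>v \<in> carrier V. P v \<in> carrier V) \<and>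
      (\<forall>u \<in> carrier V. \<forall>v \<in> carrier V. P (u \<oplus>\<^bsub>V\<^esub> v) = P u \<oplus>\<^bsub>V\<^esub> P v) \<and>
      (\<forall>c \<in> carrier k. \<forall>y \<in> fx. P (c \<odot>\<^bsub>V\<^esub> y) = l c \<odot>\<^bsub>V\<^esub> y)"
      by (intro ex_extension[OF V.M.abelian_group_axioms])
        (auto simp: lF fx_closed V.smult_r_distr)
    then show ?thesis using that by blast
  qed
  have Pfx: "P v \<in> fx" if "v \<in> carrier V" for v
    using that by (rule frob_induct) (auto simp: P fx_smult lF fx_add)
  have Pid: "P y = y" if "y \<in> fx" for y
  proof -
    have "P (\<one> \<odot>\<^bsub>V\<^esub> y) = l \<one> \<odot>\<^bsub>V\<^esub> y" by (rule P(3)[OF _ that]) simp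
    then show ?thesis unfolding l(4) V.smult_one[OF fx_closed[OF that]] .
  qed
  show thesis by (rule that[of l P]) (rule l(1,4) Pfx P(2,3) Pid; assumption)+
qed

lemma fixed_vectorspace:
  "vectorspace (k\<lparr>carrier := Fq\<rparr>) (V\<lparr>carrier := fx\<rparr>)"
  "vectorspace.fin_dim (k\<lparr>carrier := Fq\<rparr>) (V\<lparr>carrier := fx\<rparr>)"
proof -
  have F: "field (k\<lparr>carrier := Fq\<rparr>)" by (rule subfield_iff(2)[OF subfield_axioms])
  have neg: "\<exists>y\<in>fx. y \<oplus>\<^bsub>V\<^esub> x = \<zero>\<^bsub>V\<^esub>" if "x \<in> fx" for x
  proof (intro bexI)
    have "(\<ominus> \<one>) \<odot>\<^bsub>V\<^esub> x \<in> fx" by (rule fx_smult) (use that in auto)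
    then show "\<ominus>\<^bsub>V\<^esub> x \<in> fx" using fx_closed[OF that] by (simp add: V.smult_minus_1)
    show "\<ominus>\<^bsub>V\<^esub> x \<oplus>\<^bsub>V\<^esub> x = \<zero>\<^bsub>V\<^esub>" using fx_closed[OF that] by (simp add: V.M.l_neg)
  qed
  have G: "abelian_group (V\<lparr>carrier := fx\<rparr>)"
    by (rule abelian_groupI) (use fx_add fx_zero neg fx_closed in \<open>auto simp: V.M.a_ac\<close>)
  have M: "Module.module (k\<lparr>carrier := Fq\<rparr>) (V\<lparr>carrier := fx\<rparr>)"
    by (rule moduleI)
      (use F G fx_smult fx_closed in \<open>auto simp: V.smult_l_distr V.smult_r_distr V.smult_assoc1
        intro: fieldE(1)\<close>)
  show v: "vectorspace (k\<lparr>carrier := Fq\<rparr>) (V\<lparr>carrier := fx\<rparr>)"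
    using M F by (simp add: vectorspace_def)
  interpret W: vectorspace "k\<lparr>carrier := Fq\<rparr>" "V\<lparr>carrier := fx\<rparr>" by (rule v)
  show "W.fin_dim" unfolding W.fin_dim_def
    by (rule exI[of _ fx]) (use finite_fx W.in_own_span[of fx] W.span_is_subset2[of fx] in auto)
qed

end

context finite_field_closure
begin

lemma frobenius_spaceI:
  assumes "vectorspace k V" "vectorspace.fin_dim k V" "\<phi> \<in> frobenius_map k Fq V"
  shows "frobenius_space k Fq q V \<phi>"
proof -
  interpret V: vectorspace k V by fact
  show ?thesis
    by (unfold_locales)
      (use assms(2,3) in \<open>auto simp: frobenius_map_def module_hom_def card_Fq\<close>)
qed

text \<open>Raise the coordinates in some basis to the \<open>q\<close>-th power; the finitely many
  coordinates of a vector have a common period.\<close>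

lemma ex_frobenius_map:
  assumes V: "vectorspace k V" and fd: "vectorspace.fin_dim k V"
  shows "\<exists>\<phi>. frobenius_space k Fq q V \<phi>"
proof -
  interpret V: vectorspace k V by fact
  obtain Y where Y: "finite Y" "V.basis Y" using V.finite_basis_exists[OF fd] by blast
  have Yc: "Y \<subseteq> carrier V" using Y(2) by (simp add: V.basis_def)
  obtain co where co: "\<And>v. v \<in> carrier V \<Longrightarrow> co v \<in> Y \<rightarrow> carrier k" "\<And>v. v \<in> carrier V \<Longrightarrow> V.lincomb (co v) Y = v"
    and coa: "\<And>u v y. u \<in> carrier V \<Longrightarrow> v \<in> carrier V \<Longrightarrow> y \<in> Y \<Longrightarrow> co (u \<oplus>\<^bsub>V\<^esub> v) y = co u y \<oplus> co v y"
    and com: "\<And>c v y. c \<in> carrier k \<Longrightarrow> v \<in> carrier V \<Longrightarrow> y \<in> Y \<Longrightarrow> co (c \<odot>\<^bsub>V\<^esub> v) y = c \<otimes> co v y"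
    by (rule ex_coordinates[OF V Y]) (rule that)
  have cok: "co v y \<in> carrier k" if "v \<in> carrier V" "y \<in> Y" for v y using co(1)[OF that(1)] that(2) by auto
  define \<phi> where "\<phi> v = V.lincomb (\<lambda>y. sg (co v y)) Y" for v
  have cl: "\<phi> v \<in> carrier V" if "v \<in> carrier V" for v
    unfolding \<phi>_def by (rule V.lincomb_closed[OF Yc]) (use cok[OF that] in auto)
  have coeq: "co (V.lincomb a Y) y = a y" if "a \<in> Y \<rightarrow> carrier k" "y \<in> Y" for a y
    by (rule basis_unique[OF V Y _ that(1) _ that(2)])
      (use co V.lincomb_closed[OF Yc that(1)] in auto)
  have cophi: "co (\<phi> v) y = sg (co v y)" if "v \<in> carrier V" "y \<in> Y" for v y
    unfolding \<phi>_def by (rule coeq) (use cok that in auto)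
  have phin: "(\<phi> ^^ n) v \<in> carrier V \<and> (\<forall>y \<in> Y. co ((\<phi> ^^ n) v) y = (sg ^^ n) (co v y))" if "v \<in> carrier V" for v n
    by (induction n) (use that cl cophi in auto)
  have ext: "u = v" if "u \<in> carrier V" "v \<in> carrier V" "\<And>y. y \<in> Y \<Longrightarrow> co u y = co v y" for u v
  proof -
    have "V.lincomb (co u) Y = V.lincomb (co v) Y"
      by (rule V.lincomb_cong) (use Yc that co(1) in auto)
    then show ?thesis using co(2) that by simp
  qed
  have "frobenius_space k Fq q V \<phi>"
  proof (unfold_locales)
    show "V.fin_dim" by (rule fd)
    show "\<phi> (u \<oplus>\<^bsub>V\<^esub> v) = \<phi> u \<oplus>\<^bsub>V\<^esub> \<phi> v" if "u \<in> carrier V" "v \<in> carrier V" for u v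
      by (rule ext) (use that cl in \<open>auto simp: cophi coa cok pow_add\<close>)
    show "\<phi> (c \<odot>\<^bsub>V\<^esub> v) = sg c \<odot>\<^bsub>V\<^esub> \<phi> v" if "c \<in> carrier k" "v \<in> carrier V" for c v
      by (rule ext) (use that cl in \<open>auto simp: cophi com cok nat_pow_distrib\<close>)
    show "\<exists>n>0. (\<phi> ^^ n) v = v" if v: "v \<in> carrier V" for v
    proof -
      obtain n where n: "n > 0" "\<forall>c \<in> co v ` Y. (sg ^^ n) c = c"
        using common_period[of "co v ` Y" sg] Y(1) pow_periodic cok[OF v] by auto
      have "(\<phi> ^^ n) v = v"
        by (rule ext) (use phin[OF v, of n] n v in auto)
      then show ?thesis using n by blast
    qed
  qed (use cl in auto)
  then show ?thesis by blast
qed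

end

subsection \<open>Modules with a compatible Frobenius map\<close>

locale frobenius_algebra = AF: frobenius_space k Fq q A F + A: fd_algebra k A
  for k :: "('a, 'b) ring_scheme" (structure) and Fq q and A :: "('a, 'c, 'd) module_scheme" and F +
  assumes F_mult: "a \<in> carrier A \<Longrightarrow> b \<in> carrier A \<Longrightarrow> F (a \<otimes>\<^bsub>A\<^esub> b) = F a \<otimes>\<^bsub>A\<^esub> F b"
    and F_one: "F \<one>\<^bsub>A\<^esub> = \<one>\<^bsub>A\<^esub>"
begin

abbreviation B where "B \<equiv> AF.fx"

abbreviation BA where "BA \<equiv> fixed_algebra A F"

abbreviation kF where "kF \<equiv> k\<lparr>carrier := Fq\<rparr>"

lemma carrier_BA [simp]: "carrier BA = B"
  by (simp add: fixed_algebra_def AF.fx_def)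

lemma BA_simps [simp]: "\<one>\<^bsub>BA\<^esub> = \<one>\<^bsub>A\<^esub>" "x \<oplus>\<^bsub>BA\<^esub> y = x \<oplus>\<^bsub>A\<^esub> y" "x \<otimes>\<^bsub>BA\<^esub> y = x \<otimes>\<^bsub>A\<^esub> y" "c \<odot>\<^bsub>BA\<^esub> x = c \<odot>\<^bsub>A\<^esub> x"
  by (simp_all add: fixed_algebra_def)

lemma B_one: "\<one>\<^bsub>A\<^esub> \<in> B" by (rule AF.fxI) (auto simp: F_one)

lemma B_mult: "a \<in> B \<Longrightarrow> b \<in> B \<Longrightarrow> a \<otimes>\<^bsub>A\<^esub> b \<in> B"
  by (rule AF.fxI) (auto simp: F_mult AF.fx_phi AF.fx_closed)

lemma B_sub: "B \<subseteq> carrier A" using AF.fx_closed by blast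

lemma unital: "fd_module k A M \<Longrightarrow> unital_fd_module k A M"
  by (simp add: unital_fd_module_def unital_fd_module_axioms_def)

lemma unital_B: "fd_module kF BA N \<Longrightarrow> unital_fd_module kF BA N"
  by (simp add: unital_fd_module_def unital_fd_module_axioms_def B_one AF.fx_smult)

text \<open>Finiteness as a set is what gives the image of \<open>N\<close> in a module with a
  Frobenius map a common period, see \<open>local_retract_fixed\<close>.\<close>

lemma finite_B_module:
  assumes "fd_module kF BA N" shows "finite (carrier N)"
proof -
  interpret N: fd_module kF BA N by fact
  obtain Y where Y: "finite Y" "Y \<subseteq> carrier N" "N.span Y = carrier N"
    using N.finite_dimensional unfolding N.fin_dim_def by blast
  have "carrier N \<subseteq> (\<lambda>a. N.lincomb a Y) ` (Y \<rightarrow>\<^sub>E Fq)"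
  proof
    fix v assume "v \<in> carrier N"
    then obtain a where a: "a \<in> Y \<rightarrow> Fq" "N.lincomb a Y = v" using N.finite_in_span[OF Y(1,2), of v] Y(3) by auto
    have "N.lincomb (restrict a Y) Y = N.lincomb a Y"
      by (rule N.lincomb_cong) (use Y a in auto)
    then show "v \<in> (\<lambda>a. N.lincomb a Y) ` (Y \<rightarrow>\<^sub>E Fq)"
      using a by (intro image_eqI[of _ _ "restrict a Y"]) auto
  qed
  moreover have "finite (Y \<rightarrow>\<^sub>E Fq)" by (rule finite_PiE[OF Y(1)]) (rule AF.finite_Fq)
  ultimately show ?thesis by (meson finite_imageI finite_subset)
qed

lemma act_zero: "fd_module k A M \<Longrightarrow> a \<in> carrier A \<Longrightarrow> act M a \<zero>\<^bsub>M\<^esub> = \<zero>\<^bsub>M\<^esub>"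
proof -
  assume "fd_module k A M" and a: "a \<in> carrier A"
  then interpret M: fd_module k A M by simp
  show ?thesis
    by (rule additive_zero[OF M.M.abelian_group_axioms M.M.abelian_group_axioms])
      (use a M.act_closed M.act_add_right in auto)
qed

end

locale frobenius_module = frobenius_algebra k Fq q A F + U: frobenius_space k Fq q U \<phi> + U: fd_module k A U
  for k :: "('a, 'b) ring_scheme" (structure) and Fq q and A :: "('a, 'c, 'd) module_scheme" and F
    and U :: "('a, 'u, 'c) alg_module" and \<phi> +
  assumes phi_act: "a \<in> carrier A \<Longrightarrow> u \<in> carrier U \<Longrightarrow> \<phi> (act U a u) = act U (F a) (\<phi> u)"
begin

abbreviation UF where "UF \<equiv> U\<lparr>carrier := U.fx\<rparr>"

lemma fixed_act: "b \<in> B \<Longrightarrow> y \<in> U.fx \<Longrightarrow> act U b y \<in> U.fx"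
  by (rule U.fxI) (auto simp: phi_act U.fx_phi U.fx_closed AF.fx_closed AF.fx_phi U.act_closed)

lemma phin_act:
  assumes "b \<in> B" "u \<in> carrier U" shows "(\<phi> ^^ n) (act U b u) = act U b ((\<phi> ^^ n) u)"
proof (induction n)
  case (Suc n)
  then show ?case using assms by (simp add: phi_act AF.fx_closed AF.fx_phi U.phin_closed)
qed simp

lemma fixed_module: "fd_module kF BA UF"
proof -
  interpret W: vectorspace kF UF by (rule U.fixed_vectorspace(1))
  show ?thesis
    by (unfold_locales)
      (use fixed_act U.fixed_vectorspace(2) in
        \<open>auto simp: U.act_add_left U.act_add_right U.act_smult_left U.act_smult_right U.act_mult U.act_one
          U.fx_closed AF.fx_closed\<close>)
qed

lemma fixed_incl: "(\<lambda>x. x) \<in> act_hom B UF U"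
  by (auto simp: act_hom_def U.fx_closed)

lemma smult_act_fixed:
  assumes "c \<in> carrier k" "d \<in> carrier k" "b \<in> B" "y \<in> U.fx"
  shows "act U (c \<odot>\<^bsub>A\<^esub> b) (d \<odot>\<^bsub>U\<^esub> y) = (c \<otimes> d) \<odot>\<^bsub>U\<^esub> act U b y"
  using assms by (simp add: U.act_smult_left U.act_smult_right AF.fx_closed U.fx_closed U.act_closed
      U.V.smult_assoc1[symmetric] AF.m_comm)

text \<open>Extension of scalars along \<open>U = k \<otimes> U^\<phi>\<close>. The balancing
  condition of \<open>ex_extension\<close> holds because \<open>d 1\<close> lies in \<open>B\<close>
  for \<open>d \<in> Fq\<close>. As \<open>A\<close> and \<open>U\<close> are spanned by their fixed
  points, compatibility with the action is checked on products \<open>(c b) (d y)\<close>.\<close>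

lemma ex_hom_extension:
  assumes W: "fd_module k A W" and h: "h \<in> act_hom B UF W"
  shows "\<exists>h'. h' \<in> act_hom (carrier A) U W \<and> (\<forall>c \<in> carrier k. \<forall>y \<in> U.fx. h' (c \<odot>\<^bsub>U\<^esub> y) = c \<odot>\<^bsub>W\<^esub> h y)"
proof -
  interpret W: unital_fd_module k A W by (rule unital[OF W])
  interpret UU: unital_fd_module k A U by (rule unital[OF U.fd_module_axioms])
  have hc: "h y \<in> carrier W" if "y \<in> U.fx" for y using act_homD(2)[OF h] that by simp
  have ha: "h (x \<oplus>\<^bsub>U\<^esub> y) = h x \<oplus>\<^bsub>W\<^esub> h y" if "x \<in> U.fx" "y \<in> U.fx" for x y
    using act_homD(3)[OF h] that by simp
  have hb: "h (act U b y) = act W b (h y)" if "b \<in> B" "y \<in> U.fx" for b y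
    using act_homD(4)[OF h] that by simp
  have hq: "h (d \<odot>\<^bsub>U\<^esub> y) = d \<odot>\<^bsub>W\<^esub> h y" if "d \<in> Fq" "y \<in> U.fx" for d y
  proof -
    have "d \<odot>\<^bsub>A\<^esub> \<one>\<^bsub>A\<^esub> \<in> B" using AF.fx_smult[OF that(1) B_one] .
    then show ?thesis using hb[of "d \<odot>\<^bsub>A\<^esub> \<one>\<^bsub>A\<^esub>" y] that hc[OF that(2)]
      by (simp add: UU.smult_as_act W.smult_as_act U.fx_closed)
  qed
  have "\<exists>h'. (\<forall>v \<in> carrier U. h' v \<in> carrier W) \<and>
    (\<forall>u \<in> carrier U. \<forall>v \<in> carrier U. h' (u \<oplus>\<^bsub>U\<^esub> v) = h' u \<oplus>\<^bsub>W\<^esub> h' v) \<and>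
    (\<forall>c \<in> carrier k. \<forall>y \<in> U.fx. h' (c \<odot>\<^bsub>U\<^esub> y) = c \<odot>\<^bsub>W\<^esub> h y)"
    by (rule U.ex_extension[OF W.M.abelian_group_axioms])
      (use hc ha hq in \<open>auto simp: W.smult_l_distr W.smult_r_distr W.smult_assoc1\<close>)
  then obtain h' where h1: "\<And>v. v \<in> carrier U \<Longrightarrow> h' v \<in> carrier W"
    and h2: "\<And>u v. u \<in> carrier U \<Longrightarrow> v \<in> carrier U \<Longrightarrow> h' (u \<oplus>\<^bsub>U\<^esub> v) = h' u \<oplus>\<^bsub>W\<^esub> h' v"
    and h3: "\<And>c y. c \<in> carrier k \<Longrightarrow> y \<in> U.fx \<Longrightarrow> h' (c \<odot>\<^bsub>U\<^esub> y) = c \<odot>\<^bsub>W\<^esub> h y" by blast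
  have h4: "h' (act U a u) = act W a (h' u)" if a: "a \<in> carrier A" and u: "u \<in> carrier U" for a u
    using a
  proof (rule AF.frob_induct)
    fix c b assume c: "c \<in> carrier k" and b: "b \<in> B"
    show "h' (act U (c \<odot>\<^bsub>A\<^esub> b) u) = act W (c \<odot>\<^bsub>A\<^esub> b) (h' u)"
      using u
    proof (rule U.frob_induct)
      fix d y assume d: "d \<in> carrier k" and y: "y \<in> U.fx"
      show "h' (act U (c \<odot>\<^bsub>A\<^esub> b) (d \<odot>\<^bsub>U\<^esub> y)) = act W (c \<odot>\<^bsub>A\<^esub> b) (h' (d \<odot>\<^bsub>U\<^esub> y))"
        unfolding smult_act_fixed[OF c d b y] h3[OF d y]
        using c d b y by (subst h3) (auto simp: hb hc fixed_act W.act_smult_left W.act_smult_right AF.fx_closed W.act_closed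
            W.smult_assoc1[symmetric] AF.m_comm)
    next
      fix u v assume "u \<in> carrier U" "v \<in> carrier U"
        "h' (act U (c \<odot>\<^bsub>A\<^esub> b) u) = act W (c \<odot>\<^bsub>A\<^esub> b) (h' u)" "h' (act U (c \<odot>\<^bsub>A\<^esub> b) v) = act W (c \<odot>\<^bsub>A\<^esub> b) (h' v)"
      then show "h' (act U (c \<odot>\<^bsub>A\<^esub> b) (u \<oplus>\<^bsub>U\<^esub> v)) = act W (c \<odot>\<^bsub>A\<^esub> b) (h' (u \<oplus>\<^bsub>U\<^esub> v))"
        using c b by (simp add: U.act_add_right W.act_add_right h1 h2 U.act_closed AF.fx_closed)
    qed
  next
    fix a b assume "a \<in> carrier A" "b \<in> carrier A" "h' (act U a u) = act W a (h' u)" "h' (act U b u) = act W b (h' u)"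
    then show "h' (act U (a \<oplus>\<^bsub>A\<^esub> b) u) = act W (a \<oplus>\<^bsub>A\<^esub> b) (h' u)"
      using u by (simp add: U.act_add_left W.act_add_left h1 h2 U.act_closed)
  qed
  have "h' \<in> act_hom (carrier A) U W" by (rule act_homI) (use h1 h2 h4 in auto)
  then show ?thesis using h3 by blast
qed

text \<open>The projection \<open>P\<close> induced by a linear form on \<open>k\<close> commutes
  with \<open>B\<close>, because \<open>B\<close> commutes with scalars and preserves the fixed
  points.\<close>

lemma retract_fixed: "retract B UF U"
proof -
  obtain l P where P: "l \<in> carrier k \<rightarrow> Fq" "\<And>v. v \<in> carrier U \<Longrightarrow> P v \<in> U.fx"
    "\<And>u v. u \<in> carrier U \<Longrightarrow> v \<in> carrier U \<Longrightarrow> P (u \<oplus>\<^bsub>U\<^esub> v) = P u \<oplus>\<^bsub>U\<^esub> P v"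
    "\<And>c y. c \<in> carrier k \<Longrightarrow> y \<in> U.fx \<Longrightarrow> P (c \<odot>\<^bsub>U\<^esub> y) = l c \<odot>\<^bsub>U\<^esub> y"
    "\<And>y. y \<in> U.fx \<Longrightarrow> P y = y"
    by (rule U.ex_projection) (rule that)
  have lk: "l c \<in> carrier k" if "c \<in> carrier k" for c using funcset_mem[OF P(1) that] by (rule AF.Fq_in)
  have act: "P (act U b u) = act U b (P u)" if b: "b \<in> B" and u: "u \<in> carrier U" for b u
    using u
  proof (rule U.frob_induct)
    fix c y assume "c \<in> carrier k" "y \<in> U.fx"
    then show "P (act U b (c \<odot>\<^bsub>U\<^esub> y)) = act U b (P (c \<odot>\<^bsub>U\<^esub> y))"
      using b by (simp add: U.act_smult_right[symmetric] P(4) fixed_act AF.fx_closed U.fx_closed lk)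
        (simp add: U.act_smult_right P(4) fixed_act AF.fx_closed U.fx_closed lk)
  next
    fix u v assume "u \<in> carrier U" "v \<in> carrier U" "P (act U b u) = act U b (P u)" "P (act U b v) = act U b (P v)"
    then show "P (act U b (u \<oplus>\<^bsub>U\<^esub> v)) = act U b (P (u \<oplus>\<^bsub>U\<^esub> v))"
      using b P(2) by (simp add: U.act_add_right P(3) U.act_closed AF.fx_closed U.fx_closed)
  qed
  show ?thesis
    by (rule retractI[OF fixed_incl, of P]) (use P act in \<open>auto intro!: act_homI\<close>)
qed

lemma comb_act:
  assumes "b \<in> B" "u \<in> carrier U" "\<And>i. g i \<in> carrier k"
  shows "U.comb g n (act U b u) = act U b (U.comb g n u)"
proof -
  have t: "U.comb g (Suc m) v = g m \<odot>\<^bsub>U\<^esub> (\<phi> ^^ m) v \<oplus>\<^bsub>U\<^esub> U.comb g m v" if "v \<in> carrier U" for m v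
    unfolding U.comb_def
    by (rule AF.finsum_lessThan_Suc[OF U.V.M.abelian_monoid_axioms]) (auto simp: U.phin_closed that assms(3))
  have bu: "b \<in> carrier A" "act U b u \<in> carrier U" using assms by (auto simp: AF.fx_closed U.act_closed)
  show ?thesis
  proof (induction n)
    case 0 show ?case using act_zero[OF U.fd_module_axioms bu(1)] by (simp add: U.comb_def)
  next
    case (Suc n)
    show ?case unfolding t[OF bu(2)] t[OF assms(2)] Suc
      using assms bu U.comb_closed[OF assms(2,3)] by (simp add: U.act_add_right U.act_smult_right U.phin_closed phin_act)
  qed
qed

text \<open>
  \<open>U\<close> restricted to \<open>B\<close> is a direct sum of infinitely many copies of the fixed points, hence has
  no other finite local summands.
\<close>

lemma local_retract_fixed:
  assumes L: "act_local B L" and fin: "finite (carrier L)" and r: "retract B L U"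
  shows "retract B L UF"
proof (rule ccontr)
  assume not: "\<not> retract B L UF"
  obtain i p where i: "i \<in> act_hom B L U" and p: "p \<in> act_hom B U L" and pi: "\<And>x. x \<in> carrier L \<Longrightarrow> p (i x) = x"
    using r by (auto simp: retract_def)
  have ic: "i x \<in> carrier U" if "x \<in> carrier L" for x using act_homD(2)[OF i that] .
  \<comment> \<open>\<open>L\<close> is finite, so one power of \<open>\<phi>\<close> fixes the
    whole image of \<open>i\<close>. For \<open>y \<in> E n\<close> the traces of the vectors
    \<open>y (i z)\<close> are then fixed points.\<close>
  obtain n where n: "n > 0" "\<And>x. x \<in> carrier L \<Longrightarrow> (\<phi> ^^ n) (i x) = i x"
  proof -
    have "\<exists>n > 0. (\<phi> ^^ n) s = s" if "s \<in> i ` carrier L" for s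
      using that ic U.phi_periodic by blast
    from common_period[OF finite_imageI[OF fin] this]
    obtain n where n: "n > 0" "\<forall>s \<in> i ` carrier L. (\<phi> ^^ n) s = s" by auto
    show thesis by (rule that[OF n(1)]) (use n(2) in blast)
  qed
  have hom: "(\<lambda>x. p (U.comb g n (i x))) \<in> act_hom B L L" if "g \<in> AF.sep n" for g
  proof (rule act_homI)
    have gk: "\<And>i. g i \<in> carrier k" using AF.sep_closed that by blast
    show "p (U.comb g n (i x)) \<in> carrier L" if "x \<in> carrier L" for x
      by (rule act_homD(2)[OF p U.comb_closed[OF ic[OF that] gk]])
    show "p (U.comb g n (i (x \<oplus>\<^bsub>L\<^esub> y))) = p (U.comb g n (i x)) \<oplus>\<^bsub>L\<^esub> p (U.comb g n (i y))"
      if "x \<in> carrier L" "y \<in> carrier L" for x y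
      using act_homD(3)[OF i that] U.comb_add_right[OF gk ic[OF that(1)] ic[OF that(2)], where n = n]
        act_homD(3)[OF p U.comb_closed[OF ic[OF that(1)] gk] U.comb_closed[OF ic[OF that(2)] gk]] by simp
    show "p (U.comb g n (i (act L b x))) = act L b (p (U.comb g n (i x)))" if "b \<in> B" "x \<in> carrier L" for b x
      using act_homD(4)[OF i that] comb_act[OF that(1) ic[OF that(2)] gk]
        act_homD(4)[OF p that(1) U.comb_closed[OF ic[OF that(2)] gk]] by simp
  qed
  \<comment> \<open>No sequence in \<open>sep n\<close> induces a bijection of \<open>L\<close>: an
    elementary one factors through the fixed points, which \<open>not\<close> excludes, and locality
    passes the claim on to sums. But the sequence of \<open>sep_delta\<close> induces the
    identity.\<close>
  have nb: "\<not> bij_betw (\<lambda>x. p (U.comb g n (i x))) (carrier L) (carrier L)" if "g \<in> AF.sep n" for g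
    using that
  proof induction
    case (base x y)
    have xy: "x \<in> carrier k" "y \<in> carrier k" "(AF.sg ^^ n) y = y" using base by (auto simp only: AF.E_def mem_Collect_eq)
    have yi: "y \<odot>\<^bsub>U\<^esub> i z \<in> carrier U" "(\<phi> ^^ n) (y \<odot>\<^bsub>U\<^esub> i z) = y \<odot>\<^bsub>U\<^esub> i z" if "z \<in> carrier L" for z
    proof -
      show "y \<odot>\<^bsub>U\<^esub> i z \<in> carrier U" using xy ic[OF that] by simp
      show "(\<phi> ^^ n) (y \<odot>\<^bsub>U\<^esub> i z) = y \<odot>\<^bsub>U\<^esub> i z"
        unfolding U.phin_smult[OF xy(2) ic[OF that]] n(2)[OF that] xy(3) ..
    qed
    have u: "(\<lambda>z. U.tr n (y \<odot>\<^bsub>U\<^esub> i z)) \<in> act_hom B L UF"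
    proof (rule act_homI)
      fix z z' assume z: "z \<in> carrier L" "z' \<in> carrier L"
      have "U.tr n (u \<oplus>\<^bsub>U\<^esub> v) = U.tr n u \<oplus>\<^bsub>U\<^esub> U.tr n v" if "u \<in> carrier U" "v \<in> carrier U" for u v
        using that by (simp add: U.tr_as_comb U.comb_add_right)
      then show "U.tr n (y \<odot>\<^bsub>U\<^esub> i (z \<oplus>\<^bsub>L\<^esub> z')) = U.tr n (y \<odot>\<^bsub>U\<^esub> i z) \<oplus>\<^bsub>UF\<^esub> U.tr n (y \<odot>\<^bsub>U\<^esub> i z')"
        using act_homD(3)[OF i z] yi z ic xy by (simp add: U.V.smult_r_distr)
    next
      show "U.tr n (y \<odot>\<^bsub>U\<^esub> i z) \<in> carrier UF" if "z \<in> carrier L" for z using U.tr_fixed[OF yi[OF that]] by simp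
    next
      fix b z assume b: "b \<in> B" and z: "z \<in> carrier L"
      have bc: "b \<in> carrier A" by (rule AF.fx_closed[OF b])
      have "y \<odot>\<^bsub>U\<^esub> i (act L b z) = act U b (y \<odot>\<^bsub>U\<^esub> i z)"
        using act_homD(4)[OF i b z] U.act_smult_right[OF xy(2) bc ic[OF z]] by simp
      moreover have "U.tr n (act U b (y \<odot>\<^bsub>U\<^esub> i z)) = act U b (U.tr n (y \<odot>\<^bsub>U\<^esub> i z))"
        using U.tr_as_comb U.act_closed[OF bc yi(1)[OF z]] yi(1)[OF z] comb_act[OF b yi(1)[OF z], of "\<lambda>i. \<one>" n] by simp
      ultimately show "U.tr n (y \<odot>\<^bsub>U\<^esub> i (act L b z)) = act UF b (U.tr n (y \<odot>\<^bsub>U\<^esub> i z))" by simp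
    qed
    have v: "(\<lambda>z. p (x \<odot>\<^bsub>U\<^esub> z)) \<in> act_hom B UF L"
    proof (rule act_homI)
      show "p (x \<odot>\<^bsub>U\<^esub> z) \<in> carrier L" if "z \<in> carrier UF" for z
        using act_homD(2)[OF p] xy that by (simp add: U.fx_closed)
      show "p (x \<odot>\<^bsub>U\<^esub> (z \<oplus>\<^bsub>UF\<^esub> z')) = p (x \<odot>\<^bsub>U\<^esub> z) \<oplus>\<^bsub>L\<^esub> p (x \<odot>\<^bsub>U\<^esub> z')" if "z \<in> carrier UF" "z' \<in> carrier UF" for z z'
        using act_homD(3)[OF p] xy that by (simp add: U.fx_closed U.V.smult_r_distr)
      show "p (x \<odot>\<^bsub>U\<^esub> act UF b z) = act L b (p (x \<odot>\<^bsub>U\<^esub> z))" if "b \<in> B" "z \<in> carrier UF" for b z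
      proof -
        have "x \<odot>\<^bsub>U\<^esub> act U b z = act U b (x \<odot>\<^bsub>U\<^esub> z)"
          using that xy by (simp add: U.act_smult_right AF.fx_closed U.fx_closed)
        then show ?thesis using act_homD(4)[OF p that(1), of "x \<odot>\<^bsub>U\<^esub> z"] xy that by (simp add: U.fx_closed)
      qed
    qed
    have "U.comb (\<lambda>i. x \<otimes> (AF.sg ^^ i) y) n (i z) = x \<odot>\<^bsub>U\<^esub> U.tr n (y \<odot>\<^bsub>U\<^esub> i z)" if "z \<in> carrier L" for z
      by (rule U.comb_base[OF xy(1,2) ic[OF that]])
    then have "bij_betw (\<lambda>z. p (U.comb (\<lambda>i. x \<otimes> (AF.sg ^^ i) y) n (i z))) (carrier L) (carrier L) \<longleftrightarrow>
        bij_betw (\<lambda>z. p (x \<odot>\<^bsub>U\<^esub> U.tr n (y \<odot>\<^bsub>U\<^esub> i z))) (carrier L) (carrier L)"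
      by (intro bij_betw_cong) simp
    then show ?case using retract_of_bij[OF L u v] not by blast
  next
    case (add g h)
    have gk: "\<And>i. g i \<in> carrier k" "\<And>i. h i \<in> carrier k" using AF.sep_closed add by blast+
    show ?case
    proof
      assume b: "bij_betw (\<lambda>x. p (U.comb (\<lambda>i. g i \<oplus> h i) n (i x))) (carrier L) (carrier L)"
      have "p (U.comb (\<lambda>i. g i \<oplus> h i) n (i x)) = p (U.comb g n (i x)) \<oplus>\<^bsub>L\<^esub> p (U.comb h n (i x))"
        if "x \<in> carrier L" for x
        using U.comb_add[OF gk ic[OF that], where n = n]
          act_homD(3)[OF p U.comb_closed[OF ic[OF that] gk(1)] U.comb_closed[OF ic[OF that] gk(2)]] by simp
      then have "bij_betw (\<lambda>x. p (U.comb g n (i x)) \<oplus>\<^bsub>L\<^esub> p (U.comb h n (i x))) (carrier L) (carrier L)"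
        using b bij_betw_cong[of "carrier L" "\<lambda>x. p (U.comb (\<lambda>i. g i \<oplus> h i) n (i x))"
          "\<lambda>x. p (U.comb g n (i x)) \<oplus>\<^bsub>L\<^esub> p (U.comb h n (i x))" "carrier L"] by blast
      then show False using act_localD[OF L hom[OF add(1)] hom[OF add(2)]] add(3,4) by blast
    qed
  qed
  obtain g where g: "g \<in> AF.sep n" "g 0 = \<one>" "\<forall>i. 0 < i \<and> i < n \<longrightarrow> g i = \<zero>" using AF.sep_delta by blast
  have gk: "\<And>i. g i \<in> carrier k" using AF.sep_closed g(1) by blast
  have "p (U.comb g n (i x)) = x" if "x \<in> carrier L" for x
  proof -
    have "U.comb g n (i x) = i x"
      by (rule U.comb_delta[where g = g, OF n(1) _ g(2)]) (use gk g(3) ic[OF that] in auto)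
    then show ?thesis using pi[OF that] by simp
  qed
  then have "bij_betw (\<lambda>x. p (U.comb g n (i x))) (carrier L) (carrier L) \<longleftrightarrow> bij_betw (\<lambda>x. x) (carrier L) (carrier L)"
    by (intro bij_betw_cong) simp
  then show False using nb[OF g(1)] by (simp add: bij_betw_def)
qed

end

lemma vectorspace_act_update:
  "vectorspace K (M\<lparr>act := f\<rparr>) \<longleftrightarrow> vectorspace K M"
  unfolding vectorspace_def Module.module_def abelian_group_def abelian_monoid_def
    abelian_group_axioms_def Module.module_axioms_def by simp

lemma fin_dim_surj:
  assumes "vectorspace K V" "vectorspace K W" "vectorspace.fin_dim K V"
    "T \<in> module_hom K V W" "T ` carrier V = carrier W"
  shows "vectorspace.fin_dim K W"
proof -
  interpret V: vectorspace K V by fact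
  interpret W: vectorspace K W by fact
  interpret linear_map K V W T by unfold_locales (rule assms(4))
  show ?thesis using rank_nullity_main(2)[OF assms(3,5)] .
qed

text \<open>A decomposition of \<open>N\<close> pulls back along \<open>f\<close> to one of
  \<open>M\<close>. The map is semilinear along \<open>s\<close> in order to cover both
  isomorphisms, where \<open>s\<close> is the identity, and twists, where \<open>s\<close> is
  \<open>F\<close> and \<open>f\<close> is a Frobenius map.\<close>

lemma indecomposable_transfer:
  assumes M: "unital_fd_module K A M" and N: "unital_fd_module K A N"
    and b: "bij_betw f (carrier M) (carrier N)"
    and add: "\<And>x y. x \<in> carrier M \<Longrightarrow> y \<in> carrier M \<Longrightarrow> f (x \<oplus>\<^bsub>M\<^esub> y) = f x \<oplus>\<^bsub>N\<^esub> f y"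
    and act: "\<And>a x. a \<in> carrier A \<Longrightarrow> x \<in> carrier M \<Longrightarrow> s a \<in> carrier A \<and> f (act M a x) = act N (s a) (f x)"
    and ind: "indecomposable K A M"
  shows "indecomposable K A N"
proof -
  interpret M: unital_fd_module K A M by fact
  interpret N: unital_fd_module K A N by fact
  have fc: "f x \<in> carrier N" if "x \<in> carrier M" for x using b that by (auto simp: bij_betw_def)
  have fi: "x = y" if "f x = f y" "x \<in> carrier M" "y \<in> carrier M" for x y
    using b that by (auto simp: bij_betw_def inj_on_def)
  have fs: "\<exists>x \<in> carrier M. f x = y" if "y \<in> carrier N" for y using bij_betw_imp_surj_on[OF b] that by (metis imageE)
  have f0: "f \<zero>\<^bsub>M\<^esub> = \<zero>\<^bsub>N\<^esub>"
    by (rule additive_zero[OF M.M.abelian_group_axioms N.M.abelian_group_axioms]) (use fc add in auto)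
  define pre where "pre W = {x \<in> carrier M. f x \<in> W}" for W
  have sub: "alg_submodule K A (pre W) M" if W: "alg_submodule K A W N" for W
    by (rule M.alg_submoduleI) (use N.alg_submoduleD[OF W] f0 add act M.act_closed in \<open>auto simp: pre_def\<close>)
  have z: "W = {\<zero>\<^bsub>N\<^esub>}" if W: "alg_submodule K A W N" "pre W = {\<zero>\<^bsub>M\<^esub>}" for W
  proof -
    have "y = \<zero>\<^bsub>N\<^esub>" if y: "y \<in> W" for y
    proof -
      obtain x where x: "x \<in> carrier M" "f x = y" using fs N.alg_submoduleD(2)[OF W(1)] y by blast
      then have "x \<in> pre W" using y by (simp add: pre_def)
      then show ?thesis using W(2) x f0 by simp
    qed
    then show ?thesis using N.alg_submoduleD(3)[OF W(1)] by blast
  qed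
  have "N1 = {\<zero>\<^bsub>N\<^esub>} \<or> N2 = {\<zero>\<^bsub>N\<^esub>}"
    if N1: "alg_submodule K A N1 N" and N2: "alg_submodule K A N2 N"
      and s: "N1 <+>\<^bsub>N\<^esub> N2 = carrier N" and i: "N1 \<inter> N2 = {\<zero>\<^bsub>N\<^esub>}" for N1 N2
  proof -
    have "pre N1 \<inter> pre N2 = {\<zero>\<^bsub>M\<^esub>}"
    proof -
      have "x = \<zero>\<^bsub>M\<^esub>" if "x \<in> pre N1" "x \<in> pre N2" for x
      proof -
        have "f x = f \<zero>\<^bsub>M\<^esub>" using that i f0 by (auto simp: pre_def)
        then show ?thesis using fi that M.M.zero_closed by (auto simp: pre_def)
      qed
      moreover have "\<zero>\<^bsub>M\<^esub> \<in> pre N1" "\<zero>\<^bsub>M\<^esub> \<in> pre N2"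
        using M.alg_submoduleD(3)[OF sub[OF N1]] M.alg_submoduleD(3)[OF sub[OF N2]] .
      ultimately show ?thesis by blast
    qed
    moreover have "pre N1 <+>\<^bsub>M\<^esub> pre N2 = carrier M"
    proof
      show "pre N1 <+>\<^bsub>M\<^esub> pre N2 \<subseteq> carrier M" by (auto simp: set_add_def' pre_def)
      show "carrier M \<subseteq> pre N1 <+>\<^bsub>M\<^esub> pre N2"
      proof
        fix x assume x: "x \<in> carrier M"
        then obtain n1 n2 where n: "n1 \<in> N1" "n2 \<in> N2" "f x = n1 \<oplus>\<^bsub>N\<^esub> n2"
          using fc[OF x] unfolding s[symmetric] set_add_def' by auto
        have "n1 \<in> carrier N" "n2 \<in> carrier N"
          using n N.alg_submoduleD(2)[OF N1] N.alg_submoduleD(2)[OF N2] by auto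
        then obtain m1 m2 where m: "m1 \<in> carrier M" "f m1 = n1" "m2 \<in> carrier M" "f m2 = n2"
          using fs by metis
        have "x = m1 \<oplus>\<^bsub>M\<^esub> m2" by (rule fi) (use m n x add in auto)
        moreover have "m1 \<in> pre N1" "m2 \<in> pre N2" using m n by (auto simp: pre_def)
        ultimately show "x \<in> pre N1 <+>\<^bsub>M\<^esub> pre N2" unfolding set_add_def' by blast
      qed
    qed
    ultimately have "pre N1 = {\<zero>\<^bsub>M\<^esub>} \<or> pre N2 = {\<zero>\<^bsub>M\<^esub>}"
      using ind sub[OF N1] sub[OF N2] unfolding indecomposable_def by blast
    then show ?thesis using z N1 N2 by blast
  qed
  moreover have "carrier N \<noteq> {\<zero>\<^bsub>N\<^esub>}"
  proof
    assume c: "carrier N = {\<zero>\<^bsub>N\<^esub>}"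
    have "x = \<zero>\<^bsub>M\<^esub>" if "x \<in> carrier M" for x
      by (rule fi) (use fc[OF that] that c f0 in auto)
    then have "carrier M = {\<zero>\<^bsub>M\<^esub>}" using M.M.zero_closed by blast
    then show False using ind by (simp add: indecomposable_def)
  qed
  ultimately show ?thesis unfolding indecomposable_def by blast
qed

section \<open>Twists of modules and of homomorphisms\<close>

context frobenius_algebra
begin

lemma twist_simps [simp]:
  "carrier (twist A F \<phi> M) = carrier M" "\<zero>\<^bsub>twist A F \<phi> M\<^esub> = \<zero>\<^bsub>M\<^esub>"
  "x \<oplus>\<^bsub>twist A F \<phi> M\<^esub> y = x \<oplus>\<^bsub>M\<^esub> y" "c \<odot>\<^bsub>twist A F \<phi> M\<^esub> x = c \<odot>\<^bsub>M\<^esub> x"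
  by (simp_all add: twist_def)

text \<open>Since \<open>F\<close> and \<open>\<phi>\<close> are surjective, this determines the
  twisted action; the module laws are verified by writing all arguments as \<open>F a\<close> and
  \<open>\<phi> m\<close>.\<close>

lemma twist_act:
  assumes "frobenius_space k Fq q M \<phi>" "a \<in> carrier A" "m \<in> carrier M"
  shows "act (twist A F \<phi> M) (F a) (\<phi> m) = \<phi> (act M a m)"
proof -
  interpret M: frobenius_space k Fq q M \<phi> by fact
  show ?thesis
    using AF.phi_bij M.phi_bij assms(2,3) by (simp add: twist_def bij_betw_def)
qed

lemma F_surj: "a \<in> carrier A \<Longrightarrow> \<exists>a' \<in> carrier A. F a' = a"
  using bij_betw_imp_surj_on[OF AF.phi_bij] by (metis imageE)

lemma twist_module:
  assumes M: "fd_module k A M" and fr: "frobenius_space k Fq q M \<phi>"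
  shows "fd_module k A (twist A F \<phi> M)"
proof -
  interpret M: fd_module k A M by fact
  interpret M\<phi>: frobenius_space k Fq q M \<phi> by fact
  have v: "vectorspace k (twist A F \<phi> M)"
    unfolding twist_def vectorspace_act_update by (rule M.vectorspace_axioms)
  interpret T: vectorspace k "twist A F \<phi> M" by (rule v)
  have fd: "T.fin_dim"
    by (rule fin_dim_surj[OF M.vectorspace_axioms v M.finite_dimensional, of "\<lambda>x. x"]) (auto simp: module_hom_def)
  have ms: "\<exists>m' \<in> carrier M. \<phi> m' = m" if "m \<in> carrier M" for m using bij_betw_imp_surj_on[OF M\<phi>.phi_bij] that by (metis imageE)
  note ta = twist_act[OF fr]
  show ?thesis
  proof (unfold_locales)
    show "T.fin_dim" by (rule fd)
    show "act (twist A F \<phi> M) a m \<in> carrier (twist A F \<phi> M)"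
      if a: "a \<in> carrier A" and m: "m \<in> carrier (twist A F \<phi> M)" for a m
    proof -
      obtain a' where a': "a' \<in> carrier A" "F a' = a" using F_surj[OF a] by blast
      obtain m' where m': "m' \<in> carrier M" "\<phi> m' = m" using ms[of m] m by auto
      show ?thesis using ta[OF a'(1) m'(1)] a' m' by (simp add: M\<phi>.phi_closed M.act_closed)
    qed
    show "act (twist A F \<phi> M) (a \<oplus>\<^bsub>A\<^esub> b) m = act (twist A F \<phi> M) a m \<oplus>\<^bsub>twist A F \<phi> M\<^esub> act (twist A F \<phi> M) b m"
      if a: "a \<in> carrier A" and b: "b \<in> carrier A" and m: "m \<in> carrier (twist A F \<phi> M)" for a b m
    proof -
      obtain a' where a': "a' \<in> carrier A" "F a' = a" using F_surj[OF a] by blast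
      obtain b' where b': "b' \<in> carrier A" "F b' = b" using F_surj[OF b] by blast
      obtain m' where m': "m' \<in> carrier M" "\<phi> m' = m" using ms[of m] m by auto
      show ?thesis using ta[OF a'(1) m'(1)] ta[OF b'(1) m'(1)] ta[OF AF.V.M.add.m_closed[OF a'(1) b'(1)] m'(1)] a' b' m'
        by (simp add: M\<phi>.phi_add M.act_closed AF.phi_add M.act_add_left)
    qed
    show "act (twist A F \<phi> M) a (m \<oplus>\<^bsub>twist A F \<phi> M\<^esub> l) = act (twist A F \<phi> M) a m \<oplus>\<^bsub>twist A F \<phi> M\<^esub> act (twist A F \<phi> M) a l"
      if a: "a \<in> carrier A" and m: "m \<in> carrier (twist A F \<phi> M)" and l: "l \<in> carrier (twist A F \<phi> M)" for a m l
    proof -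
      obtain a' where a': "a' \<in> carrier A" "F a' = a" using F_surj[OF a] by blast
      obtain m' where m': "m' \<in> carrier M" "\<phi> m' = m" using ms[of m] m by auto
      obtain l' where l': "l' \<in> carrier M" "\<phi> l' = l" using ms[of l] l by auto
      show ?thesis using ta[OF a'(1) m'(1)] ta[OF a'(1) l'(1)] ta[OF a'(1) M.M.add.m_closed[OF m'(1) l'(1)]] a' l' m'
        by (simp add: M\<phi>.phi_add M.act_closed M.act_add_right)
    qed
    show "act (twist A F \<phi> M) (c \<odot>\<^bsub>A\<^esub> a) m = c \<odot>\<^bsub>twist A F \<phi> M\<^esub> act (twist A F \<phi> M) a m"
      "act (twist A F \<phi> M) a (c \<odot>\<^bsub>twist A F \<phi> M\<^esub> m) = c \<odot>\<^bsub>twist A F \<phi> M\<^esub> act (twist A F \<phi> M) a m"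
      if c: "c \<in> carrier k" and a: "a \<in> carrier A" and m: "m \<in> carrier (twist A F \<phi> M)" for c a m
    proof -
      \<comment> \<open>Scalars too have to be written as images: periodicity of \<open>c\<close>
        under Frobenius yields a \<open>q\<close>-th root \<open>d\<close>.\<close>
      obtain n where n: "n > 0" "(AF.sg ^^ n) c = c" using AF.pow_periodic[OF c] by blast
      obtain n' where "n = Suc n'" using n(1) gr0_implies_Suc by blast
      then have "AF.sg ((AF.sg ^^ n') c) = c" using n by simp
      then obtain d where d: "d \<in> carrier k" "d [^] q = c" using AF.sgn_closed[OF c] by blast
      obtain a' where a': "a' \<in> carrier A" "F a' = a" using F_surj[OF a] by blast
      obtain m' where m': "m' \<in> carrier M" "\<phi> m' = m" using ms[of m] m by auto
      have da: "d \<odot>\<^bsub>A\<^esub> a' \<in> carrier A" "d \<odot>\<^bsub>M\<^esub> m' \<in> carrier M" using d a' m' by auto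
      show "act (twist A F \<phi> M) (c \<odot>\<^bsub>A\<^esub> a) m = c \<odot>\<^bsub>twist A F \<phi> M\<^esub> act (twist A F \<phi> M) a m"
        using ta[OF a'(1) m'(1)] ta[OF da(1) m'(1)] a' d m'
        by (simp add: M\<phi>.phi_smult M.act_closed AF.phi_smult M.act_smult_left)
      show "act (twist A F \<phi> M) a (c \<odot>\<^bsub>twist A F \<phi> M\<^esub> m) = c \<odot>\<^bsub>twist A F \<phi> M\<^esub> act (twist A F \<phi> M) a m"
        using ta[OF a'(1) m'(1)] ta[OF a'(1) da(2)] a' d m'
        by (simp add: M\<phi>.phi_smult M.act_closed M.act_smult_right)
    qed
    show "act (twist A F \<phi> M) (a \<otimes>\<^bsub>A\<^esub> b) m = act (twist A F \<phi> M) a (act (twist A F \<phi> M) b m)"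
      if a: "a \<in> carrier A" and b: "b \<in> carrier A" and m: "m \<in> carrier (twist A F \<phi> M)" for a b m
    proof -
      obtain a' where a': "a' \<in> carrier A" "F a' = a" using F_surj[OF a] by blast
      obtain b' where b': "b' \<in> carrier A" "F b' = b" using F_surj[OF b] by blast
      obtain m' where m': "m' \<in> carrier M" "\<phi> m' = m" using ms[of m] m by auto
      show ?thesis using ta[OF a'(1) M.act_closed[OF b'(1) m'(1)]] ta[OF b'(1) m'(1)] ta[OF A.A.m_closed[OF a'(1) b'(1)] m'(1)] a' b' m'
        by (simp add: F_mult M.act_mult)
    qed
    show "act (twist A F \<phi> M) \<one>\<^bsub>A\<^esub> m = m" if m: "m \<in> carrier (twist A F \<phi> M)" for m
    proof -
      obtain m' where m': "m' \<in> carrier M" "\<phi> m' = m" using ms[of m] m by auto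
      show ?thesis using ta[OF A.A.one_closed m'(1)] m' by (simp add: F_one M.act_one)
    qed
  qed
qed

lemma twist_frobenius_space:
  assumes M: "fd_module k A M" and fr: "frobenius_space k Fq q M \<phi>"
  shows "frobenius_space k Fq q (twist A F \<phi> M) \<phi>"
proof -
  interpret M\<phi>: frobenius_space k Fq q M \<phi> by fact
  interpret T: fd_module k A "twist A F \<phi> M" by (rule twist_module[OF M fr])
  show ?thesis
    by (unfold_locales)
      (use M\<phi>.phi_closed M\<phi>.phi_add M\<phi>.phi_smult M\<phi>.phi_periodic T.finite_dimensional in auto)
qed

lemma twist_indecomposable:
  assumes M: "fd_module k A M" and fr: "frobenius_space k Fq q M \<phi>" and ind: "indecomposable k A M"
  shows "indecomposable k A (twist A F \<phi> M)"
proof -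
  interpret M\<phi>: frobenius_space k Fq q M \<phi> by fact
  show ?thesis
    by (rule indecomposable_transfer[OF unital[OF M] unital[OF twist_module[OF M fr]], of \<phi> F])
      (use M\<phi>.phi_bij M\<phi>.phi_add twist_act[OF fr] AF.phi_closed ind in auto)
qed

text \<open>Functoriality of the twist: \<open>f\<close> is conjugated by the two Frobenius maps,
  and the powers of \<open>F\<close> and \<open>\<phi>\<close> introduced on one side cancel on the
  other.\<close>

lemma twist_hom:
  assumes M: "fd_module k A M" and fr: "frobenius_space k Fq q M \<phi>" and fr': "frobenius_space k Fq q M' \<phi>'"
    and f: "f \<in> act_hom (carrier A) M M'"
  shows "(\<lambda>x. \<phi>' (f (inv_into (carrier M) \<phi> x))) \<in> act_hom (carrier A) (twist A F \<phi> M) (twist A F \<phi>' M')"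
proof (rule act_homI)
  interpret M: fd_module k A M by fact
  interpret M\<phi>: frobenius_space k Fq q M \<phi> by fact
  interpret M\<phi>': frobenius_space k Fq q M' \<phi>' by fact
  let ?g = "inv_into (carrier M) \<phi>"
  have g [simp]: "?g (\<phi> m) = m" if "m \<in> carrier M" for m
    using M\<phi>.phi_bij that by (simp add: bij_betw_def)
  have ms: "\<exists>m' \<in> carrier M. \<phi> m' = m" if "m \<in> carrier M" for m
    using bij_betw_imp_surj_on[OF M\<phi>.phi_bij] that by (metis imageE)
  show "\<phi>' (f (?g x)) \<in> carrier (twist A F \<phi>' M')" if x: "x \<in> carrier (twist A F \<phi> M)" for x
  proof -
    obtain m where "m \<in> carrier M" "\<phi> m = x" using ms[of x] x by auto
    then show ?thesis using act_homD(2)[OF f, of m] by (auto simp: M\<phi>'.phi_closed)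
  qed
  show "\<phi>' (f (?g (x \<oplus>\<^bsub>twist A F \<phi> M\<^esub> y))) = \<phi>' (f (?g x)) \<oplus>\<^bsub>twist A F \<phi>' M'\<^esub> \<phi>' (f (?g y))"
    if x: "x \<in> carrier (twist A F \<phi> M)" and y: "y \<in> carrier (twist A F \<phi> M)" for x y
  proof -
    obtain m where m: "m \<in> carrier M" "\<phi> m = x" using ms[of x] x by auto
    obtain l where l: "l \<in> carrier M" "\<phi> l = y" using ms[of y] y by auto
    show ?thesis
      using g[OF m(1)] g[OF l(1)] g[OF M.M.add.m_closed[OF m(1) l(1)]] m l act_homD(2,3)[OF f]
      by (simp add: M\<phi>.phi_add M\<phi>'.phi_add)
  qed
  show "\<phi>' (f (?g (act (twist A F \<phi> M) a x))) = act (twist A F \<phi>' M') a (\<phi>' (f (?g x)))"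
    if a: "a \<in> carrier A" and x: "x \<in> carrier (twist A F \<phi> M)" for a x
  proof -
    obtain m where m: "m \<in> carrier M" "\<phi> m = x" using ms[of x] x by auto
    obtain a' where a': "a' \<in> carrier A" "F a' = a" using F_surj[OF a] by blast
    show ?thesis
      using g[OF m(1)] g[OF M.act_closed[OF a'(1) m(1)]] m a' act_homD(4)[OF f]
        twist_act[OF fr a'(1) m(1)] twist_act[OF fr' a'(1) act_homD(2)[OF f m(1)]]
      by simp
  qed
qed

text \<open>All twists are taken with the same \<open>\<phi>\<close>, which remains a Frobenius map
  of each of them. They share carrier and vector space structure and differ only in the
  action.\<close>

abbreviation tw where "tw \<phi> i M \<equiv> (twist A F \<phi> ^^ i) M"

lemma tw_simps [simp]:
  "carrier (tw \<phi> i M) = carrier M" "\<zero>\<^bsub>tw \<phi> i M\<^esub> = \<zero>\<^bsub>M\<^esub>"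
  "x \<oplus>\<^bsub>tw \<phi> i M\<^esub> y = x \<oplus>\<^bsub>M\<^esub> y" "c \<odot>\<^bsub>tw \<phi> i M\<^esub> x = c \<odot>\<^bsub>M\<^esub> x"
  by (induction i) auto

lemma tw_module:
  assumes M: "fd_module k A M" and fr: "frobenius_space k Fq q M \<phi>"
  shows "fd_module k A (tw \<phi> i M)" "frobenius_space k Fq q (tw \<phi> i M) \<phi>"
proof -
  have "fd_module k A (tw \<phi> i M) \<and> frobenius_space k Fq q (tw \<phi> i M) \<phi>"
    by (induction i) (auto simp: M fr twist_module twist_frobenius_space)
  then show "fd_module k A (tw \<phi> i M)" "frobenius_space k Fq q (tw \<phi> i M) \<phi>" by auto
qed

lemma tw_indecomposable:
  assumes M: "fd_module k A M" and fr: "frobenius_space k Fq q M \<phi>" and ind: "indecomposable k A M"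
  shows "indecomposable k A (tw \<phi> i M)"
  by (induction i) (auto simp: ind twist_indecomposable tw_module[OF M fr])

lemma tw_act:
  assumes M: "fd_module k A M" and fr: "frobenius_space k Fq q M \<phi>"
    and a: "a \<in> carrier A" and m: "m \<in> carrier M"
  shows "act (tw \<phi> i M) ((F ^^ i) a) ((\<phi> ^^ i) m) = (\<phi> ^^ i) (act M a m)"
proof (induction i)
  case (Suc i)
  interpret M\<phi>: frobenius_space k Fq q M \<phi> by fact
  show ?case
    using twist_act[OF tw_module(2)[OF M fr, of i], of "(F ^^ i) a" "(\<phi> ^^ i) m"]
      Suc a m AF.phin_closed M\<phi>.phin_closed by simp
qed simp

lemma tw_restrict:
  assumes M: "fd_module k A M" and fr: "frobenius_space k Fq q M \<phi>"
  shows "retract B M (tw \<phi> i M)" "retract B (tw \<phi> i M) M"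
proof -
  interpret M: fd_module k A M by fact
  interpret M\<phi>: frobenius_space k Fq q M \<phi> by fact
  have h: "\<phi> ^^ i \<in> act_hom B M (tw \<phi> i M)"
  proof (rule act_homI)
    show "(\<phi> ^^ i) (act M b x) = act (tw \<phi> i M) b ((\<phi> ^^ i) x)" if "b \<in> B" "x \<in> carrier M" for b x
      using tw_act[OF M fr AF.fx_closed[OF that(1)] that(2), of i] AF.fx_phin[OF that(1), of i] by simp
  qed (auto simp: M\<phi>.phin_closed M\<phi>.phin_add)
  have b: "bij_betw (\<phi> ^^ i) (carrier M) (carrier (tw \<phi> i M))"
    using bij_betw_funpow[OF M\<phi>.phi_bij] by simp
  show "retract B M (tw \<phi> i M)" "retract B (tw \<phi> i M) M"
    using retract_iso[OF h b M.M.abelian_group_axioms] M.act_closed AF.fx_closed by blast+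
qed

end

definition mk_module :: "'m set \<Rightarrow> 'm \<Rightarrow> ('m \<Rightarrow> 'm \<Rightarrow> 'm) \<Rightarrow> ('k \<Rightarrow> 'm \<Rightarrow> 'm) \<Rightarrow> ('a \<Rightarrow> 'm \<Rightarrow> 'm) \<Rightarrow>
    ('k, 'm, 'a) alg_module" where
  "mk_module C z p s t = \<lparr>carrier = C, monoid.mult = p, one = z, zero = z, add = p, smult = s, act = t\<rparr>"

lemma mk_module_simps [simp]:
  "carrier (mk_module C z p s t) = C" "\<zero>\<^bsub>mk_module C z p s t\<^esub> = z"
  "x \<oplus>\<^bsub>mk_module C z p s t\<^esub> y = p x y" "c \<odot>\<^bsub>mk_module C z p s t\<^esub> x = s c x"
  "act (mk_module C z p s t) a x = t a x"
  by (simp_all add: mk_module_def)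

subsection \<open>The sum of the twists of a module\<close>

locale periodic_module = frobenius_algebra k Fq q A F + M: frobenius_space k Fq q M \<phi> + M: fd_module k A M
  for k :: "('a, 'b) ring_scheme" (structure) and Fq q and A :: "('a, 'c, 'd) module_scheme" and F
    and M :: "('a, 'u, 'c) alg_module" and \<phi> +
  fixes n :: nat
  assumes n_pos: "n > 0"
    and period: "a \<in> carrier A \<Longrightarrow> m \<in> carrier M \<Longrightarrow> (\<phi> ^^ n) (act M a m) = act M ((F ^^ n) a) ((\<phi> ^^ n) m)"

context frobenius_algebra
begin

text \<open>\<open>B\<close> and the set of fixed points of \<open>\<phi>\<close> are finite, so
  some \<open>\<phi>^n\<close> fixes all products \<open>b y\<close> with \<open>b \<in> B\<close>
  and \<open>y\<close> a fixed point. Since \<open>B\<close> spans \<open>A\<close> and the fixed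
  points span \<open>M\<close>, this \<open>\<phi>^n\<close> is compatible with the action, although
  \<open>\<phi>\<close> in general is not.\<close>

lemma ex_periodic:
  assumes M: "fd_module k A M" and fr: "frobenius_space k Fq q M \<phi>"
  shows "\<exists>n. periodic_module k Fq q A F M \<phi> n"
proof -
  interpret M: fd_module k A M by fact
  interpret M\<phi>: frobenius_space k Fq q M \<phi> by fact
  let ?S = "(\<lambda>(b, y). act M b y) ` (B \<times> M\<phi>.fx)"
  have "finite ?S" using AF.finite_fx M\<phi>.finite_fx by simp
  moreover have "\<exists>n > 0. (\<phi> ^^ n) s = s" if "s \<in> ?S" for s
    using that M\<phi>.phi_periodic by (auto simp: M.act_closed AF.fx_closed M\<phi>.fx_closed)
  ultimately obtain n where n: "n > 0" "\<forall>s \<in> ?S. (\<phi> ^^ n) s = s" using common_period[of ?S \<phi>] by blast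
  have bfix: "(\<phi> ^^ n) (act M b y) = act M b y" if "b \<in> B" "y \<in> M\<phi>.fx" for b y
    using n(2) that by auto
  have sm: "act M (c \<odot>\<^bsub>A\<^esub> b) (d \<odot>\<^bsub>M\<^esub> y) = (c \<otimes> d) \<odot>\<^bsub>M\<^esub> act M b y"
    if "c \<in> carrier k" "d \<in> carrier k" "b \<in> B" "y \<in> M\<phi>.fx" for c d b y
    using that by (simp add: M.act_smult_left M.act_smult_right AF.fx_closed M\<phi>.fx_closed M.act_closed
        M.smult_assoc1[symmetric] AF.m_comm)
  have "(\<phi> ^^ n) (act M a m) = act M ((F ^^ n) a) ((\<phi> ^^ n) m)" if a: "a \<in> carrier A" and m: "m \<in> carrier M" for a m
    using a
  proof (rule AF.frob_induct)
    fix c b assume c: "c \<in> carrier k" and b: "b \<in> B"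
    show "(\<phi> ^^ n) (act M (c \<odot>\<^bsub>A\<^esub> b) m) = act M ((F ^^ n) (c \<odot>\<^bsub>A\<^esub> b)) ((\<phi> ^^ n) m)"
      using m
    proof (rule M\<phi>.frob_induct)
      fix d y assume d: "d \<in> carrier k" and y: "y \<in> M\<phi>.fx"
      have "(\<phi> ^^ n) ((c \<otimes> d) \<odot>\<^bsub>M\<^esub> act M b y) = (AF.sg ^^ n) (c \<otimes> d) \<odot>\<^bsub>M\<^esub> act M b y"
        using M\<phi>.phin_smult[of "c \<otimes> d" "act M b y" n] bfix[OF b y] c d M.act_closed[OF AF.fx_closed[OF b] M\<phi>.fx_closed[OF y]]
        by simp
      moreover have "act M ((F ^^ n) (c \<odot>\<^bsub>A\<^esub> b)) ((\<phi> ^^ n) (d \<odot>\<^bsub>M\<^esub> y)) =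
          ((AF.sg ^^ n) c \<otimes> (AF.sg ^^ n) d) \<odot>\<^bsub>M\<^esub> act M b y"
        unfolding M\<phi>.phin_smult[OF d M\<phi>.fx_closed[OF y]] AF.phin_smult[OF c AF.fx_closed[OF b]]
          M\<phi>.fx_phin[OF y] AF.fx_phin[OF b]
        by (rule sm) (use b y c d in auto)
      ultimately show "(\<phi> ^^ n) (act M (c \<odot>\<^bsub>A\<^esub> b) (d \<odot>\<^bsub>M\<^esub> y)) = act M ((F ^^ n) (c \<odot>\<^bsub>A\<^esub> b)) ((\<phi> ^^ n) (d \<odot>\<^bsub>M\<^esub> y))"
        unfolding sm[OF c d b y] using AF.sgn_mult[OF c d] by simp
    next
      fix u v assume "u \<in> carrier M" "v \<in> carrier M"
        "(\<phi> ^^ n) (act M (c \<odot>\<^bsub>A\<^esub> b) u) = act M ((F ^^ n) (c \<odot>\<^bsub>A\<^esub> b)) ((\<phi> ^^ n) u)"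
        "(\<phi> ^^ n) (act M (c \<odot>\<^bsub>A\<^esub> b) v) = act M ((F ^^ n) (c \<odot>\<^bsub>A\<^esub> b)) ((\<phi> ^^ n) v)"
      then show "(\<phi> ^^ n) (act M (c \<odot>\<^bsub>A\<^esub> b) (u \<oplus>\<^bsub>M\<^esub> v)) = act M ((F ^^ n) (c \<odot>\<^bsub>A\<^esub> b)) ((\<phi> ^^ n) (u \<oplus>\<^bsub>M\<^esub> v))"
        using c b by (simp add: M.act_add_right M\<phi>.phin_add M\<phi>.phin_closed AF.phin_closed M.act_closed AF.fx_closed)
    qed
  next
    fix a b assume "a \<in> carrier A" "b \<in> carrier A"
      "(\<phi> ^^ n) (act M a m) = act M ((F ^^ n) a) ((\<phi> ^^ n) m)" "(\<phi> ^^ n) (act M b m) = act M ((F ^^ n) b) ((\<phi> ^^ n) m)"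
    then show "(\<phi> ^^ n) (act M (a \<oplus>\<^bsub>A\<^esub> b) m) = act M ((F ^^ n) (a \<oplus>\<^bsub>A\<^esub> b)) ((\<phi> ^^ n) m)"
      using m by (simp add: M.act_add_left M\<phi>.phin_add AF.phin_add M\<phi>.phin_closed AF.phin_closed M.act_closed)
  qed
  then have "periodic_module k Fq q A F M \<phi> n"
    by unfold_locales (use n(1) in auto)
  then show ?thesis ..
qed

end

context periodic_module
begin

lemma tw_M: "fd_module k A (tw \<phi> i M)" "frobenius_space k Fq q (tw \<phi> i M) \<phi>"
  using tw_module[OF M.fd_module_axioms M.frobenius_space_axioms] .

lemma phin_surj: "m \<in> carrier M \<Longrightarrow> \<exists>m' \<in> carrier M. (\<phi> ^^ i) m' = m"
  using bij_betw_imp_surj_on[OF bij_betw_funpow[OF M.phi_bij, of i]] by (metis imageE)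

lemma Fn_surj: "a \<in> carrier A \<Longrightarrow> \<exists>a' \<in> carrier A. (F ^^ i) a' = a"
  using bij_betw_imp_surj_on[OF bij_betw_funpow[OF AF.phi_bij, of i]] by (metis imageE)

text \<open>\<open>\<phi>^n\<close> carries the action of \<open>M\<close> to that of its
  \<open>n\<close>-th twist and, by \<open>period\<close>, to that of \<open>M\<close> itself. So
  the two actions coincide, not merely up to isomorphism.\<close>

lemma tw_period:
  assumes a: "a \<in> carrier A" and m: "m \<in> carrier M"
  shows "act (tw \<phi> (i + n) M) a m = act (tw \<phi> i M) a m"
proof -
  have 0: "act (tw \<phi> n M) a m = act M a m" if a: "a \<in> carrier A" and m: "m \<in> carrier M" for a m
  proof -
    obtain a' m' where "a' \<in> carrier A" "(F ^^ n) a' = a" "m' \<in> carrier M" "(\<phi> ^^ n) m' = m"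
      using phin_surj[OF m] Fn_surj[OF a] by metis
    then show ?thesis using tw_act[OF M.fd_module_axioms M.frobenius_space_axioms, of a' m' n] period[of a' m'] by simp
  qed
  obtain a' m' where am: "a' \<in> carrier A" "(F ^^ i) a' = a" "m' \<in> carrier M" "(\<phi> ^^ i) m' = m"
    using phin_surj[OF m] Fn_surj[OF a] by metis
  have "act (tw \<phi> (i + n) M) a m = (\<phi> ^^ i) (act (tw \<phi> n M) a' m')"
    using tw_act[OF tw_M[of n] am(1), of m' i] am by (simp add: funpow_add)
  also have "\<dots> = act (tw \<phi> i M) a m"
    using 0[OF am(1,3)] tw_act[OF M.fd_module_axioms M.frobenius_space_axioms am(1,3), of i] am by simp
  finally show ?thesis .
qed

lemma tw_mod:
  assumes a: "a \<in> carrier A" and m: "m \<in> carrier M"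
  shows "act (tw \<phi> (i mod n) M) a m = act (tw \<phi> i M) a m"
proof -
  have "act (tw \<phi> (j + t * n) M) a m = act (tw \<phi> j M) a m" for t j
  proof (induction t)
    case (Suc t)
    have "j + Suc t * n = (j + t * n) + n" by simp
    show ?case unfolding \<open>j + Suc t * n = (j + t * n) + n\<close> tw_period[OF a m] by (rule Suc)
  qed simp
  from this[of "i mod n" "i div n"] show ?thesis by simp
qed

text \<open>
  Finite families indexed modulo \<open>n\<close>, as periodic sequences; the \<open>i\<close>-th component carries the
  action of the \<open>i\<close>-th twist.
\<close>

definition cyc :: "('a, nat \<Rightarrow> 'u, 'c) alg_module" where
  "cyc = mk_module {w. (\<forall>i. w i \<in> carrier M) \<and> (\<forall>i. w (i + n) = w i)} (\<lambda>_. \<zero>\<^bsub>M\<^esub>)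
    (\<lambda>u v i. u i \<oplus>\<^bsub>M\<^esub> v i) (\<lambda>c w i. c \<odot>\<^bsub>M\<^esub> w i) (\<lambda>a w i. act (tw \<phi> i M) a (w i))"

lemma cyc_simps [simp]:
  "w \<in> carrier cyc \<longleftrightarrow> (\<forall>i. w i \<in> carrier M) \<and> (\<forall>i. w (i + n) = w i)"
  "\<zero>\<^bsub>cyc\<^esub> = (\<lambda>_. \<zero>\<^bsub>M\<^esub>)" "u \<oplus>\<^bsub>cyc\<^esub> v = (\<lambda>i. u i \<oplus>\<^bsub>M\<^esub> v i)" "c \<odot>\<^bsub>cyc\<^esub> w = (\<lambda>i. c \<odot>\<^bsub>M\<^esub> w i)"
  "act cyc a w = (\<lambda>i. act (tw \<phi> i M) a (w i))"
  by (simp_all add: cyc_def)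

text \<open>\<open>\<phi>\<close> carries component \<open>i - 1\<close> to component
  \<open>i\<close>; the predecessor modulo \<open>n\<close> is written \<open>i + (n - 1)\<close> to
  stay within the natural numbers.\<close>

definition cphi :: "(nat \<Rightarrow> 'u) \<Rightarrow> nat \<Rightarrow> 'u" where
  "cphi w = (\<lambda>i. \<phi> (w (i + (n - 1))))"

definition single :: "nat \<Rightarrow> 'u \<Rightarrow> nat \<Rightarrow> 'u" where
  "single j x = (\<lambda>i. if i mod n = j then x else \<zero>\<^bsub>M\<^esub>)"

text \<open>Partial sums of the decomposition into components, for inductions that split off one
  component at a time.\<close>

definition trunc :: "nat \<Rightarrow> (nat \<Rightarrow> 'u) \<Rightarrow> nat \<Rightarrow> 'u" where
  "trunc m w = (\<lambda>i. if i mod n < m then w i else \<zero>\<^bsub>M\<^esub>)"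

lemma cyc_mod: "w \<in> carrier cyc \<Longrightarrow> w (i mod n) = w i"
proof -
  assume w: "w \<in> carrier cyc"
  have "w (j + t * n) = w j" for j t
  proof (induction t)
    case (Suc t)
    have "w ((j + t * n) + n) = w (j + t * n)" using w by simp
    then show ?case using Suc by (simp add: ac_simps)
  qed simp
  from this[of "i mod n" "i div n"] show ?thesis by simp
qed

lemma single_closed: "x \<in> carrier M \<Longrightarrow> single j x \<in> carrier cyc" by (simp add: single_def)

lemma trunc_closed: "w \<in> carrier cyc \<Longrightarrow> trunc m w \<in> carrier cyc" by (simp add: trunc_def)

lemma trunc_Suc:
  assumes "w \<in> carrier cyc"
  shows "trunc (Suc m) w = trunc m w \<oplus>\<^bsub>cyc\<^esub> single m (w m)"
proof
  fix i
  show "trunc (Suc m) w i = (trunc m w \<oplus>\<^bsub>cyc\<^esub> single m (w m)) i"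
    using assms cyc_mod[OF assms, of i] by (auto simp: trunc_def single_def less_Suc_eq)
qed

lemma trunc_0: "trunc 0 w = \<zero>\<^bsub>cyc\<^esub>" by (simp add: trunc_def)

lemma trunc_n: "trunc n w = w" using n_pos by (simp add: trunc_def)

lemma cyc_vectorspace: "vectorspace k cyc"
proof -
  have G: "abelian_group cyc"
  proof (rule abelian_groupI)
    show "\<exists>v \<in> carrier cyc. v \<oplus>\<^bsub>cyc\<^esub> w = \<zero>\<^bsub>cyc\<^esub>" if "w \<in> carrier cyc" for w
      by (rule bexI[of _ "\<lambda>i. \<ominus>\<^bsub>M\<^esub> w i"]) (use that in \<open>auto simp: M.V.M.l_neg\<close>)
  qed (auto simp: M.V.M.a_ac)
  have "Module.module k cyc"
    by (rule moduleI)
      (use G AF.is_cring in \<open>auto simp: M.V.smult_l_distr M.V.smult_r_distr M.V.smult_assoc1\<close>)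
  then show ?thesis by (simp add: vectorspace_def AF.field_axioms)
qed

lemma cyc_fin_dim: "vectorspace.fin_dim k cyc"
proof -
  interpret W: vectorspace k cyc by (rule cyc_vectorspace)
  obtain Y where Y: "finite Y" "Y \<subseteq> carrier M" "M.V.span Y = carrier M"
    using M.finite_dimensional unfolding M.V.fin_dim_def by blast
  define S where "S = (\<lambda>(j, y). single j y) ` ({..<n} \<times> Y)"
  have fin: "finite S" unfolding S_def using Y(1) by simp
  have Sc: "S \<subseteq> carrier cyc"
  proof
    fix s assume "s \<in> S"
    then obtain j y where "y \<in> Y" "s = single j y" unfolding S_def by auto
    then show "s \<in> carrier cyc" using single_closed[of y j] Y(2) by blast
  qed
  have sub: "LinearCombinations.submodule k (W.span S) cyc" by (rule W.span_is_submodule[OF Sc])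
  have single_in: "single j x \<in> W.span S" if j: "j < n" and x: "x \<in> carrier M" for j x
  proof (rule M.V.span_induct[of x Y])
    show "x \<in> M.V.span Y" "Y \<subseteq> carrier M" using x Y by auto
    have "single j \<zero>\<^bsub>M\<^esub> = \<zero>\<^bsub>cyc\<^esub>" by (simp add: single_def)
    then show "single j \<zero>\<^bsub>M\<^esub> \<in> W.span S" using submodule.zero_closed[OF sub] by simp
  next
    fix c y assume c: "c \<in> carrier k" and y: "y \<in> Y"
    have "single j (c \<odot>\<^bsub>M\<^esub> y) = c \<odot>\<^bsub>cyc\<^esub> single j y" using c by (auto simp: single_def)
    moreover have "single j y \<in> S" unfolding S_def using j y by (intro image_eqI[of _ _ "(j, y)"]) auto
    then have "single j y \<in> W.span S" using W.in_own_span[OF Sc] by (rule rev_subsetD)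
    ultimately show "single j (c \<odot>\<^bsub>M\<^esub> y) \<in> W.span S" using submodule.smult_closed[OF sub c] by simp
  next
    fix u v assume "single j u \<in> W.span S" "single j v \<in> W.span S"
    moreover have "single j (u \<oplus>\<^bsub>M\<^esub> v) = single j u \<oplus>\<^bsub>cyc\<^esub> single j v" by (auto simp: single_def)
    ultimately show "single j (u \<oplus>\<^bsub>M\<^esub> v) \<in> W.span S" using submodule.m_closed[OF sub] by simp
  qed
  have "w \<in> W.span S" if w: "w \<in> carrier cyc" for w
  proof -
    have "m \<le> n \<Longrightarrow> trunc m w \<in> W.span S" for m
    proof (induction m)
      case 0 show ?case unfolding trunc_0 by (rule submodule.zero_closed[OF sub])
    next
      case (Suc m)
      have wm: "w m \<in> carrier M" using w by simp
      show ?case unfolding trunc_Suc[OF w]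
        by (rule submodule.m_closed[OF sub]) (use Suc single_in[OF _ wm] in auto)
    qed
    from this[of n] show ?thesis by (simp add: trunc_n)
  qed
  then have "W.span S = carrier cyc" using W.span_is_subset2[OF Sc] by blast
  then show ?thesis unfolding W.fin_dim_def using fin Sc by blast
qed

lemma tw_act_closed: "a \<in> carrier A \<Longrightarrow> m \<in> carrier M \<Longrightarrow> act (tw \<phi> i M) a m \<in> carrier M"
  using fd_module.act_closed[OF tw_M(1), of a m i] by simp

lemma cyc_module: "fd_module k A cyc"
proof -
  interpret W: vectorspace k cyc by (rule cyc_vectorspace)
  note T = tw_M(1)
  show ?thesis
  proof (unfold_locales)
    show "W.fin_dim" by (rule cyc_fin_dim)
    show "act cyc a w \<in> carrier cyc" if a: "a \<in> carrier A" and w: "w \<in> carrier cyc" for a w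
      using a w by (auto simp: tw_act_closed tw_period)
    show "act cyc (a \<oplus>\<^bsub>A\<^esub> b) w = act cyc a w \<oplus>\<^bsub>cyc\<^esub> act cyc b w"
      if "a \<in> carrier A" "b \<in> carrier A" "w \<in> carrier cyc" for a b w
      using that fd_module.act_add_left[OF T] by simp
    show "act cyc a (u \<oplus>\<^bsub>cyc\<^esub> v) = act cyc a u \<oplus>\<^bsub>cyc\<^esub> act cyc a v"
      if "a \<in> carrier A" "u \<in> carrier cyc" "v \<in> carrier cyc" for a u v
      using that fd_module.act_add_right[OF T] by simp
    show "act cyc (c \<odot>\<^bsub>A\<^esub> a) w = c \<odot>\<^bsub>cyc\<^esub> act cyc a w" if "c \<in> carrier k" "a \<in> carrier A" "w \<in> carrier cyc" for c a w
      using that fd_module.act_smult_left[OF T] by simp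
    show "act cyc a (c \<odot>\<^bsub>cyc\<^esub> w) = c \<odot>\<^bsub>cyc\<^esub> act cyc a w" if "c \<in> carrier k" "a \<in> carrier A" "w \<in> carrier cyc" for c a w
      using that fd_module.act_smult_right[OF T] by simp
    show "act cyc (a \<otimes>\<^bsub>A\<^esub> b) w = act cyc a (act cyc b w)" if "a \<in> carrier A" "b \<in> carrier A" "w \<in> carrier cyc" for a b w
      using that fd_module.act_mult[OF T] by simp
    show "act cyc \<one>\<^bsub>A\<^esub> w = w" if "w \<in> carrier cyc" for w
      using that fd_module.act_one[OF T] by simp
  qed
qed

lemma cphi_funpow: "(cphi ^^ m) w i = (\<phi> ^^ m) (w (i + m * (n - 1)))"
proof (induction m arbitrary: i)
  case (Suc m)
  have "(cphi ^^ Suc m) w i = \<phi> ((cphi ^^ m) w (i + (n - 1)))" by (simp add: cphi_def)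
  also have "\<dots> = (\<phi> ^^ Suc m) (w (i + Suc m * (n - 1)))" unfolding Suc by (simp add: ac_simps)
  finally show ?case .
qed simp

text \<open>\<open>\<phi>\<close> turns the action of twist \<open>i\<close> into that of twist
  \<open>i + 1\<close>, and \<open>tw_period\<close> closes the cycle. So the shifted map is
  compatible with the action, which \<open>\<phi>\<close> on \<open>M\<close> alone need not
  be.\<close>

lemma cyc_frobenius_module: "frobenius_module k Fq q A F cyc cphi"
proof -
  interpret W: fd_module k A cyc by (rule cyc_module)
  show ?thesis
  proof (unfold_locales)
    show "W.fin_dim" by (rule cyc_fin_dim)
    show "cphi w \<in> carrier cyc" if w: "w \<in> carrier cyc" for w
    proof -
      have "w (i + n + (n - 1)) = w (i + (n - 1))" for i
        using w cyc_simps(1)[of w] by (metis add.commute add.left_commute)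
      then show ?thesis using w by (auto simp: cphi_def M.phi_closed)
    qed
    show "cphi (u \<oplus>\<^bsub>cyc\<^esub> v) = cphi u \<oplus>\<^bsub>cyc\<^esub> cphi v" if "u \<in> carrier cyc" "v \<in> carrier cyc" for u v
      using that by (auto simp: cphi_def M.phi_add)
    show "cphi (c \<odot>\<^bsub>cyc\<^esub> v) = c [^] q \<odot>\<^bsub>cyc\<^esub> cphi v" if "c \<in> carrier k" "v \<in> carrier cyc" for c v
      using that by (auto simp: cphi_def M.phi_smult)
    show "\<exists>t > 0. (cphi ^^ t) w = w" if w: "w \<in> carrier cyc" for w
    proof -
      have fs: "finite (w ` {..<n})" by simp
      have "\<exists>t > 0. (\<phi> ^^ t) s = s" if "s \<in> w ` {..<n}" for s
        using that w M.phi_periodic by auto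
      from common_period[OF fs this] obtain t where t: "t > 0" "\<And>j. j < n \<Longrightarrow> (\<phi> ^^ t) (w j) = w j" by auto
      have tw: "(\<phi> ^^ t) (w i) = w i" for i
        using t(2)[of "i mod n"] n_pos cyc_mod[OF w, of i] by simp
      have twm: "(\<phi> ^^ (t * s)) (w i) = w i" for s i
        by (induction s) (use tw in \<open>auto simp: funpow_add\<close>)
      \<comment> \<open>The exponent is a multiple of \<open>t\<close>, which removes
        \<open>\<phi>\<close>, and of \<open>n\<close>, which removes the shift of the
        index.\<close>
      have "(cphi ^^ (t * n)) w i = w i" for i
      proof -
        have "w (i + t * n * (n - 1)) = w i"
          using cyc_mod[OF w, of "i + t * n * (n - 1)"] cyc_mod[OF w, of i] by (simp add: mult.assoc mult.left_commute)
        then show ?thesis unfolding cphi_funpow using twm[of n i] by simp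
      qed
      then have "(cphi ^^ (t * n)) w = w" by blast
      moreover have "t * n > 0" using t n_pos by simp
      ultimately show ?thesis by blast
    qed
    show "cphi (act cyc a w) = act cyc (F a) (cphi w)" if a: "a \<in> carrier A" and w: "w \<in> carrier cyc" for a w
    proof
      fix i
      have wi: "w j \<in> carrier M" for j using w by simp
      have "cphi (act cyc a w) i = act (tw \<phi> (Suc (i + (n - 1))) M) (F a) (\<phi> (w (i + (n - 1))))"
        using twist_act[OF tw_M(2) a, of "w (i + (n - 1))" "i + (n - 1)"] wi by (simp add: cphi_def)
      also have "Suc (i + (n - 1)) = i + n" using n_pos by simp
      finally show "cphi (act cyc a w) i = act cyc (F a) (cphi w) i"
        using tw_period[OF AF.phi_closed[OF a] M.phi_closed[OF wi]] by (simp add: cphi_def)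
    qed
  qed
qed

lemma proj_hom: "(\<lambda>w. w j) \<in> act_hom (carrier A) cyc (tw \<phi> j M)"
  by (rule act_homI) auto

lemma single_hom: "j < n \<Longrightarrow> single j \<in> act_hom (carrier A) (tw \<phi> j M) cyc"
proof (rule act_homI)
  assume j: "j < n"
  show "single j x \<in> carrier cyc" if "x \<in> carrier (tw \<phi> j M)" for x using that single_closed by simp
  show "single j (x \<oplus>\<^bsub>tw \<phi> j M\<^esub> y) = single j x \<oplus>\<^bsub>cyc\<^esub> single j y" if "x \<in> carrier (tw \<phi> j M)" "y \<in> carrier (tw \<phi> j M)" for x y
    by (auto simp: single_def)
  show "single j (act (tw \<phi> j M) a x) = act cyc a (single j x)" if a: "a \<in> carrier A" and x: "x \<in> carrier (tw \<phi> j M)" for a x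
  proof
    fix i
    show "single j (act (tw \<phi> j M) a x) i = act cyc a (single j x) i"
      using tw_mod[OF a, of x i] x act_zero[OF tw_M(1) a, of i] by (auto simp: single_def)
  qed
qed

lemma retract_tw_cyc: "j < n \<Longrightarrow> retract (carrier A) (tw \<phi> j M) cyc"
  by (rule retractI[OF single_hom proj_hom]) (auto simp: single_def)

lemma trunc_hom: "trunc m \<in> act_hom (carrier A) cyc cyc"
proof (rule act_homI)
  show "trunc m (act cyc a w) = act cyc a (trunc m w)" if a: "a \<in> carrier A" and w: "w \<in> carrier cyc" for a w
    using act_zero[OF tw_M(1) a] by (auto simp: trunc_def)
qed (auto simp: trunc_def)

text \<open>The Krull-Schmidt argument: truncation at \<open>n\<close> induces the identity of
  \<open>L\<close>. Whenever truncation at \<open>Suc m\<close> induces a bijection, locality yields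
  either a retract of component \<open>m\<close> or a bijection from truncation at \<open>m\<close>;
  truncation at \<open>0\<close> induces zero.\<close>

lemma local_retract_cyc:
  assumes L: "act_local S L" and S: "S \<subseteq> carrier A" and r: "retract S L cyc"
  shows "\<exists>j < n. retract S L (tw \<phi> j M)"
proof -
  obtain i p where i: "i \<in> act_hom S L cyc" and p: "p \<in> act_hom S cyc L" and pi: "\<And>x. x \<in> carrier L \<Longrightarrow> p (i x) = x"
    using r by (auto simp: retract_def)
  have AL: "abelian_group L" and L0: "carrier L \<noteq> {\<zero>\<^bsub>L\<^esub>}" using L by (auto simp: act_local_def)
  interpret W: fd_module k A cyc by (rule cyc_module)
  have ic: "i x \<in> carrier cyc" if "x \<in> carrier L" for x by (rule act_homD(2)[OF i that])
  have th: "trunc m \<in> act_hom S cyc cyc" for m using trunc_hom act_hom_mono[OF S] by blast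
  have ph: "(\<lambda>w. w j) \<in> act_hom S cyc (tw \<phi> j M)" for j using proj_hom act_hom_mono[OF S] by blast
  have ih: "single j \<in> act_hom S (tw \<phi> j M) cyc" if "j < n" for j using single_hom[OF that] act_hom_mono[OF S] by blast
  have "m \<le> n \<Longrightarrow> bij_betw (\<lambda>x. p (trunc m (i x))) (carrier L) (carrier L) \<Longrightarrow> \<exists>j < n. retract S L (tw \<phi> j M)" for m
  proof (induction m)
    case 0
    have "(\<lambda>x. p (trunc 0 (i x))) = (\<lambda>x. \<zero>\<^bsub>L\<^esub>)"
      unfolding trunc_0 using act_hom_zero[OF p W.M.abelian_group_axioms AL] by simp
    then have "(\<lambda>x. \<zero>\<^bsub>L\<^esub>) ` carrier L = carrier L" using 0(2) by (simp add: bij_betw_def)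
    moreover have "\<zero>\<^bsub>L\<^esub> \<in> carrier L" using AL by (simp add: abelian_group_def abelian_monoid.zero_closed)
    ultimately have "carrier L = {\<zero>\<^bsub>L\<^esub>}" by blast
    then show ?case using L0 by contradiction
  next
    case (Suc m)
    have m: "m < n" using Suc by simp
    note f = act_hom_comp[OF act_hom_comp[OF i th[of m]] p]
    note u = act_hom_comp[OF i ph[of m]] and v = act_hom_comp[OF ih[OF m] p]
    note g = act_hom_comp[OF u v]
    have "p (trunc (Suc m) (i x)) = p (trunc m (i x)) \<oplus>\<^bsub>L\<^esub> p (single m (i x m))" if x: "x \<in> carrier L" for x
    proof -
      have c: "i x m \<in> carrier M" using ic[OF x] by simp
      show ?thesis unfolding trunc_Suc[OF ic[OF x]]
        by (rule act_homD(3)[OF p trunc_closed[OF ic[OF x]] single_closed[OF c]])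
    qed
    then have "bij_betw (\<lambda>x. p (trunc m (i x)) \<oplus>\<^bsub>L\<^esub> p (single m (i x m))) (carrier L) (carrier L)"
      using Suc(3) bij_betw_cong[of "carrier L" "\<lambda>x. p (trunc (Suc m) (i x))"
        "\<lambda>x. p (trunc m (i x)) \<oplus>\<^bsub>L\<^esub> p (single m (i x m))" "carrier L"] by blast
    from act_localD[OF L f g this] show ?case
    proof
      assume "bij_betw (\<lambda>x. p (trunc m (i x))) (carrier L) (carrier L)"
      then show ?thesis using Suc(1) m by simp
    next
      assume "bij_betw (\<lambda>x. p (single m (i x m))) (carrier L) (carrier L)"
      from retract_of_bij[OF L u v this] show ?thesis using m by blast
    qed
  qed
  moreover have "bij_betw (\<lambda>x. p (trunc n (i x))) (carrier L) (carrier L)"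
    unfolding trunc_n by (subst bij_betw_cong[of _ _ "\<lambda>x. x"]) (auto simp: pi bij_betw_def)
  ultimately show ?thesis by blast
qed

end

subsection \<open>Descent and ascent of indecomposable modules\<close>

context frobenius_algebra
begin

lemma indecomposable_B_local:
  assumes N: "fd_module kF BA N" "indecomposable kF BA N"
  shows "act_local B N"
  using unital_fd_module.indecomposable_local[OF unital_B[OF N(1)] N(2)] by simp

lemma retract_indecomposable_sym:
  assumes M: "fd_module k A M" "indecomposable k A M" and Z: "fd_module k A Z" "indecomposable k A Z"
    and r: "retract (carrier A) Z M"
  shows "alg_module_iso k A Z M \<noteq> {}" "retract (carrier A) M Z"
proof -
  interpret M: unital_fd_module k A M by (rule unital[OF M(1)])
  interpret Z: unital_fd_module k A Z by (rule unital[OF Z(1)])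
  have Z0: "carrier Z \<noteq> {\<zero>\<^bsub>Z\<^esub>}" using Z(2) by (simp add: indecomposable_def)
  obtain i p where ip: "i \<in> act_hom (carrier A) Z M" "p \<in> act_hom (carrier A) M Z" "\<And>x. x \<in> carrier Z \<Longrightarrow> p (i x) = x"
    using r by (auto simp: retract_def)
  have b: "bij_betw i (carrier Z) (carrier M)"
    by (rule M.retract_indecomposable_bij[OF M(2) Z(1) Z0 ip])
  show "alg_module_iso k A Z M \<noteq> {}"
    using Z.act_hom_bij_iso[OF M.unital_fd_module_axioms ip(1) b] by blast
  show "retract (carrier A) M Z"
    by (rule retract_iso(2)[OF ip(1) b Z.M.abelian_group_axioms Z.act_closed])
qed

text \<open>Compatibility of \<open>\<psi>\<close> says that twisting \<open>U\<close> by
  \<open>\<psi>\<close> does not change its action, so the twists of \<open>i\<close> and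
  \<open>p\<close> lead into and out of \<open>U\<close> again.\<close>

lemma retract_twist:
  assumes M: "fd_module k A M" and fr: "frobenius_space k Fq q M \<phi>"
    and U: "frobenius_module k Fq q A F U \<psi>" and r: "retract (carrier A) M U"
  shows "retract (carrier A) (twist A F \<phi> M) U"
proof -
  interpret M\<phi>: frobenius_space k Fq q M \<phi> by fact
  interpret U: frobenius_module k Fq q A F U \<psi> by fact
  note frU = U.U.frobenius_space_axioms
  obtain i p where i: "i \<in> act_hom (carrier A) M U" and p: "p \<in> act_hom (carrier A) U M"
    and pi: "\<And>x. x \<in> carrier M \<Longrightarrow> p (i x) = x"
    using r by (auto simp: retract_def)
  have "retract (carrier A) (twist A F \<phi> M) (twist A F \<psi> U)"
  proof (rule retractI[OF twist_hom[OF M fr frU i] twist_hom[OF U.U.fd_module_axioms frU fr p]])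
    fix x assume x: "x \<in> carrier (twist A F \<phi> M)"
    let ?y = "inv_into (carrier M) \<phi> x"
    have y: "?y \<in> carrier M" "\<phi> ?y = x"
      using bij_betw_imp_surj_on[OF M\<phi>.phi_bij] x by (auto simp: inv_into_into f_inv_into_f)
    then have "inv_into (carrier U) \<psi> (\<psi> (i ?y)) = i ?y"
      using U.U.phi_bij act_homD(2)[OF i] by (simp add: bij_betw_def)
    then show "\<phi> (p (inv_into (carrier U) \<psi> (\<psi> (i ?y)))) = x" using pi y by simp
  qed
  moreover have "act (twist A F \<psi> U) a x = act U a x" if a: "a \<in> carrier A" and x: "x \<in> carrier U" for a x
  proof -
    obtain a' where a': "a' \<in> carrier A" "F a' = a" using F_surj[OF a] by blast
    obtain u where u: "u \<in> carrier U" "\<psi> u = x" using bij_betw_imp_surj_on[OF U.U.phi_bij] x by (metis imageE)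
    show ?thesis using twist_act[OF frU a'(1) u(1)] U.phi_act[OF a'(1) u(1)] a' u by simp
  qed
  then have "retract (carrier A) (twist A F \<psi> U) U"
    by (intro retractI[of "\<lambda>x. x" _ _ _ "\<lambda>x. x"]) (auto intro!: act_homI)
  ultimately show ?thesis by (rule retract_trans)
qed

text \<open>
  A summand \<open>N\<close> of the restriction of \<open>M\<close> is a summand of the fixed points of the sum \<open>W\<close> of the
  twists; the corresponding idempotent extends to \<open>W\<close>, and its image \<open>U\<close> is the extension of
  scalars of \<open>N\<close>.
\<close>

lemma ex_scalar_extension:
  fixes M :: "('a, 'u, 'c) alg_module" and N :: "('a, 'v, 'c) alg_module"
  assumes N: "fd_module kF BA N" "indecomposable kF BA N"
    and M: "fd_module k A M" "indecomposable k A M" and fr: "frobenius_space k Fq q M \<phi>"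
    and NM: "retract B N M"
  obtains n and U :: "('a, nat \<Rightarrow> 'u, 'c) alg_module" and \<psi>
  where "periodic_module k Fq q A F M \<phi> n" "frobenius_module k Fq q A F U \<psi>"
    "retract (carrier A) U (periodic_module.cyc A F M \<phi> n)"
    "retract B N (U\<lparr>carrier := frobenius_space.fx U \<psi>\<rparr>)" "retract B (U\<lparr>carrier := frobenius_space.fx U \<psi>\<rparr>) N"
    "retract (carrier A) M U"
proof -
  obtain n where n: "periodic_module k Fq q A F M \<phi> n" using ex_periodic[OF M(1) fr] by blast
  interpret P: periodic_module k Fq q A F M \<phi> n by (rule n)
  interpret W: frobenius_module k Fq q A F P.cyc P.cphi by (rule P.cyc_frobenius_module)
  interpret WW: unital_fd_module k A P.cyc by (rule unital[OF P.cyc_module])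
  let ?W = "P.cyc"
  have NL: "act_local B N" by (rule indecomposable_B_local[OF N])
  interpret N: fd_module kF BA N by (rule N(1))
  have "retract (carrier A) M ?W" using P.retract_tw_cyc[OF P.n_pos] by simp
  then have "retract B M ?W" by (rule retract_mono[OF B_sub])
  then have "retract B N ?W" by (rule retract_trans[OF NM])
  then have "retract B N W.UF" by (rule W.local_retract_fixed[OF NL finite_B_module[OF N(1)]])
  then obtain i p where i: "i \<in> act_hom B N W.UF" and p: "p \<in> act_hom B W.UF N" and pi: "\<And>x. x \<in> carrier N \<Longrightarrow> p (i x) = x"
    by (auto simp: retract_def)
  have i_fx: "i x \<in> W.U.fx" if "x \<in> carrier N" for x using act_homD(2)[OF i that] by simp
  have p_N: "p y \<in> carrier N" if "y \<in> W.U.fx" for y using act_homD(2)[OF p, of y] that by simp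
  \<comment> \<open>The idempotent of the fixed points whose image is a copy of \<open>N\<close>.
    Its extension \<open>e\<close> is again idempotent and commutes with the Frobenius map, which
    therefore restricts to the image of \<open>e\<close>.\<close>
  define e0 where "e0 y = i (p y)" for y
  have e0: "e0 y \<in> W.U.fx" "e0 (e0 y) = e0 y" if "y \<in> W.U.fx" for y
    using i_fx p_N pi that by (auto simp: e0_def)
  have "(\<lambda>y. e0 y) \<in> act_hom B W.UF ?W"
    unfolding e0_def by (rule act_hom_comp[OF act_hom_comp[OF p i] W.fixed_incl])
  then have "\<exists>e. e \<in> act_hom (carrier A) ?W ?W \<and> (\<forall>c \<in> carrier k. \<forall>y \<in> W.U.fx. e (c \<odot>\<^bsub>?W\<^esub> y) = c \<odot>\<^bsub>?W\<^esub> e0 y)"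
    by (rule W.ex_hom_extension[OF P.cyc_module])
  then obtain e where e: "e \<in> act_hom (carrier A) ?W ?W"
    and ec: "\<And>c y. c \<in> carrier k \<Longrightarrow> y \<in> W.U.fx \<Longrightarrow> e (c \<odot>\<^bsub>?W\<^esub> y) = c \<odot>\<^bsub>?W\<^esub> e0 y" by blast
  have ea: "e (u \<oplus>\<^bsub>?W\<^esub> v) = e u \<oplus>\<^bsub>?W\<^esub> e v" "e u \<in> carrier ?W" if "u \<in> carrier ?W" "v \<in> carrier ?W" for u v
    using act_homD(2,3)[OF e] that by blast+
  have efx: "e y = e0 y" if "y \<in> W.U.fx" for y
    using ec[of \<one> y] that W.U.V.smult_one[OF W.U.fx_closed[OF that]] W.U.V.smult_one[OF W.U.fx_closed[OF e0(1)[OF that]]]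
    by simp
  have ephi: "e (P.cphi v) = P.cphi (e v)" if "v \<in> carrier ?W" for v
    using that
  proof (rule W.U.frob_induct)
    fix c y assume c: "c \<in> carrier k" and y: "y \<in> W.U.fx"
    note yc = W.U.fx_closed[OF y] and ey = W.U.fx_closed[OF e0(1)[OF y]]
    have "e (P.cphi (c \<odot>\<^bsub>?W\<^esub> y)) = c [^] q \<odot>\<^bsub>?W\<^esub> e0 y"
      unfolding W.U.phi_smult[OF c yc] W.U.fx_phi[OF y] by (rule ec) (use c y in auto)
    then show "e (P.cphi (c \<odot>\<^bsub>?W\<^esub> y)) = P.cphi (e (c \<odot>\<^bsub>?W\<^esub> y))"
      unfolding ec[OF c y] W.U.phi_smult[OF c ey] W.U.fx_phi[OF e0(1)[OF y]] .
  next
    fix u v assume "u \<in> carrier ?W" "v \<in> carrier ?W" "e (P.cphi u) = P.cphi (e u)" "e (P.cphi v) = P.cphi (e v)"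
    then show "e (P.cphi (u \<oplus>\<^bsub>?W\<^esub> v)) = P.cphi (e (u \<oplus>\<^bsub>?W\<^esub> v))"
      using ea W.U.phi_add W.U.phi_closed by metis
  qed
  have ee: "e (e v) = e v" if "v \<in> carrier ?W" for v
    using that
  proof (rule W.U.frob_induct)
    fix c y assume c: "c \<in> carrier k" and y: "y \<in> W.U.fx"
    show "e (e (c \<odot>\<^bsub>?W\<^esub> y)) = e (c \<odot>\<^bsub>?W\<^esub> y)"
      unfolding ec[OF c y] ec[OF c e0(1)[OF y]] e0(2)[OF y] ..
  next
    fix u v assume "u \<in> carrier ?W" "v \<in> carrier ?W" "e (e u) = e u" "e (e v) = e v"
    then show "e (e (u \<oplus>\<^bsub>?W\<^esub> v)) = e (u \<oplus>\<^bsub>?W\<^esub> v)" using ea by metis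
  qed
  define I where "I = e ` carrier ?W"
  define U where "U = ?W\<lparr>carrier := I\<rparr>"
  have I: "v \<in> I \<longleftrightarrow> v \<in> carrier ?W \<and> e v = v" for v
  proof
    assume "v \<in> I"
    then obtain w where "w \<in> carrier ?W" "v = e w" unfolding I_def by (rule imageE)
    then show "v \<in> carrier ?W \<and> e v = v" using ee[of w] act_homD(2)[OF e, of w] by metis
  next
    assume "v \<in> carrier ?W \<and> e v = v"
    then show "v \<in> I" unfolding I_def by (metis imageI)
  qed
  have subI: "alg_submodule k A I ?W" unfolding I_def by (rule WW.act_hom_image[OF e P.cyc_module])
  have Um: "fd_module k A U" unfolding U_def by (rule WW.fd_submodule[OF subI])
  interpret U: fd_module k A U by (rule Um)
  have Us: "carrier U = I" "\<And>x y. x \<oplus>\<^bsub>U\<^esub> y = x \<oplus>\<^bsub>?W\<^esub> y" "\<And>c x. c \<odot>\<^bsub>U\<^esub> x = c \<odot>\<^bsub>?W\<^esub> x" "\<And>a x. act U a x = act ?W a x"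
    "\<zero>\<^bsub>U\<^esub> = \<zero>\<^bsub>?W\<^esub>"
    unfolding U_def by simp_all
  have IW: "v \<in> carrier ?W" if "v \<in> I" for v using I that by blast
  have frU: "frobenius_module k Fq q A F U P.cphi"
  proof (unfold_locales)
    show "U.fin_dim" by (rule U.finite_dimensional)
    show "P.cphi v \<in> carrier U" if "v \<in> carrier U" for v
      unfolding Us I using that[unfolded Us I] ephi W.U.phi_closed by metis
    show "P.cphi (u \<oplus>\<^bsub>U\<^esub> v) = P.cphi u \<oplus>\<^bsub>U\<^esub> P.cphi v" if "u \<in> carrier U" "v \<in> carrier U" for u v
      unfolding Us by (rule W.U.phi_add) (use that Us(1) IW in blast)+
    show "P.cphi (c \<odot>\<^bsub>U\<^esub> v) = c [^] q \<odot>\<^bsub>U\<^esub> P.cphi v" if "c \<in> carrier k" "v \<in> carrier U" for c v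
      unfolding Us by (rule W.U.phi_smult) (use that Us(1) IW in blast)+
    show "\<exists>n>0. (P.cphi ^^ n) v = v" if "v \<in> carrier U" for v
      by (rule W.U.phi_periodic) (use that Us(1) IW in blast)
    show "P.cphi (act U a v) = act U (F a) (P.cphi v)" if "a \<in> carrier A" "v \<in> carrier U" for a v
      unfolding Us by (rule W.phi_act) (use that Us(1) IW in blast)+
  qed
  interpret UF: frobenius_module k Fq q A F U P.cphi by (rule frU)
  have Ufx: "y \<in> UF.U.fx \<longleftrightarrow> y \<in> W.U.fx \<and> e y = y" for y
    unfolding UF.U.fx_def W.U.fx_def Us using I by auto
  have UW: "retract (carrier A) U ?W"
  proof (rule retractI)
    show "(\<lambda>x. x) \<in> act_hom (carrier A) U ?W" unfolding U_def by (rule WW.act_hom_incl[OF subI])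
    show "e \<in> act_hom (carrier A) ?W U"
      by (rule act_homI) (use act_homD[OF e] in \<open>auto simp only: Us I_def\<close>)
    show "e x = x" if "x \<in> carrier U" for x using that Us(1) I by blast
  qed
  have iU: "i \<in> act_hom B N UF.UF"
  proof (rule act_homI)
    show "i x \<in> carrier UF.UF" if x: "x \<in> carrier N" for x
      using i_fx[OF x] efx[OF i_fx[OF x]] pi[OF x] by (simp add: Ufx e0_def)
  qed (use act_homD(3,4)[OF i] in \<open>simp_all add: Us\<close>)
  have pU: "p \<in> act_hom B UF.UF N"
    by (rule act_homI) (use p_N act_homD(3,4)[OF p] in \<open>simp_all add: Us Ufx\<close>)
  have NU: "retract B N UF.UF" by (rule retractI[OF iU pU]) (rule pi)
  have UN: "retract B UF.UF N"
    by (rule retractI[OF pU iU]) (use efx in \<open>auto simp: Ufx e0_def\<close>)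
  have U0: "carrier U \<noteq> {\<zero>\<^bsub>U\<^esub>}"
  proof
    assume c: "carrier U = {\<zero>\<^bsub>U\<^esub>}"
    have "i x = \<zero>\<^bsub>U\<^esub>" if "x \<in> carrier N" for x
      using act_homD(2)[OF iU that] UF.U.fx_closed c by auto
    then have "x = p \<zero>\<^bsub>U\<^esub>" if "x \<in> carrier N" for x using pi[OF that] that by simp
    then have "x = \<zero>\<^bsub>N\<^esub>" if "x \<in> carrier N" for x using that N.M.zero_closed by metis
    then have "carrier N = {\<zero>\<^bsub>N\<^esub>}" using N.M.zero_closed by blast
    then show False using N(2) by (simp add: indecomposable_def)
  qed
  \<comment> \<open>Some indecomposable summand of \<open>U\<close> is a twist of \<open>M\<close>,
    say the \<open>j\<close>-th. By \<open>retract_twist\<close> all later twists are summands of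
    \<open>U\<close>, among them the \<open>n\<close>-th, whose action is that of
    \<open>M\<close>.\<close>
  have MU: "retract (carrier A) M U"
  proof -
    interpret UU: unital_fd_module k A U by (rule unital[OF Um])
    obtain Z where Z: "alg_submodule k A Z U" "indecomposable k A (U\<lparr>carrier := Z\<rparr>)" "retract (carrier A) (U\<lparr>carrier := Z\<rparr>) U"
      using UU.ex_indecomposable_summand[OF U0] by blast
    let ?Z = "U\<lparr>carrier := Z\<rparr>"
    have Zm: "fd_module k A ?Z" by (rule UU.fd_submodule[OF Z(1)])
    have ZL: "act_local (carrier A) ?Z" by (rule unital_fd_module.indecomposable_local[OF unital[OF Zm] Z(2)])
    obtain j where j: "j < n" "retract (carrier A) ?Z (tw \<phi> j M)"
      using P.local_retract_cyc[OF ZL subset_refl retract_trans[OF Z(3) UW]] by blast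
    have "retract (carrier A) (tw \<phi> j M) ?Z"
      by (rule retract_indecomposable_sym(2)[OF P.tw_M(1) tw_indecomposable[OF M(1) fr M(2)] Zm Z(2) j(2)])
    then have jU: "retract (carrier A) (tw \<phi> j M) U" using Z(3) by (rule retract_trans)
    have "retract (carrier A) (tw \<phi> (t + j) M) U" for t
    proof (induction t)
      case (Suc t) then show ?case using retract_twist[OF P.tw_M frU Suc] by simp
    qed (use jU in simp)
    from this[of "n - j"] j have nU: "retract (carrier A) (tw \<phi> n M) U" by simp
    have "retract (carrier A) M (tw \<phi> n M)"
      by (rule retractI[of "\<lambda>x. x" _ _ _ "\<lambda>x. x"]) (use P.tw_period[of _ _ 0] in \<open>auto intro!: act_homI\<close>)
    then show ?thesis using nU by (rule retract_trans)
  qed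
  show thesis by (rule that[OF n frU UW NU UN MU])
qed

text \<open>Let \<open>U\<close> be the extension of scalars of \<open>N\<close>. Then
  \<open>M\<close> is a summand of \<open>U\<close>, hence so is \<open>N'\<close> over
  \<open>B\<close>. Being finite and local, \<open>N'\<close> is already a summand of the fixed
  points of \<open>U\<close>, that is, of \<open>N\<close>.\<close>

lemma restriction_unique:
  fixes M :: "('a, 'u, 'c) alg_module"
  assumes N: "fd_module kF BA N" "indecomposable kF BA N"
    and N': "fd_module kF BA N'" "indecomposable kF BA N'"
    and M: "fd_module k A M" "indecomposable k A M"
    and R: "retract B N M" "retract B N' M"
  shows "retract B N' N"
proof -
  interpret M: fd_module k A M by (rule M(1))
  obtain \<phi> where fr: "frobenius_space k Fq q M \<phi>"
    using AF.ex_frobenius_map[OF M.vectorspace_axioms M.finite_dimensional] by blast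
  obtain U :: "('a, nat \<Rightarrow> 'u, 'c) alg_module" and \<psi> where U: "frobenius_module k Fq q A F U \<psi>"
    "retract B (U\<lparr>carrier := frobenius_space.fx U \<psi>\<rparr>) N" "retract (carrier A) M U"
    by (rule ex_scalar_extension[OF N M fr R(1)]) (rule that)
  interpret U: frobenius_module k Fq q A F U \<psi> by (rule U(1))
  have "retract B N' U" by (rule retract_trans[OF R(2) retract_mono[OF B_sub U(3)]])
  then have "retract B N' U.UF"
    by (rule U.local_retract_fixed[OF indecomposable_B_local[OF N'] finite_B_module[OF N'(1)]])
  then show ?thesis using U(2) by (rule retract_trans)
qed

text \<open>The two homomorphisms extend to \<open>U\<close> and \<open>U'\<close>, and since fixed
  points span, the relation \<open>p i = id\<close> extends with them.\<close>

lemma retract_of_fixed: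
  assumes U: "frobenius_module k Fq q A F U \<psi>" and U': "frobenius_module k Fq q A F U' \<psi>'"
    and r: "retract B (U\<lparr>carrier := frobenius_space.fx U \<psi>\<rparr>) (U'\<lparr>carrier := frobenius_space.fx U' \<psi>'\<rparr>)"
  shows "retract (carrier A) U U'"
proof -
  interpret U: frobenius_module k Fq q A F U \<psi> by fact
  interpret U': frobenius_module k Fq q A F U' \<psi>' by fact
  obtain i p where i: "i \<in> act_hom B U.UF U'.UF" and p: "p \<in> act_hom B U'.UF U.UF" and pi: "\<And>x. x \<in> U.U.fx \<Longrightarrow> p (i x) = x"
    using r by (auto simp: retract_def)
  have ifx: "i y \<in> U'.U.fx" if "y \<in> U.U.fx" for y using act_homD(2)[OF i, of y] that by simp
  obtain i' where i': "i' \<in> act_hom (carrier A) U U'" and ic: "\<And>c y. c \<in> carrier k \<Longrightarrow> y \<in> U.U.fx \<Longrightarrow> i' (c \<odot>\<^bsub>U\<^esub> y) = c \<odot>\<^bsub>U'\<^esub> i y"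
    using U.ex_hom_extension[OF U'.U.fd_module_axioms act_hom_comp[OF i U'.fixed_incl]] by blast
  obtain p' where p': "p' \<in> act_hom (carrier A) U' U" and pc: "\<And>c y. c \<in> carrier k \<Longrightarrow> y \<in> U'.U.fx \<Longrightarrow> p' (c \<odot>\<^bsub>U'\<^esub> y) = c \<odot>\<^bsub>U\<^esub> p y"
    using U'.ex_hom_extension[OF U.U.fd_module_axioms act_hom_comp[OF p U.fixed_incl]] by blast
  show ?thesis
  proof (rule retractI[OF i' p'])
    fix x assume "x \<in> carrier U"
    then show "p' (i' x) = x"
    proof (rule U.U.frob_induct)
      fix c y assume c: "c \<in> carrier k" and y: "y \<in> U.U.fx"
      show "p' (i' (c \<odot>\<^bsub>U\<^esub> y)) = c \<odot>\<^bsub>U\<^esub> y" unfolding ic[OF c y] pc[OF c ifx[OF y]] pi[OF y] ..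
    next
      fix u v assume uv: "u \<in> carrier U" "v \<in> carrier U" "p' (i' u) = u" "p' (i' v) = v"
      show "p' (i' (u \<oplus>\<^bsub>U\<^esub> v)) = u \<oplus>\<^bsub>U\<^esub> v"
        unfolding act_homD(3)[OF i' uv(1,2)] act_homD(3)[OF p' act_homD(2)[OF i' uv(1)] act_homD(2)[OF i' uv(2)]] uv(3,4) ..
    qed
  qed
qed

text \<open>The extension of scalars of \<open>N\<close> built inside the twists of \<open>M\<close>
  is a summand of the one built inside the twists of \<open>M'\<close>. So \<open>M\<close>, a
  summand of the former, is a summand of the sum of the twists of \<open>M'\<close>; being local and
  indecomposable, it is isomorphic to one of them.\<close>

lemma common_restriction:
  fixes M :: "('a, 'u, 'c) alg_module" and M' :: "('a, 'v, 'c) alg_module"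
  assumes N: "fd_module kF BA N" "indecomposable kF BA N"
    and M: "fd_module k A M" "indecomposable k A M"
    and M': "fd_module k A M'" "indecomposable k A M'" and fr': "frobenius_space k Fq q M' \<phi>"
    and R: "retract B N M" "retract B N M'"
  shows "\<exists>i. alg_module_iso k A M (tw \<phi> i M') \<noteq> {}"
proof -
  interpret M: fd_module k A M by (rule M(1))
  obtain \<psi> where fr: "frobenius_space k Fq q M \<psi>"
    using AF.ex_frobenius_map[OF M.vectorspace_axioms M.finite_dimensional] by blast
  obtain U :: "('a, nat \<Rightarrow> 'u, 'c) alg_module" and \<theta> where U: "frobenius_module k Fq q A F U \<theta>"
    "retract B (U\<lparr>carrier := frobenius_space.fx U \<theta>\<rparr>) N" "retract (carrier A) M U"
    by (rule ex_scalar_extension[OF N M fr R(1)]) (rule that)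
  obtain n' and U' :: "('a, nat \<Rightarrow> 'v, 'c) alg_module" and \<theta>' where U': "periodic_module k Fq q A F M' \<phi> n'" "frobenius_module k Fq q A F U' \<theta>'"
    "retract (carrier A) U' (periodic_module.cyc A F M' \<phi> n')"
    "retract B N (U'\<lparr>carrier := frobenius_space.fx U' \<theta>'\<rparr>)"
    by (rule ex_scalar_extension[OF N M' fr' R(2)]) (rule that)
  interpret P: periodic_module k Fq q A F M' \<phi> n' by (rule U'(1))
  have "retract (carrier A) U U'"
    by (rule retract_of_fixed[OF U(1) U'(2) retract_trans[OF U(2) U'(4)]])
  then have "retract (carrier A) M P.cyc"
    by (rule retract_trans[OF U(3) retract_trans[OF _ U'(3)]])
  moreover have LM: "act_local (carrier A) M" by (rule unital_fd_module.indecomposable_local[OF unital[OF M(1)] M(2)])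
  ultimately obtain j where "retract (carrier A) M (tw \<phi> j M')" using P.local_retract_cyc[OF LM subset_refl] by blast
  then have "alg_module_iso k A M (tw \<phi> j M') \<noteq> {}"
    by (rule retract_indecomposable_sym(1)[OF P.tw_M(1) tw_indecomposable[OF M'(1) fr' M'(2)] M])
  then show ?thesis by blast
qed

text \<open>An indecomposable summand of the fixed points of the sum of the twists is a summand of
  that sum over \<open>B\<close>, hence by locality of a single twist, and the twists all have the
  same restriction to \<open>B\<close>.\<close>

lemma ex_restriction:
  fixes M :: "('a, 'u, 'c) alg_module"
  assumes M: "fd_module k A M" "indecomposable k A M"
  shows "\<exists>N :: ('a, nat \<Rightarrow> 'u, 'c) alg_module. fd_module kF BA N \<and> indecomposable kF BA N \<and> retract B N M"
proof -
  interpret M: fd_module k A M by (rule M(1))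
  obtain \<phi> where fr: "frobenius_space k Fq q M \<phi>"
    using AF.ex_frobenius_map[OF M.vectorspace_axioms M.finite_dimensional] by blast
  obtain n where n: "periodic_module k Fq q A F M \<phi> n" using ex_periodic[OF M(1) fr] by blast
  interpret P: periodic_module k Fq q A F M \<phi> n by (rule n)
  interpret W: frobenius_module k Fq q A F P.cyc P.cphi by (rule P.cyc_frobenius_module)
  interpret WF: unital_fd_module kF BA W.UF by (rule unital_B[OF W.fixed_module])
  \<comment> \<open>Fixed points span the sum of the twists, which contains \<open>M\<close> as
    component \<open>0\<close> and so is nonzero.\<close>
  have "carrier W.UF \<noteq> {\<zero>\<^bsub>W.UF\<^esub>}"
  proof
    assume c: "carrier W.UF = {\<zero>\<^bsub>W.UF\<^esub>}"
    have w0: "w = \<zero>\<^bsub>P.cyc\<^esub>" if "w \<in> carrier P.cyc" for w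
      using that
    proof (rule W.U.frob_induct)
      show "d \<odot>\<^bsub>P.cyc\<^esub> y = \<zero>\<^bsub>P.cyc\<^esub>" if d: "d \<in> carrier k" and y: "y \<in> W.U.fx" for d y
      proof -
        have "y = \<zero>\<^bsub>P.cyc\<^esub>" using y c by simp
        then show ?thesis using W.U.V.smult_r_null[OF d] by simp
      qed
      show "u \<oplus>\<^bsub>P.cyc\<^esub> v = \<zero>\<^bsub>P.cyc\<^esub>" if "u = \<zero>\<^bsub>P.cyc\<^esub>" "v = \<zero>\<^bsub>P.cyc\<^esub>" for u v
        unfolding that by (rule W.U.V.M.l_zero[OF W.U.V.M.zero_closed])
    qed
    have "x = \<zero>\<^bsub>M\<^esub>" if "x \<in> carrier M" for x
    proof -
      have "P.single 0 x = \<zero>\<^bsub>P.cyc\<^esub>" by (rule w0[OF P.single_closed[OF that]])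
      then have "P.single 0 x 0 = \<zero>\<^bsub>P.cyc\<^esub> 0" by (rule fun_cong)
      then show ?thesis by (simp add: P.single_def)
    qed
    then have "carrier M = {\<zero>\<^bsub>M\<^esub>}" using M.M.zero_closed by blast
    then show False using M(2) by (simp add: indecomposable_def)
  qed
  then obtain Z where Z: "alg_submodule kF BA Z W.UF" "indecomposable kF BA (W.UF\<lparr>carrier := Z\<rparr>)"
    "retract (carrier BA) (W.UF\<lparr>carrier := Z\<rparr>) W.UF"
    using WF.ex_indecomposable_summand by blast
  let ?N = "W.UF\<lparr>carrier := Z\<rparr>"
  have Nm: "fd_module kF BA ?N" by (rule WF.fd_submodule[OF Z(1)])
  have NL: "act_local B ?N" by (rule indecomposable_B_local[OF Nm Z(2)])
  have "retract B ?N P.cyc" using Z(3) W.retract_fixed unfolding carrier_BA by (rule retract_trans)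
  then obtain j where "retract B ?N (tw \<phi> j M)" using P.local_retract_cyc[OF NL B_sub] by blast
  then have "retract B ?N M" using tw_restrict(2)[OF M(1) fr] by (rule retract_trans)
  then show ?thesis using Nm Z(2) by blast
qed

end

text \<open>
  The coinduced module \<open>Hom\<^sub>B(A, N)\<close> is not finite dimensional, but contains the submodule spanned by
  the maps \<open>a \<mapsto> \<Lambda>(c a) x\<close>, where \<open>\<Lambda> : A \<rightarrow> B\<close> is induced by a linear form on \<open>k\<close>.
\<close>

locale coinduced = frobenius_algebra k Fq q A F + N: fd_module "k\<lparr>carrier := Fq\<rparr>" "fixed_algebra A F" N
  for k :: "('a, 'b) ring_scheme" (structure) and Fq q and A :: "('a, 'c, 'd) module_scheme" and F
    and N :: "('a, 'v, 'c) alg_module" +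
  fixes l :: "'a \<Rightarrow> 'a" and \<Lambda> :: "'c \<Rightarrow> 'c"
  assumes l_in: "l \<in> carrier k \<rightarrow> Fq"
    and L_closed: "a \<in> carrier A \<Longrightarrow> \<Lambda> a \<in> AF.fx"
    and L_add: "a \<in> carrier A \<Longrightarrow> b \<in> carrier A \<Longrightarrow> \<Lambda> (a \<oplus>\<^bsub>A\<^esub> b) = \<Lambda> a \<oplus>\<^bsub>A\<^esub> \<Lambda> b"
    and L_smult: "c \<in> carrier k \<Longrightarrow> b \<in> AF.fx \<Longrightarrow> \<Lambda> (c \<odot>\<^bsub>A\<^esub> b) = l c \<odot>\<^bsub>A\<^esub> b"
    and L_fixed: "b \<in> AF.fx \<Longrightarrow> \<Lambda> b = b"
begin

lemma N_act_closed [simp]: "b \<in> B \<Longrightarrow> x \<in> carrier N \<Longrightarrow> act N b x \<in> carrier N"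
  using N.act_closed by simp

lemma lk: "c \<in> carrier k \<Longrightarrow> l c \<in> Fq" using l_in by auto

text \<open>\<open>\<Lambda>\<close> is \<open>l \<otimes> id\<close> on
  \<open>A = k \<otimes> B\<close>, hence a homomorphism of \<open>B\<close>-bimodules;
  \<open>L_right\<close> is the other half.\<close>

lemma L_left:
  assumes b: "b \<in> B" and a: "a \<in> carrier A" shows "\<Lambda> (b \<otimes>\<^bsub>A\<^esub> a) = b \<otimes>\<^bsub>A\<^esub> \<Lambda> a"
  using a
proof (rule AF.frob_induct)
  fix c y assume c: "c \<in> carrier k" and y: "y \<in> B"
  show "\<Lambda> (b \<otimes>\<^bsub>A\<^esub> (c \<odot>\<^bsub>A\<^esub> y)) = b \<otimes>\<^bsub>A\<^esub> \<Lambda> (c \<odot>\<^bsub>A\<^esub> y)"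
    using b c y lk[OF c] A.smult_mult_right[OF _ AF.fx_closed[OF b] AF.fx_closed[OF y]] by (simp add: L_smult B_mult)
next
  fix u v assume "u \<in> carrier A" "v \<in> carrier A" "\<Lambda> (b \<otimes>\<^bsub>A\<^esub> u) = b \<otimes>\<^bsub>A\<^esub> \<Lambda> u" "\<Lambda> (b \<otimes>\<^bsub>A\<^esub> v) = b \<otimes>\<^bsub>A\<^esub> \<Lambda> v"
  then show "\<Lambda> (b \<otimes>\<^bsub>A\<^esub> (u \<oplus>\<^bsub>A\<^esub> v)) = b \<otimes>\<^bsub>A\<^esub> \<Lambda> (u \<oplus>\<^bsub>A\<^esub> v)"
    using AF.fx_closed[OF b] AF.fx_closed[OF L_closed] by (simp add: A.A.r_distr L_add)
qed

lemma L_right: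
  assumes b: "b \<in> B" and a: "a \<in> carrier A" shows "\<Lambda> (a \<otimes>\<^bsub>A\<^esub> b) = \<Lambda> a \<otimes>\<^bsub>A\<^esub> b"
  using a
proof (rule AF.frob_induct)
  fix c y assume c: "c \<in> carrier k" and y: "y \<in> B"
  show "\<Lambda> ((c \<odot>\<^bsub>A\<^esub> y) \<otimes>\<^bsub>A\<^esub> b) = \<Lambda> (c \<odot>\<^bsub>A\<^esub> y) \<otimes>\<^bsub>A\<^esub> b"
    using b c y lk[OF c] A.smult_mult_left[OF _ AF.fx_closed[OF y] AF.fx_closed[OF b]] by (simp add: L_smult B_mult)
next
  fix u v assume "u \<in> carrier A" "v \<in> carrier A" "\<Lambda> (u \<otimes>\<^bsub>A\<^esub> b) = \<Lambda> u \<otimes>\<^bsub>A\<^esub> b" "\<Lambda> (v \<otimes>\<^bsub>A\<^esub> b) = \<Lambda> v \<otimes>\<^bsub>A\<^esub> b"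
  then show "\<Lambda> ((u \<oplus>\<^bsub>A\<^esub> v) \<otimes>\<^bsub>A\<^esub> b) = \<Lambda> (u \<oplus>\<^bsub>A\<^esub> v) \<otimes>\<^bsub>A\<^esub> b"
    using AF.fx_closed[OF b] AF.fx_closed[OF L_closed] by (simp add: A.A.l_distr L_add)
qed

definition gen :: "'a \<Rightarrow> 'v \<Rightarrow> 'c \<Rightarrow> 'v" where
  "gen c x = (\<lambda>a\<in>carrier A. act N (\<Lambda> (c \<odot>\<^bsub>A\<^esub> a)) x)"

text \<open>Additive generation suffices: \<open>gen c x\<close> is \<open>c\<close> times
  \<open>gen 1 x\<close>, and right multiplication of the argument by \<open>b \<in> B\<close> only
  replaces \<open>x\<close> by \<open>b x\<close>. The members are extensional functions, so that
  agreement on \<open>A\<close> is equality.\<close>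

inductive_set V :: "('c \<Rightarrow> 'v) set" where
  gen: "c \<in> carrier k \<Longrightarrow> x \<in> carrier N \<Longrightarrow> gen c x \<in> V"
| add: "f \<in> V \<Longrightarrow> g \<in> V \<Longrightarrow> (\<lambda>a\<in>carrier A. f a \<oplus>\<^bsub>N\<^esub> g a) \<in> V"

lemma V_closed: "f \<in> V \<Longrightarrow> a \<in> carrier A \<Longrightarrow> f a \<in> carrier N"
  by (induction rule: V.induct) (auto simp: gen_def L_closed)

lemma V_ext: "f \<in> V \<Longrightarrow> a \<notin> carrier A \<Longrightarrow> f a = undefined"
  by (induction rule: V.induct) (auto simp: gen_def)

lemma V_eqI: "f \<in> V \<Longrightarrow> (\<And>a. a \<in> carrier A \<Longrightarrow> g a = f a) \<Longrightarrow> restrict g (carrier A) = f"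
  by (rule ext) (auto simp: restrict_def V_ext)

lemma V_add: "f \<in> V \<Longrightarrow> a \<in> carrier A \<Longrightarrow> b \<in> carrier A \<Longrightarrow> f (a \<oplus>\<^bsub>A\<^esub> b) = f a \<oplus>\<^bsub>N\<^esub> f b"
proof (induction rule: V.induct)
  case (gen c x)
  then show ?case using N.act_add_left by (simp add: gen_def AF.V.smult_r_distr L_add L_closed)
next
  case (add f g)
  then show ?case by (simp add: V_closed N.M.a_ac)
qed

lemma V_zero: "f \<in> V \<Longrightarrow> f \<zero>\<^bsub>A\<^esub> = \<zero>\<^bsub>N\<^esub>"
  by (rule additive_zero[OF AF.V.M.abelian_group_axioms N.M.abelian_group_axioms]) (auto simp: V_closed V_add)

lemma V_left: "f \<in> V \<Longrightarrow> b \<in> B \<Longrightarrow> a \<in> carrier A \<Longrightarrow> f (b \<otimes>\<^bsub>A\<^esub> a) = act N b (f a)"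
proof (induction rule: V.induct)
  case (gen c x)
  have bc: "b \<in> carrier A" by (rule AF.fx_closed[OF gen(3)])
  have "\<Lambda> (c \<odot>\<^bsub>A\<^esub> (b \<otimes>\<^bsub>A\<^esub> a)) = b \<otimes>\<^bsub>A\<^esub> \<Lambda> (c \<odot>\<^bsub>A\<^esub> a)"
    using L_left[OF gen(3), of "c \<odot>\<^bsub>A\<^esub> a"] A.smult_mult_right[OF gen(1) bc gen(4)] gen by simp
  then show ?case using N.act_mult[of b "\<Lambda> (c \<odot>\<^bsub>A\<^esub> a)" x] gen bc by (simp add: gen_def L_closed)
next
  case (add f g)
  then show ?case using N.act_add_right[of b] AF.fx_closed[OF add(5)] by (simp add: V_closed)
qed

lemma V_smult: "f \<in> V \<Longrightarrow> d \<in> carrier k \<Longrightarrow> (\<lambda>a\<in>carrier A. f (d \<odot>\<^bsub>A\<^esub> a)) \<in> V"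
proof (induction rule: V.induct)
  case (gen c x)
  have "(\<lambda>a\<in>carrier A. gen c x (d \<odot>\<^bsub>A\<^esub> a)) = gen (c \<otimes> d) x"
    using gen by (auto simp: gen_def AF.V.smult_assoc1)
  then show ?case using V.gen[of "c \<otimes> d" x] gen by simp
next
  case (add f g)
  have "(\<lambda>a\<in>carrier A. (\<lambda>a\<in>carrier A. f a \<oplus>\<^bsub>N\<^esub> g a) (d \<odot>\<^bsub>A\<^esub> a)) =
    (\<lambda>a\<in>carrier A. (\<lambda>a\<in>carrier A. f (d \<odot>\<^bsub>A\<^esub> a)) a \<oplus>\<^bsub>N\<^esub> (\<lambda>a\<in>carrier A. g (d \<odot>\<^bsub>A\<^esub> a)) a)"
    using add(5) by (intro restrict_ext) simp
  then show ?case using V.add[OF add(3,4)[OF add(5)]] by (simp only:)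
qed

text \<open>\<open>A\<close> is spanned by products \<open>d b\<close> with
  \<open>b \<in> B\<close>, and the translate of \<open>gen c x\<close> by \<open>d b\<close> is
  \<open>gen (c d) (b x)\<close>.\<close>

lemma V_act:
  assumes f: "f \<in> V" and d: "d \<in> carrier A" shows "(\<lambda>a\<in>carrier A. f (a \<otimes>\<^bsub>A\<^esub> d)) \<in> V"
  using d
proof (rule AF.frob_induct)
  show "(\<lambda>a\<in>carrier A. f (a \<otimes>\<^bsub>A\<^esub> (d \<odot>\<^bsub>A\<^esub> b))) \<in> V" if d: "d \<in> carrier k" and b: "b \<in> B" for d b
    using f
  proof induction
    case (gen c x)
    have bc: "b \<in> carrier A" by (rule AF.fx_closed[OF b])
    have "act N (\<Lambda> (c \<odot>\<^bsub>A\<^esub> (a \<otimes>\<^bsub>A\<^esub> (d \<odot>\<^bsub>A\<^esub> b)))) x = act N (\<Lambda> ((c \<otimes> d) \<odot>\<^bsub>A\<^esub> a)) (act N b x)" if a: "a \<in> carrier A" for a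
    proof -
      have "c \<odot>\<^bsub>A\<^esub> (a \<otimes>\<^bsub>A\<^esub> (d \<odot>\<^bsub>A\<^esub> b)) = ((c \<otimes> d) \<odot>\<^bsub>A\<^esub> a) \<otimes>\<^bsub>A\<^esub> b"
        using a bc d gen by (simp add: A.smult_mult_right A.smult_mult_left AF.V.smult_assoc1)
      then show ?thesis using L_right[OF b, of "(c \<otimes> d) \<odot>\<^bsub>A\<^esub> a"] a d gen b
          N.act_mult[of "\<Lambda> ((c \<otimes> d) \<odot>\<^bsub>A\<^esub> a)" b x] by (simp add: L_closed)
    qed
    then have "(\<lambda>a\<in>carrier A. gen c x (a \<otimes>\<^bsub>A\<^esub> (d \<odot>\<^bsub>A\<^esub> b))) = gen (c \<otimes> d) (act N b x)"
      unfolding gen_def using d bc by (intro restrict_ext) simp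
    then show ?case using V.gen[of "c \<otimes> d" "act N b x"] gen d b by simp
  next
    case (add f g)
    have "(\<lambda>a\<in>carrier A. (\<lambda>a\<in>carrier A. f a \<oplus>\<^bsub>N\<^esub> g a) (a \<otimes>\<^bsub>A\<^esub> (d \<odot>\<^bsub>A\<^esub> b))) =
      (\<lambda>a\<in>carrier A. (\<lambda>a\<in>carrier A. f (a \<otimes>\<^bsub>A\<^esub> (d \<odot>\<^bsub>A\<^esub> b))) a \<oplus>\<^bsub>N\<^esub> (\<lambda>a\<in>carrier A. g (a \<otimes>\<^bsub>A\<^esub> (d \<odot>\<^bsub>A\<^esub> b))) a)"
      using d AF.fx_closed[OF b] by (intro restrict_ext) simp
    then show ?case using V.add[OF add(3,4)] by (simp only:)
  qed
next
  fix u v assume uv: "u \<in> carrier A" "v \<in> carrier A"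
    and V: "(\<lambda>a\<in>carrier A. f (a \<otimes>\<^bsub>A\<^esub> u)) \<in> V" "(\<lambda>a\<in>carrier A. f (a \<otimes>\<^bsub>A\<^esub> v)) \<in> V"
  have "(\<lambda>a\<in>carrier A. f (a \<otimes>\<^bsub>A\<^esub> (u \<oplus>\<^bsub>A\<^esub> v))) =
      (\<lambda>a\<in>carrier A. (\<lambda>a\<in>carrier A. f (a \<otimes>\<^bsub>A\<^esub> u)) a \<oplus>\<^bsub>N\<^esub> (\<lambda>a\<in>carrier A. f (a \<otimes>\<^bsub>A\<^esub> v)) a)"
    using uv by (intro restrict_ext) (simp add: A.A.r_distr V_add[OF f])
  then show "(\<lambda>a\<in>carrier A. f (a \<otimes>\<^bsub>A\<^esub> (u \<oplus>\<^bsub>A\<^esub> v))) \<in> V" using V.add[OF V] by (simp only:)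
qed

lemma V_zero_in: "(\<lambda>a\<in>carrier A. \<zero>\<^bsub>N\<^esub>) \<in> V"
proof -
  have z: "act N b \<zero>\<^bsub>N\<^esub> = \<zero>\<^bsub>N\<^esub>" if "b \<in> B" for b
    by (rule additive_zero[OF N.M.abelian_group_axioms N.M.abelian_group_axioms])
      (use that N.act_add_right[of b] in auto)
  have "gen \<one> \<zero>\<^bsub>N\<^esub> = (\<lambda>a\<in>carrier A. \<zero>\<^bsub>N\<^esub>)"
    unfolding gen_def by (intro restrict_ext) (simp add: z L_closed)
  then show ?thesis using V.gen[of \<one> "\<zero>\<^bsub>N\<^esub>"] by simp
qed

text \<open>The usual left module structure on \<open>Hom_B(A, N)\<close>: algebra elements act by
  right translation of the argument, and scalars by multiplying it.\<close>

definition coind :: "('a, 'c \<Rightarrow> 'v, 'c) alg_module" where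
  "coind = mk_module V (\<lambda>a\<in>carrier A. \<zero>\<^bsub>N\<^esub>) (\<lambda>f g. \<lambda>a\<in>carrier A. f a \<oplus>\<^bsub>N\<^esub> g a)
     (\<lambda>c f. \<lambda>a\<in>carrier A. f (c \<odot>\<^bsub>A\<^esub> a)) (\<lambda>d f. \<lambda>a\<in>carrier A. f (a \<otimes>\<^bsub>A\<^esub> d))"

lemma coind_simps [simp]:
  "carrier coind = V" "\<zero>\<^bsub>coind\<^esub> = (\<lambda>a\<in>carrier A. \<zero>\<^bsub>N\<^esub>)" "f \<oplus>\<^bsub>coind\<^esub> g = (\<lambda>a\<in>carrier A. f a \<oplus>\<^bsub>N\<^esub> g a)"
  "c \<odot>\<^bsub>coind\<^esub> f = (\<lambda>a\<in>carrier A. f (c \<odot>\<^bsub>A\<^esub> a))" "act coind d f = (\<lambda>a\<in>carrier A. f (a \<otimes>\<^bsub>A\<^esub> d))"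
  by (simp_all add: coind_def)

lemma coind_vectorspace: "vectorspace k coind"
proof -
  have G: "abelian_group coind"
  proof (rule abelian_groupI)
    show "\<exists>g \<in> carrier coind. g \<oplus>\<^bsub>coind\<^esub> f = \<zero>\<^bsub>coind\<^esub>" if f: "f \<in> carrier coind" for f
    proof -
      have fV: "f \<in> V" using f by simp
      have "f ((\<ominus> \<one>) \<odot>\<^bsub>A\<^esub> a) \<oplus>\<^bsub>N\<^esub> f a = \<zero>\<^bsub>N\<^esub>" if a: "a \<in> carrier A" for a
        using V_add[OF fV, of "(\<ominus> \<one>) \<odot>\<^bsub>A\<^esub> a" a] a V_zero[OF fV] by (simp add: AF.V.smult_minus_1 AF.V.M.l_neg)
      then show ?thesis using V_smult[OF fV, of "\<ominus> \<one>"]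
        by (intro bexI[of _ "\<lambda>a\<in>carrier A. f ((\<ominus> \<one>) \<odot>\<^bsub>A\<^esub> a)"]) (auto intro!: restrict_ext)
    qed
    show "\<zero>\<^bsub>coind\<^esub> \<oplus>\<^bsub>coind\<^esub> f = f" if f: "f \<in> carrier coind" for f
      unfolding coind_simps by (rule V_eqI) (use f V_closed in auto)
  qed (auto simp: V.add V_zero_in V_closed N.M.a_ac intro!: restrict_ext)
  have "Module.module k coind"
  proof (rule moduleI)
    show "\<one> \<odot>\<^bsub>coind\<^esub> f = f" if f: "f \<in> carrier coind" for f
      unfolding coind_simps by (rule V_eqI) (use f in auto)
    show "(c \<otimes> d) \<odot>\<^bsub>coind\<^esub> f = c \<odot>\<^bsub>coind\<^esub> (d \<odot>\<^bsub>coind\<^esub> f)" if "c \<in> carrier k" "d \<in> carrier k" "f \<in> carrier coind" for c d f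
      unfolding coind_simps by (rule restrict_ext) (use that in \<open>simp add: AF.V.smult_assoc1[symmetric] AF.m_comm\<close>)
  qed (use G AF.is_cring in \<open>auto simp: V_smult V_add AF.V.smult_l_distr intro!: restrict_ext\<close>)
  then show ?thesis by (simp add: vectorspace_def AF.field_axioms)
qed

text \<open>\<open>N\<close> is finite, so the functions \<open>gen 1 x\<close> form a finite
  spanning set.\<close>

lemma coind_fin_dim: "vectorspace.fin_dim k coind"
proof -
  interpret W: vectorspace k coind by (rule coind_vectorspace)
  let ?S = "gen \<one> ` carrier N"
  have fin: "finite ?S" using finite_B_module[OF N.fd_module_axioms] by simp
  have Sc: "?S \<subseteq> carrier coind" using V.gen by auto
  have sub: "LinearCombinations.submodule k (W.span ?S) coind" by (rule W.span_is_submodule[OF Sc])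
  have "f \<in> W.span ?S" if "f \<in> V" for f
    using that
  proof induction
    case (gen c x)
    have "gen c x = c \<odot>\<^bsub>coind\<^esub> gen \<one> x" using gen by (auto simp: gen_def)
    moreover have "gen \<one> x \<in> W.span ?S" using W.in_own_span[OF Sc] gen by blast
    ultimately show ?case using submodule.smult_closed[OF sub gen(1)] by (simp only:)
  next
    case (add f g)
    show ?case using submodule.m_closed[OF sub add(3,4)] by (simp only: coind_simps)
  qed
  then have "W.span ?S = carrier coind" using W.span_is_subset2[OF Sc] by auto
  then show ?thesis unfolding W.fin_dim_def using fin Sc by blast
qed

lemma coind_module: "fd_module k A coind"
proof -
  interpret W: vectorspace k coind by (rule coind_vectorspace)
  show ?thesis
  proof (unfold_locales)
    show "W.fin_dim" by (rule coind_fin_dim)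
    show "act coind \<one>\<^bsub>A\<^esub> f = f" if f: "f \<in> carrier coind" for f
      unfolding coind_simps by (rule V_eqI) (use f in auto)
    show "act coind (a \<otimes>\<^bsub>A\<^esub> b) f = act coind a (act coind b f)" if "a \<in> carrier A" "b \<in> carrier A" "f \<in> carrier coind" for a b f
      unfolding coind_simps by (rule restrict_ext) (use that in \<open>simp add: A.A.m_assoc\<close>)
    show "act coind (c \<odot>\<^bsub>A\<^esub> a) f = c \<odot>\<^bsub>coind\<^esub> act coind a f" if "c \<in> carrier k" "a \<in> carrier A" "f \<in> carrier coind" for c a f
      unfolding coind_simps by (rule restrict_ext) (use that in \<open>simp add: A.smult_mult_left A.smult_mult_right\<close>)
    show "act coind a (c \<odot>\<^bsub>coind\<^esub> f) = c \<odot>\<^bsub>coind\<^esub> act coind a f" if "c \<in> carrier k" "a \<in> carrier A" "f \<in> carrier coind" for c a f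
      unfolding coind_simps by (rule restrict_ext) (use that in \<open>simp add: A.smult_mult_left A.smult_mult_right\<close>)
    show "act coind (a \<oplus>\<^bsub>A\<^esub> b) f = act coind a f \<oplus>\<^bsub>coind\<^esub> act coind b f"
      if "a \<in> carrier A" "b \<in> carrier A" "f \<in> carrier coind" for a b f
      unfolding coind_simps by (rule restrict_ext) (use that in \<open>simp add: A.A.r_distr V_add\<close>)
    show "act coind a (f \<oplus>\<^bsub>coind\<^esub> g) = act coind a f \<oplus>\<^bsub>coind\<^esub> act coind a g"
      if "a \<in> carrier A" "f \<in> carrier coind" "g \<in> carrier coind" for a f g
      unfolding coind_simps by (rule restrict_ext) (use that in simp)
    show "act coind a f \<in> carrier coind" if "a \<in> carrier A" "f \<in> carrier coind" for a f
      using V_act that by simp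
  qed
qed

text \<open>\<open>gen 1\<close> is split by evaluation at \<open>1\<close>, because
  \<open>\<Lambda>\<close> fixes \<open>1\<close>.\<close>

lemma retract_coind: "retract B N coind"
proof (rule retractI)
  show "gen \<one> \<in> act_hom B N coind"
  proof (rule act_homI)
    show "gen \<one> (x \<oplus>\<^bsub>N\<^esub> y) = gen \<one> x \<oplus>\<^bsub>coind\<^esub> gen \<one> y" if "x \<in> carrier N" "y \<in> carrier N" for x y
      unfolding coind_simps gen_def by (rule restrict_ext) (use that N.act_add_right L_closed in simp)
    show "gen \<one> (act N b x) = act coind b (gen \<one> x)" if b: "b \<in> B" and x: "x \<in> carrier N" for b x
      unfolding coind_simps gen_def
    proof (rule restrict_ext)
      fix a assume a: "a \<in> carrier A"
      have bc: "b \<in> carrier A" by (rule AF.fx_closed[OF b])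
      show "act N (\<Lambda> (\<one> \<odot>\<^bsub>A\<^esub> a)) (act N b x) = (\<lambda>a\<in>carrier A. act N (\<Lambda> (\<one> \<odot>\<^bsub>A\<^esub> a)) x) (a \<otimes>\<^bsub>A\<^esub> b)"
        using a bc b x L_right[OF b a] N.act_mult[of "\<Lambda> a" b x] by (simp add: L_closed)
    qed
  qed (auto simp: V.gen)
  show "(\<lambda>f. f \<one>\<^bsub>A\<^esub>) \<in> act_hom B coind N"
  proof (rule act_homI)
    show "act coind b f \<one>\<^bsub>A\<^esub> = act N b (f \<one>\<^bsub>A\<^esub>)" if b: "b \<in> B" and f: "f \<in> carrier coind" for b f
    proof -
      have fV: "f \<in> V" and bc: "b \<in> carrier A" using f AF.fx_closed[OF b] by auto
      show ?thesis using V_left[OF fV b, of "\<one>\<^bsub>A\<^esub>"] bc by simp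
    qed
  qed (auto simp: V_closed)
  show "gen \<one> x \<one>\<^bsub>A\<^esub> = x" if "x \<in> carrier N" for x
    using that N.act_one by (simp add: gen_def L_fixed B_one)
qed

end

context frobenius_algebra
begin

text \<open>The coinduced module may decompose; locality of \<open>N\<close> selects an
  indecomposable summand that still has \<open>N\<close> as a summand over \<open>B\<close>.\<close>

lemma ex_induction:
  fixes N :: "('a, 'v, 'c) alg_module"
  assumes N: "fd_module kF BA N" "indecomposable kF BA N"
  shows "\<exists>M :: ('a, 'c \<Rightarrow> 'v, 'c) alg_module. fd_module k A M \<and> indecomposable k A M \<and> retract B N M"
proof -
  interpret N: fd_module kF BA N by (rule N(1))
  obtain l \<Lambda> where L: "l \<in> carrier k \<rightarrow> Fq" "\<And>v. v \<in> carrier A \<Longrightarrow> \<Lambda> v \<in> B"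
    "\<And>u v. u \<in> carrier A \<Longrightarrow> v \<in> carrier A \<Longrightarrow> \<Lambda> (u \<oplus>\<^bsub>A\<^esub> v) = \<Lambda> u \<oplus>\<^bsub>A\<^esub> \<Lambda> v"
    "\<And>c y. c \<in> carrier k \<Longrightarrow> y \<in> B \<Longrightarrow> \<Lambda> (c \<odot>\<^bsub>A\<^esub> y) = l c \<odot>\<^bsub>A\<^esub> y"
    "\<And>y. y \<in> B \<Longrightarrow> \<Lambda> y = y"
    by (rule AF.ex_projection) (rule that)
  interpret C: coinduced k Fq q A F N l \<Lambda>
    by unfold_locales (fact L(1), rule L, assumption, rule L, assumption+, rule L, assumption+, rule L, assumption)
  interpret U: unital_fd_module k A C.coind by (rule unital[OF C.coind_module])
  obtain Z where Z: "retract B N (C.coind\<lparr>carrier := Z\<rparr>)" "alg_submodule k A Z C.coind"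
    "indecomposable k A (C.coind\<lparr>carrier := Z\<rparr>)"
    using U.local_indecomposable_summand[OF indecomposable_B_local[OF N] B_sub C.retract_coind] by blast
  show ?thesis using Z(1,3) U.fd_submodule[OF Z(2)] by blast
qed

end

subsection \<open>Isomorphism classes\<close>

lemma alg_module_iso_refl: "alg_module_iso K A M M \<noteq> {}"
proof -
  have "(\<lambda>x. x) \<in> alg_module_iso K A M M"
    by (auto simp: alg_module_iso_def module_hom_def bij_betw_def)
  then show ?thesis by blast
qed

lemma alg_module_iso_trans:
  assumes "alg_module_iso K A M N \<noteq> {}" "alg_module_iso K A N L \<noteq> {}"
  shows "alg_module_iso K A M L \<noteq> {}"
proof -
  obtain f g where fg: "f \<in> alg_module_iso K A M N" "g \<in> alg_module_iso K A N L" using assms by blast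
  then have b: "bij_betw f (carrier M) (carrier N)" "bij_betw g (carrier N) (carrier L)"
    by (auto simp: alg_module_iso_def)
  have "g \<circ> f \<in> alg_module_iso K A M L"
    unfolding alg_module_iso_def module_hom_def
    using bij_betw_trans[OF b] fg by (auto simp: alg_module_iso_def module_hom_def Pi_iff)
  then show ?thesis by blast
qed

lemma alg_module_iso_sym:
  assumes "unital_fd_module K A M" "unital_fd_module K A N" "alg_module_iso K A M N \<noteq> {}"
  shows "alg_module_iso K A N M \<noteq> {}"
proof -
  interpret M: unital_fd_module K A M by fact
  interpret N: unital_fd_module K A N by fact
  obtain f where f: "f \<in> alg_module_iso K A M N" using assms by blast
  note D = alg_module_isoD[OF f]
  have "inv_into (carrier M) f \<in> alg_module_iso K A N M"
    by (rule N.act_hom_bij_iso[OF M.unital_fd_module_axioms act_hom_inv[OF D M.M.abelian_group_axioms M.act_closed] bij_betw_inv_into[OF D(2)]])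
  then show ?thesis by blast
qed

lemma iso_class_eqI:
  assumes "unital_fd_module K A M" "unital_fd_module K A N" "alg_module_iso K A M N \<noteq> {}"
  shows "iso_class K A M = iso_class K A N"
  using alg_module_iso_trans assms(3) alg_module_iso_sym[OF assms] unfolding iso_class_def by blast

lemma iso_class_eqD:
  assumes "fd_module K A N" "iso_class K A M = iso_class K A N"
  shows "alg_module_iso K A M N \<noteq> {}"
proof -
  have "N \<in> iso_class K A N" using assms(1) alg_module_iso_refl by (simp add: iso_class_def)
  then show ?thesis unfolding assms(2)[symmetric] by (simp add: iso_class_def)
qed

lemma retract_of_iso:
  assumes "unital_fd_module K A M" "S \<subseteq> carrier A" "alg_module_iso K A M N \<noteq> {}"
  shows "retract S M N" "retract S N M"
proof -
  interpret M: unital_fd_module K A M by fact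
  obtain f where f: "f \<in> alg_module_iso K A M N" using assms by blast
  note r = retract_iso[OF alg_module_isoD[OF f] M.M.abelian_group_axioms M.act_closed]
  show "retract S M N" by (rule retract_mono[OF assms(2) r(1)])
  show "retract S N M" by (rule retract_mono[OF assms(2) r(2)])
qed

text \<open>Transport of structure along an injection. It brings modules built on function types to
  the type on which isomorphism classes are taken.\<close>

lemma ex_transport:
  fixes M :: "('k, 'm, 'a) alg_module" and h :: "'m \<Rightarrow> 'n"
  assumes M: "unital_fd_module K A M" and h: "inj_on h (carrier M)"
  shows "\<exists>N :: ('k, 'n, 'a) alg_module. fd_module K A N \<and> alg_module_iso K A M N \<noteq> {}"
proof -
  interpret M: unital_fd_module K A M by fact
  define g where "g = inv_into (carrier M) h"
  define N :: "('k, 'n, 'a) alg_module" where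
    "N = mk_module (h ` carrier M) (h \<zero>\<^bsub>M\<^esub>) (\<lambda>x y. h (g x \<oplus>\<^bsub>M\<^esub> g y)) (\<lambda>c x. h (c \<odot>\<^bsub>M\<^esub> g x)) (\<lambda>a x. h (act M a (g x)))"
  have gh [simp]: "g (h x) = x" if "x \<in> carrier M" for x using h that by (simp add: g_def)
  have G: "abelian_group N"
  proof (rule abelian_groupI)
    show "\<exists>y \<in> carrier N. y \<oplus>\<^bsub>N\<^esub> x = \<zero>\<^bsub>N\<^esub>" if "x \<in> carrier N" for x
    proof -
      obtain x' where "x' \<in> carrier M" "x = h x'" using \<open>x \<in> carrier N\<close> by (auto simp: N_def)
      then show ?thesis by (intro bexI[of _ "h (\<ominus>\<^bsub>M\<^esub> x')"]) (auto simp: N_def M.M.l_neg)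
    qed
  qed (auto simp: N_def M.M.a_ac)
  have "Module.module K N"
    by (rule moduleI) (use G M.is_cring in \<open>auto simp: N_def M.smult_l_distr M.smult_r_distr M.smult_assoc1\<close>)
  then have V: "vectorspace K N" by (simp add: vectorspace_def M.field_axioms)
  interpret N: vectorspace K N by (rule V)
  have fd: "N.fin_dim"
    by (rule fin_dim_surj[OF M.vectorspace_axioms V M.finite_dimensional, of h]) (auto simp: N_def module_hom_def)
  have "fd_module K A N"
    by (unfold_locales)
      (use fd in \<open>auto simp: N_def M.act_closed M.act_add_left M.act_add_right M.act_smult_left
        M.act_smult_right M.act_mult M.act_one\<close>)
  moreover have "h \<in> alg_module_iso K A M N"
    using h by (auto simp: alg_module_iso_def module_hom_def N_def bij_betw_def)
  ultimately show ?thesis by blast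
qed

lemma indecomposable_iso:
  assumes "unital_fd_module K A M" "unital_fd_module K A N" "alg_module_iso K A M N \<noteq> {}" "indecomposable K A M"
  shows "indecomposable K A N"
proof -
  obtain f where f: "f \<in> alg_module_iso K A M N" using assms by blast
  note D = alg_module_isoD[OF f]
  show ?thesis
    by (rule indecomposable_transfer[OF assms(1,2) D(2), of "\<lambda>a. a"])
      (use act_homD(3,4)[OF D(1)] assms(4) in auto)
qed

lemma ex_inj_into_infinite:
  assumes "countable S" shows "\<exists>h :: 'm \<Rightarrow> 'n :: infinite. inj_on h S"
proof -
  obtain f :: "nat \<Rightarrow> 'n" where f: "inj f" using infinite_countable_subset[OF infinite_UNIV] by blast
  have "inj_on (f \<circ> to_nat_on S) S"
    using f inj_on_to_nat_on[OF assms] by (auto intro: comp_inj_on inj_on_subset)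
  then show ?thesis by blast
qed

subsection \<open>The correspondence\<close>

context frobenius_algebra
begin

lemma twist_iso:
  assumes M: "fd_module k A M" and fr: "frobenius_space k Fq q M \<phi>"
    and M': "fd_module k A M'" and fr': "frobenius_space k Fq q M' \<phi>'"
    and iso: "alg_module_iso k A M M' \<noteq> {}"
  shows "alg_module_iso k A (twist A F \<phi> M) (twist A F \<phi>' M') \<noteq> {}"
proof -
  interpret M\<phi>: frobenius_space k Fq q M \<phi> by fact
  interpret M\<phi>': frobenius_space k Fq q M' \<phi>' by fact
  interpret T: unital_fd_module k A "twist A F \<phi> M" by (rule unital[OF twist_module[OF M fr]])
  obtain f where f: "f \<in> alg_module_iso k A M M'" using iso by blast
  note D = alg_module_isoD[OF f]
  have "bij_betw (\<phi>' \<circ> (f \<circ> inv_into (carrier M) \<phi>)) (carrier M) (carrier M')"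
    by (rule bij_betw_trans[OF bij_betw_trans[OF bij_betw_inv_into[OF M\<phi>.phi_bij] D(2)] M\<phi>'.phi_bij])
  then have "bij_betw (\<lambda>x. \<phi>' (f (inv_into (carrier M) \<phi> x))) (carrier (twist A F \<phi> M)) (carrier (twist A F \<phi>' M'))"
    by (simp add: comp_def)
  from T.act_hom_bij_iso[OF unital[OF twist_module[OF M' fr']] twist_hom[OF M fr fr' D(1)] this]
  show ?thesis by blast
qed

text \<open>By \<open>twist_iso\<close>, any other representative with any other Frobenius map has
  an isomorphic twist, so all members of the union that defines \<open>twist_class\<close> are one
  and the same class.\<close>

lemma twist_class_iso_class:
  fixes M :: "('a, 'u, 'c) alg_module"
  assumes M: "fd_module k A M" and fr: "frobenius_space k Fq q M \<phi>"
  shows "twist_class k Fq A F (iso_class k A M) = iso_class k A (twist A F \<phi> M)"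
proof
  interpret M\<phi>: frobenius_space k Fq q M \<phi> by fact
  have eq: "iso_class k A (twist A F \<phi>' M') = iso_class k A (twist A F \<phi> M)"
    if "M' \<in> iso_class k A M" "\<phi>' \<in> frobenius_map k Fq M'" for M' \<phi>'
  proof -
    have M': "fd_module k A M'" and iso: "alg_module_iso k A M M' \<noteq> {}" using that(1) by (auto simp: iso_class_def)
    interpret M': fd_module k A M' by (rule M')
    have fr': "frobenius_space k Fq q M' \<phi>'"
      by (rule AF.frobenius_spaceI[OF M'.vectorspace_axioms M'.finite_dimensional that(2)])
    show ?thesis
      by (rule iso_class_eqI[symmetric, OF unital[OF twist_module[OF M fr]] unital[OF twist_module[OF M' fr']]
        twist_iso[OF M fr M' fr' iso]])
  qed
  show "twist_class k Fq A F (iso_class k A M) \<subseteq> iso_class k A (twist A F \<phi> M)"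
    unfolding twist_class_def using eq by blast
  have "M \<in> iso_class k A M" using M alg_module_iso_refl by (simp add: iso_class_def)
  then show "iso_class k A (twist A F \<phi> M) \<subseteq> twist_class k Fq A F (iso_class k A M)"
    unfolding twist_class_def using M\<phi>.phi_frobenius_map by blast
qed

lemma twist_class_funpow:
  assumes M: "fd_module k A M" and fr: "frobenius_space k Fq q M \<phi>"
  shows "(twist_class k Fq A F ^^ i) (iso_class k A M) = iso_class k A (tw \<phi> i M)"
proof (induction i)
  case (Suc i)
  show ?case using twist_class_iso_class[OF tw_module[OF M fr, of i]] Suc by simp
qed simp

definition correspondence ::
  "('a, 'n, 'c) alg_module set \<Rightarrow> ('a, 'm, 'c) alg_module set set" where
  "correspondence C = {iso_class k A M | M. fd_module k A M \<and> indecomposable k A M \<and> (\<exists>N \<in> C. retract B N M)}"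

lemma iso_retract_B:
  assumes "fd_module kF BA N" "alg_module_iso kF BA N N' \<noteq> {}"
  shows "retract B N N'" "retract B N' N"
  using retract_of_iso[OF unital_B[OF assms(1)] _ assms(2), of B] by simp_all

text \<open>Any one \<open>M0\<close> above \<open>N\<close> describes all the others. They lie in
  its orbit by \<open>common_restriction\<close>, which always finds a nonnegative power of the
  twist; conversely, restriction to \<open>B\<close> does not distinguish a module from its twists,
  in either direction.\<close>

lemma correspondence_orbit:
  fixes N :: "('a, 'n, 'c) alg_module" and M0 :: "('a, 'm, 'c) alg_module"
  assumes N: "fd_module kF BA N" "indecomposable kF BA N"
    and M0: "fd_module k A M0" "indecomposable k A M0" and R: "retract B N M0"
  shows "correspondence (iso_class kF BA N) =
    {y \<in> indec_classes k A. \<exists>i. (twist_class k Fq A F ^^ i) (iso_class k A M0) = y \<or>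
      (twist_class k Fq A F ^^ i) y = iso_class k A M0}" (is "_ = ?O")
proof
  interpret M0: fd_module k A M0 by (rule M0(1))
  obtain \<phi> where fr: "frobenius_space k Fq q M0 \<phi>"
    using AF.ex_frobenius_map[OF M0.vectorspace_axioms M0.finite_dimensional] by blast
  show "correspondence (iso_class kF BA N) \<subseteq> ?O"
  proof
    fix y :: "('a, 'm, 'c) alg_module set"
    assume "y \<in> correspondence (iso_class kF BA N)"
    then obtain M :: "('a, 'm, 'c) alg_module" and N' :: "('a, 'n, 'c) alg_module"
      where M: "y = iso_class k A M" "fd_module k A M" "indecomposable k A M"
        and N': "N' \<in> iso_class kF BA N" "retract B N' M"
      unfolding correspondence_def by blast
    have "alg_module_iso kF BA N N' \<noteq> {}" using N'(1) by (simp add: iso_class_def)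
    then have "retract B N M" using retract_trans[OF iso_retract_B(1)[OF N(1)] N'(2)] by blast
    from common_restriction[OF N M(2,3) M0 fr this R] obtain i where i: "alg_module_iso k A M (tw \<phi> i M0) \<noteq> {}" by blast
    have "y = (twist_class k Fq A F ^^ i) (iso_class k A M0)"
      unfolding M(1) twist_class_funpow[OF M0(1) fr]
      by (rule iso_class_eqI[OF unital[OF M(2)] unital[OF tw_module(1)[OF M0(1) fr]] i])
    moreover have "y \<in> indec_classes k A" unfolding indec_classes_def using M by blast
    ultimately show "y \<in> ?O" by blast
  qed
  show "?O \<subseteq> correspondence (iso_class kF BA N)"
  proof
    fix y assume y: "y \<in> ?O"
    then obtain M where M: "y = iso_class k A M" "fd_module k A M" "indecomposable k A M"
      unfolding indec_classes_def by blast
    interpret M: fd_module k A M by (rule M(2))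
    obtain \<psi> where fr': "frobenius_space k Fq q M \<psi>"
      using AF.ex_frobenius_map[OF M.vectorspace_axioms M.finite_dimensional] by blast
    from y obtain i where "(twist_class k Fq A F ^^ i) (iso_class k A M0) = iso_class k A M \<or>
      (twist_class k Fq A F ^^ i) (iso_class k A M) = iso_class k A M0" unfolding M(1) by blast
    then have "retract B M0 M"
    proof
      assume "(twist_class k Fq A F ^^ i) (iso_class k A M0) = iso_class k A M"
      then have "alg_module_iso k A (tw \<phi> i M0) M \<noteq> {}"
        unfolding twist_class_funpow[OF M0(1) fr] by (rule iso_class_eqD[OF M(2)])
      then have "retract B (tw \<phi> i M0) M"
        by (rule retract_of_iso(1)[OF unital[OF tw_module(1)[OF M0(1) fr]] B_sub])
      then show ?thesis by (rule retract_trans[OF tw_restrict(1)[OF M0(1) fr]])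
    next
      assume "(twist_class k Fq A F ^^ i) (iso_class k A M) = iso_class k A M0"
      then have "alg_module_iso k A (tw \<psi> i M) M0 \<noteq> {}"
        unfolding twist_class_funpow[OF M(2) fr'] by (rule iso_class_eqD[OF M0(1)])
      then have "retract B M0 (tw \<psi> i M)"
        by (rule retract_of_iso(2)[OF unital[OF tw_module(1)[OF M(2) fr']] B_sub])
      then show ?thesis by (rule retract_trans[OF _ tw_restrict(2)[OF M(2) fr']])
    qed
    then have "retract B N M" by (rule retract_trans[OF R])
    moreover have "N \<in> iso_class kF BA N" using N(1) alg_module_iso_refl by (simp add: iso_class_def)
    ultimately show "y \<in> correspondence (iso_class kF BA N)"
      unfolding correspondence_def using M by blast
  qed
qed

text \<open>The module of \<open>ex_induction\<close> lives on functions
  \<open>'c \<Rightarrow> 'n\<close>; being countable, it has a copy on any infinite type.\<close>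

lemma ex_induction_infinite:
  fixes N :: "('a, 'n, 'c) alg_module"
  assumes N: "fd_module kF BA N" "indecomposable kF BA N"
  obtains M :: "('a, 'm :: infinite, 'c) alg_module"
  where "fd_module k A M" "indecomposable k A M" "retract B N M"
proof -
  obtain M :: "('a, 'c \<Rightarrow> 'n, 'c) alg_module" where M: "fd_module k A M" "indecomposable k A M" "retract B N M"
    using ex_induction[OF N] by blast
  interpret M: fd_module k A M by (rule M(1))
  obtain h :: "('c \<Rightarrow> 'n) \<Rightarrow> 'm" where "inj_on h (carrier M)"
    using ex_inj_into_infinite[OF AF.countable_vectorspace[OF M.vectorspace_axioms M.finite_dimensional]] by blast
  then obtain M' :: "('a, 'm, 'c) alg_module" where M': "fd_module k A M'" "alg_module_iso k A M M' \<noteq> {}"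
    using ex_transport[OF unital[OF M(1)]] by blast
  show thesis
    by (rule that[OF M'(1) indecomposable_iso[OF unital[OF M(1)] unital[OF M'(1)] M'(2) M(2)]
      retract_trans[OF M(3) retract_of_iso(1)[OF unital[OF M(1)] B_sub M'(2)]]])
qed

lemma ex_restriction_infinite:
  fixes M :: "('a, 'm, 'c) alg_module"
  assumes M: "fd_module k A M" "indecomposable k A M"
  obtains N :: "('a, 'n :: infinite, 'c) alg_module"
  where "fd_module kF BA N" "indecomposable kF BA N" "retract B N M"
proof -
  obtain N :: "('a, nat \<Rightarrow> 'm, 'c) alg_module" where N: "fd_module kF BA N" "indecomposable kF BA N" "retract B N M"
    using ex_restriction[OF M] by blast
  obtain h :: "(nat \<Rightarrow> 'm) \<Rightarrow> 'n" where "inj_on h (carrier N)"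
    using ex_inj_into_infinite[OF countable_finite[OF finite_B_module[OF N(1)]]] by blast
  then obtain N' :: "('a, 'n, 'c) alg_module" where N': "fd_module kF BA N'" "alg_module_iso kF BA N N' \<noteq> {}"
    using ex_transport[OF unital_B[OF N(1)]] by blast
  show thesis
    by (rule that[OF N'(1) indecomposable_iso[OF unital_B[OF N(1)] unital_B[OF N'(1)] N'(2) N(2)]
      retract_trans[OF iso_retract_B(2)[OF N(1) N'(2)] N(3)]])
qed

lemma bij_betw_correspondence:
  "bij_betw (correspondence :: ('a, 'n :: infinite, 'c) alg_module set \<Rightarrow> ('a, 'm :: infinite, 'c) alg_module set set)
    (indec_classes kF BA) (frobenius_orbits k Fq A F)"
proof -
  let ?P = "correspondence :: ('a, 'n, 'c) alg_module set \<Rightarrow> ('a, 'm, 'c) alg_module set set"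
  have into: "?P C \<in> frobenius_orbits k Fq A F" if C: "C \<in> indec_classes kF BA" for C
  proof -
    obtain N :: "('a, 'n, 'c) alg_module" where N: "C = iso_class kF BA N" "fd_module kF BA N" "indecomposable kF BA N"
      using C unfolding indec_classes_def by blast
    obtain M :: "('a, 'm, 'c) alg_module" where M: "fd_module k A M" "indecomposable k A M" "retract B N M"
      by (rule ex_induction_infinite[OF N(2,3)])
    have "iso_class k A M \<in> indec_classes k A" unfolding indec_classes_def using M by blast
    then show ?thesis
      unfolding N(1) correspondence_orbit[OF N(2,3) M] frobenius_orbits_def permutation_orbits_def by blast
  qed
  have inj: "C = C'" if C: "C \<in> indec_classes kF BA" "C' \<in> indec_classes kF BA" "?P C = ?P C'" for C C'
  proof -
    obtain N :: "('a, 'n, 'c) alg_module" where N: "C = iso_class kF BA N" "fd_module kF BA N" "indecomposable kF BA N"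
      using C(1) unfolding indec_classes_def by blast
    obtain N' :: "('a, 'n, 'c) alg_module" where N': "C' = iso_class kF BA N'" "fd_module kF BA N'" "indecomposable kF BA N'"
      using C(2) unfolding indec_classes_def by blast
    obtain M :: "('a, 'm, 'c) alg_module" where M: "fd_module k A M" "indecomposable k A M" "retract B N M"
      by (rule ex_induction_infinite[OF N(2,3)])
    have "N \<in> C" unfolding N(1) using N(2) alg_module_iso_refl by (simp add: iso_class_def)
    then have "iso_class k A M \<in> ?P C" unfolding correspondence_def using M by blast
    then have "iso_class k A M \<in> ?P C'" unfolding C(3) .
    then obtain M' :: "('a, 'm, 'c) alg_module" and N'' :: "('a, 'n, 'c) alg_module"
      where M': "iso_class k A M = iso_class k A M'" "fd_module k A M'" "N'' \<in> C'" "retract B N'' M'"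
      unfolding correspondence_def by blast
    have "alg_module_iso kF BA N' N'' \<noteq> {}" using M'(3) by (simp add: N'(1) iso_class_def)
    then have "retract B N' N''" by (rule iso_retract_B(1)[OF N'(2)])
    moreover have "retract B M' M"
      by (rule retract_of_iso(2)[OF unital[OF M(1)] B_sub iso_class_eqD[OF M'(2,1)]])
    ultimately have "retract B N' M" using M'(4) retract_trans[OF retract_trans] by blast
    \<comment> \<open>\<open>N\<close> and \<open>N'\<close> are now both summands of the
      restriction of one \<open>M\<close>, so \<open>restriction_unique\<close> applies; between
      indecomposable modules a retract is an isomorphism.\<close>
    then have r: "retract B N' N" by (rule restriction_unique[OF N(2,3) N'(2,3) M])
    interpret N: unital_fd_module kF BA N by (rule unital_B[OF N(2)])
    interpret N': unital_fd_module kF BA N' by (rule unital_B[OF N'(2)])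
    obtain i p where ip: "i \<in> act_hom (carrier BA) N' N" "p \<in> act_hom (carrier BA) N N'" "\<And>x. x \<in> carrier N' \<Longrightarrow> p (i x) = x"
      using r by (auto simp: retract_def)
    have "carrier N' \<noteq> {\<zero>\<^bsub>N'\<^esub>}" using N'(3) by (simp add: indecomposable_def)
    from N.retract_indecomposable_bij[OF N(3) N'(2) this ip]
    have "alg_module_iso kF BA N' N \<noteq> {}"
      using N'.act_hom_bij_iso[OF N.unital_fd_module_axioms ip(1)] by blast
    then have "iso_class kF BA N' = iso_class kF BA N"
      by (rule iso_class_eqI[OF N'.unital_fd_module_axioms N.unital_fd_module_axioms])
    then show ?thesis by (simp add: N(1) N'(1))
  qed
  have surj: "\<exists>C \<in> indec_classes kF BA. ?P C = orb" if orb: "orb \<in> frobenius_orbits k Fq A F" for orb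
  proof -
    obtain x where x: "x \<in> indec_classes k A"
      "orb = {y \<in> indec_classes k A. \<exists>i. (twist_class k Fq A F ^^ i) x = y \<or> (twist_class k Fq A F ^^ i) y = x}"
      using orb unfolding frobenius_orbits_def permutation_orbits_def by blast
    obtain M :: "('a, 'm, 'c) alg_module" where M: "x = iso_class k A M" "fd_module k A M" "indecomposable k A M"
      using x(1) unfolding indec_classes_def by blast
    obtain N :: "('a, 'n, 'c) alg_module" where N: "fd_module kF BA N" "indecomposable kF BA N" "retract B N M"
      by (rule ex_restriction_infinite[OF M(2,3)])
    have "?P (iso_class kF BA N) = orb" unfolding x(2) M(1) by (rule correspondence_orbit[OF N(1,2) M(2,3) N(3)])
    moreover have "iso_class kF BA N \<in> indec_classes kF BA" unfolding indec_classes_def using N by blast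
    ultimately show ?thesis by blast
  qed
  show ?thesis unfolding bij_betw_def inj_on_def using into inj surj by blast
qed

end

text \<open>\<open>1\<close> acts both as the identity and as \<open>z + z\<close>, so
  \<open>m = m + m\<close>. The zero algebra is treated apart because there \<open>F\<close> carries
  no information on \<open>c \<mapsto> c^q\<close>. Stated through \<open>z\<close>, the argument
  applies alike to \<open>A\<close> and to its fixed points.\<close>

lemma trivial_algebra_no_indecomposables:
  assumes "\<one>\<^bsub>A\<^esub> = z" "z \<in> carrier A" "z \<oplus>\<^bsub>A\<^esub> z = z"
  shows "indec_classes K A = {}"
proof -
  have "carrier M = {\<zero>\<^bsub>M\<^esub>}" if "fd_module K A M" for M
  proof -
    interpret M: fd_module K A M by fact
    have "m = \<zero>\<^bsub>M\<^esub>" if m: "m \<in> carrier M" for m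
    proof -
      have "act M z m = m" using M.act_one[OF m] assms(1) by simp
      then have "m = m \<oplus>\<^bsub>M\<^esub> m" using M.act_add_left[OF assms(2,2) m] assms(3) by simp
      then show ?thesis using m by (metis M.M.add.l_cancel_one')
    qed
    then show ?thesis using M.M.zero_closed by blast
  qed
  then show ?thesis unfolding indec_classes_def indecomposable_def by blast
qed

text \<open>
  That \<open>c \<mapsto> c\<^sup>q\<close> is additive, of finite order on each element and trivial on \<open>Fq\<close> is read off from
  \<open>F\<close> on the line \<open>k 1\<close> of \<open>A\<close>.
\<close>

lemma frobenius_algebraI:
  fixes k :: "'k ring" and A :: "('k, 'a) module"
  assumes q: "primepow q" and k: "algebraic_closure k Fq" and card: "card Fq = q"
    and A: "fd_algebra k A" and F: "F \<in> frobenius_morphism k Fq A" and nt: "\<one>\<^bsub>A\<^esub> \<noteq> \<zero>\<^bsub>A\<^esub>"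
  shows "frobenius_algebra k Fq q A F"
proof -
  interpret k: algebraic_closure k Fq by fact
  interpret A: fd_algebra k A by fact
  have Fq: "x \<in> carrier k" if "x \<in> Fq" for x using subfieldE(3)[OF k.subfield_axioms] that by blast
  have Fm: "F \<in> frobenius_map k Fq A" and Fi: "F \<in> ring_hom A A"
    using F by (auto simp: frobenius_morphism_def ring_iso_def)
  have F1: "F \<one>\<^bsub>A\<^esub> = \<one>\<^bsub>A\<^esub>" by (rule ring_hom_one[OF Fi])
  have Fs: "F (c \<odot>\<^bsub>A\<^esub> a) = (c [^]\<^bsub>k\<^esub> q) \<odot>\<^bsub>A\<^esub> F a" if "c \<in> carrier k" "a \<in> carrier A" for c a
    using Fm that card by (simp add: frobenius_map_def)
  \<comment> \<open>\<open>c \<mapsto> c 1\<close> is injective since \<open>1\<close> is nonzero,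
    so identities between scalars can be tested on multiples of \<open>1\<close>, where
    \<open>F\<close> acts by \<open>c \<mapsto> c^q\<close>.\<close>
  have eqI: "c = d" if "c \<odot>\<^bsub>A\<^esub> \<one>\<^bsub>A\<^esub> = d \<odot>\<^bsub>A\<^esub> \<one>\<^bsub>A\<^esub>" "c \<in> carrier k" "d \<in> carrier k" for c d
  proof (rule ccontr)
    assume ne: "c \<noteq> d"
    define e where "e = c \<ominus>\<^bsub>k\<^esub> d"
    have e: "e \<in> carrier k" "e \<noteq> \<zero>\<^bsub>k\<^esub>" unfolding e_def using that ne by simp_all
    have "e \<odot>\<^bsub>A\<^esub> \<one>\<^bsub>A\<^esub> \<oplus>\<^bsub>A\<^esub> d \<odot>\<^bsub>A\<^esub> \<one>\<^bsub>A\<^esub> = (e \<oplus>\<^bsub>k\<^esub> d) \<odot>\<^bsub>A\<^esub> \<one>\<^bsub>A\<^esub>"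
      using e that by (simp add: A.smult_l_distr)
    also have "e \<oplus>\<^bsub>k\<^esub> d = c" unfolding e_def by (rule k.diff_add_cancel[OF that(2,3)])
    finally have "e \<odot>\<^bsub>A\<^esub> \<one>\<^bsub>A\<^esub> \<oplus>\<^bsub>A\<^esub> d \<odot>\<^bsub>A\<^esub> \<one>\<^bsub>A\<^esub> = d \<odot>\<^bsub>A\<^esub> \<one>\<^bsub>A\<^esub>" using that(1) by simp
    then have z: "e \<odot>\<^bsub>A\<^esub> \<one>\<^bsub>A\<^esub> = \<zero>\<^bsub>A\<^esub>" using e that by (simp add: A.M.add.r_cancel_one)
    have i: "inv\<^bsub>k\<^esub> e \<in> carrier k" "inv\<^bsub>k\<^esub> e \<otimes>\<^bsub>k\<^esub> e = \<one>\<^bsub>k\<^esub>" using e by (auto simp: k.field_Units)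
    have "\<one>\<^bsub>A\<^esub> = inv\<^bsub>k\<^esub> e \<odot>\<^bsub>A\<^esub> (e \<odot>\<^bsub>A\<^esub> \<one>\<^bsub>A\<^esub>)"
      using i e by (simp add: A.smult_assoc1[symmetric])
    then show False using nt i by (simp add: z)
  qed
  have padd: "(x \<oplus>\<^bsub>k\<^esub> y) [^]\<^bsub>k\<^esub> q = x [^]\<^bsub>k\<^esub> q \<oplus>\<^bsub>k\<^esub> y [^]\<^bsub>k\<^esub> q" if xy: "x \<in> carrier k" "y \<in> carrier k" for x y
  proof (rule eqI)
    have "F ((x \<oplus>\<^bsub>k\<^esub> y) \<odot>\<^bsub>A\<^esub> \<one>\<^bsub>A\<^esub>) = F (x \<odot>\<^bsub>A\<^esub> \<one>\<^bsub>A\<^esub>) \<oplus>\<^bsub>A\<^esub> F (y \<odot>\<^bsub>A\<^esub> \<one>\<^bsub>A\<^esub>)"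
      using xy ring_hom_add[OF Fi] by (simp add: A.smult_l_distr)
    moreover have "F ((x \<oplus>\<^bsub>k\<^esub> y) \<odot>\<^bsub>A\<^esub> \<one>\<^bsub>A\<^esub>) = ((x \<oplus>\<^bsub>k\<^esub> y) [^]\<^bsub>k\<^esub> q) \<odot>\<^bsub>A\<^esub> \<one>\<^bsub>A\<^esub>"
      using Fs[of "x \<oplus>\<^bsub>k\<^esub> y" "\<one>\<^bsub>A\<^esub>"] xy F1 by simp
    ultimately show "((x \<oplus>\<^bsub>k\<^esub> y) [^]\<^bsub>k\<^esub> q) \<odot>\<^bsub>A\<^esub> \<one>\<^bsub>A\<^esub> = (x [^]\<^bsub>k\<^esub> q \<oplus>\<^bsub>k\<^esub> y [^]\<^bsub>k\<^esub> q) \<odot>\<^bsub>A\<^esub> \<one>\<^bsub>A\<^esub>"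
      using xy by (simp add: Fs F1 A.smult_l_distr)
  qed (use xy in simp_all)
  have Fn: "(F ^^ n) (c \<odot>\<^bsub>A\<^esub> \<one>\<^bsub>A\<^esub>) = ((\<lambda>z. z [^]\<^bsub>k\<^esub> q) ^^ n) c \<odot>\<^bsub>A\<^esub> \<one>\<^bsub>A\<^esub> \<and> ((\<lambda>z. z [^]\<^bsub>k\<^esub> q) ^^ n) c \<in> carrier k"
    if "c \<in> carrier k" for n c
    by (induction n) (use that in \<open>auto simp: Fs F1\<close>)
  interpret kf: finite_field_closure k Fq q
  proof (unfold_locales)
    show "card Fq = q" by (rule card)
    show "q > 0" using q by (rule primepow_gt_0_nat)
    show "\<exists>n>0. ((\<lambda>z. z [^]\<^bsub>k\<^esub> q) ^^ n) x = x" if x: "x \<in> carrier k" for x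
    proof -
      obtain n where n: "n > 0" "(F ^^ n) (x \<odot>\<^bsub>A\<^esub> \<one>\<^bsub>A\<^esub>) = x \<odot>\<^bsub>A\<^esub> \<one>\<^bsub>A\<^esub>"
      proof -
        have "\<forall>v \<in> carrier A. \<exists>n > 0. (F ^^ n) v = v" using Fm by (simp add: frobenius_map_def)
        then show thesis using that x A.smult_closed[OF x A.A.one_closed] by blast
      qed
      have "((\<lambda>z. z [^]\<^bsub>k\<^esub> q) ^^ n) x = x"
      proof (rule eqI)
        show "((\<lambda>z. z [^]\<^bsub>k\<^esub> q) ^^ n) x \<odot>\<^bsub>A\<^esub> \<one>\<^bsub>A\<^esub> = x \<odot>\<^bsub>A\<^esub> \<one>\<^bsub>A\<^esub>"
          using Fn[OF x, of n] n(2) by metis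
        show "((\<lambda>z. z [^]\<^bsub>k\<^esub> q) ^^ n) x \<in> carrier k" using Fn[OF x, of n] by blast
      qed (rule x)
      then show ?thesis using n by blast
    qed
    show "x [^]\<^bsub>k\<^esub> q = x" if x: "x \<in> Fq" for x
    proof (rule eqI)
      have "F (x \<odot>\<^bsub>A\<^esub> \<one>\<^bsub>A\<^esub>) = x \<odot>\<^bsub>A\<^esub> F \<one>\<^bsub>A\<^esub>"
        using Fm x by (simp add: frobenius_map_def module_hom_def)
      then show "(x [^]\<^bsub>k\<^esub> q) \<odot>\<^bsub>A\<^esub> \<one>\<^bsub>A\<^esub> = x \<odot>\<^bsub>A\<^esub> \<one>\<^bsub>A\<^esub>" using Fs[OF Fq[OF x]] F1 by simp
    qed (use Fq[OF x] in simp_all)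
  qed (rule padd)
  interpret FS: frobenius_space k Fq q A F
    by (rule kf.frobenius_spaceI[OF A.vectorspace_axioms A.finite_dimensional Fm])
  show ?thesis
    by (unfold_locales) (use F1 ring_hom_mult[OF Fi] A.finite_dimensional in auto)
qed

theorem corollary5p2:
  fixes k :: "'k ring" and Fq :: "'k set" and q :: nat
    and A :: "('k, 'a) module" and F\<^sub>A :: "'a \<Rightarrow> 'a"
  assumes "primepow q"
    and "algebraic_closure k Fq" and "card Fq = q"
    and "fd_algebra k A"
    and "F\<^sub>A \<in> frobenius_morphism k Fq A"
  shows "\<exists>\<Phi>. bij_betw \<Phi>
    (indec_classes (k\<lparr>carrier := Fq\<rparr>) (fixed_algebra A F\<^sub>A)
       :: ('k, 'n :: infinite, 'a) alg_module set set)
    (frobenius_orbits k Fq A F\<^sub>A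
       :: ('k, 'm :: infinite, 'a) alg_module set set set)"
proof (cases "\<one>\<^bsub>A\<^esub> = \<zero>\<^bsub>A\<^esub>")
  case True
  interpret A: fd_algebra k A by (rule assms(4))
  have "F\<^sub>A \<in> ring_hom A A" using assms(5) by (simp add: frobenius_morphism_def ring_iso_def)
  then have "F\<^sub>A \<one>\<^bsub>A\<^esub> = \<one>\<^bsub>A\<^esub>" by (rule ring_hom_one)
  then have "(indec_classes (k\<lparr>carrier := Fq\<rparr>) (fixed_algebra A F\<^sub>A) :: ('k, 'n, 'a) alg_module set set) = {}"
    by (intro trivial_algebra_no_indecomposables[of _ "\<zero>\<^bsub>A\<^esub>"]) (simp_all add: True fixed_algebra_def)
  moreover have "(indec_classes k A :: ('k, 'm, 'a) alg_module set set) = {}"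
    by (rule trivial_algebra_no_indecomposables[of _ "\<zero>\<^bsub>A\<^esub>"]) (simp_all add: True)
  ultimately show ?thesis
    by (simp add: frobenius_orbits_def permutation_orbits_def bij_betw_def)
next
  case False
  interpret frobenius_algebra k Fq q A F\<^sub>A by (rule frobenius_algebraI[OF assms False])
  show ?thesis by (rule exI[of _ correspondence]) (rule bij_betw_correspondence)
qed

end
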